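(* Fix an integer $k\ge 3$. For every $\varepsilon>0$ there exists $\Delta_0$ such that if $\Delta\ge\Delta_0$, then every $F_k$-free graph $G$ of maximum degree $\Delta$ satisfies $\chi(G)\le (1+\varepsilon)\Delta/\log\Delta$. Moreover, there is a randomised algorithm that, given such a graph $G$, constructs in polynomial time, with high probability, a proper colouring of $G$ with at most $(1+\varepsilon)\Delta/\log\Delta$ colours.
   Context: For $k\ge 3$, the fan $F_k$ is the graph obtained from a path on $k-1$ vertices by adding one new vertex adjacent to all vertices of the path. A graph is $F_k$-free if it contains no subgraph isomorphic to $F_k$. $\chi(G)$ denotes the chromatic number, and $\log$ is the natural logarithm. "With high probability" means with probability tending to $1$ as the number of vertices of $G$ tends to infinity. *)

theory Defs
  imports "HOL-Probability.Probability" "HOL-Computational_Algebra.Polynomial"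
begin

section \<open>Graphs\<close>

record 'a ugraph =
  verts :: "'a set"
  edges :: "'a set set"

definition finite_simple_graph :: "'a ugraph \<Rightarrow> bool" where
  "finite_simple_graph G \<longleftrightarrow>
     finite (verts G) \<and> (\<forall>e\<in>edges G. e \<subseteq> verts G \<and> card e = 2)"

definition vertex_degree :: "'a ugraph \<Rightarrow> 'a \<Rightarrow> nat" where
  "vertex_degree G v = card {u \<in> verts G. {u, v} \<in> edges G}"

definition max_degree :: "'a ugraph \<Rightarrow> nat" where
  "max_degree G = Max (insert 0 (vertex_degree G ` verts G))"

definition subgraph :: "'a ugraph \<Rightarrow> 'a ugraph \<Rightarrow> bool" where
  "subgraph H G \<longleftrightarrow> finite_simple_graph H \<and> verts H \<subseteq> verts G \<and> edges H \<subseteq> edges G"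

definition isomorphic :: "'a ugraph \<Rightarrow> 'b ugraph \<Rightarrow> bool" where
  "isomorphic G H \<longleftrightarrow>
     (\<exists>f. bij_betw f (verts G) (verts H) \<and> edges H = (\<lambda>e. f ` e) ` edges G)"

definition free_of :: "'b ugraph \<Rightarrow> 'a ugraph \<Rightarrow> bool" where
  "free_of F G \<longleftrightarrow> \<not> (\<exists>H. subgraph H G \<and> isomorphic F H)"

definition path_graph :: "nat \<Rightarrow> nat ugraph" where
  "path_graph m = \<lparr>verts = {0..<m}, edges = {{i, Suc i} | i. Suc i < m}\<rparr>"

text \<open>The path occupies \<open>0, \<dots>, k - 2\<close>; the new vertex is \<open>k - 1\<close>.\<close>

definition fan :: "nat \<Rightarrow> nat ugraph" where
  "fan k = (let P = path_graph (k - 1) in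
     \<lparr>verts = insert (k - 1) (verts P),
      edges = edges P \<union> {{v, k - 1} | v. v \<in> verts P}\<rparr>)"

definition proper_colouring :: "'a ugraph \<Rightarrow> ('a \<Rightarrow> nat) \<Rightarrow> bool" where
  "proper_colouring G c \<longleftrightarrow>
     (\<forall>u\<in>verts G. \<forall>v\<in>verts G. {u, v} \<in> edges G \<longrightarrow> c u \<noteq> c v)"

definition num_colours :: "'a ugraph \<Rightarrow> ('a \<Rightarrow> nat) \<Rightarrow> nat" where
  "num_colours G c = card (c ` verts G)"

definition chromatic_number :: "'a ugraph \<Rightarrow> nat" where
  "chromatic_number G = (LEAST m. \<exists>c. proper_colouring G c \<and> num_colours G c = m)"


section \<open>Randomised algorithms\<close>

text \<open>
  Algorithms are programs for a random access machine with fair coin flips. A program mentions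
  finitely many registers, and it has an unbounded memory that is accessed by indirect addressing.
  Registers and memory cells hold natural numbers, and each step costs one unit of time.
  There is no multiplication instruction: \<open>t\<close> steps then lengthen the numbers
  by only \<open>O(t)\<close> bits, so polynomial time on this machine
  is polynomial time on a probabilistic Turing machine.
\<close>

type_synonym reg = nat

datatype com =
    Skip
  | Const reg nat
  | Add reg reg reg
  | Sub reg reg reg
  | Half reg reg
  | Load reg reg
  | Store reg reg
  | Flip reg
  | Seq com com
  | Cond reg com com
  | While reg com

record state =
  regs :: "nat \<Rightarrow> nat"
  mem :: "nat \<Rightarrow> nat"

definition set_reg :: "reg \<Rightarrow> nat \<Rightarrow> state \<Rightarrow> state" where
  "set_reg r x s = s\<lparr>regs := (regs s)(r := x)\<rparr>"

text \<open>
  A configuration consists of the stack of commands still to be executed and the current state.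
  The machine has halted when the stack is empty.
\<close>

type_synonym config = "com list \<times> state"

fun step :: "config \<Rightarrow> config pmf" where
  "step ([], s) = return_pmf ([], s)"
| "step (Skip # K, s) = return_pmf (K, s)"
| "step (Const r x # K, s) = return_pmf (K, set_reg r x s)"
| "step (Add r a b # K, s) = return_pmf (K, set_reg r (regs s a + regs s b) s)"
| "step (Sub r a b # K, s) = return_pmf (K, set_reg r (regs s a - regs s b) s)"
| "step (Half r a # K, s) = return_pmf (K, set_reg r (regs s a div 2) s)"
| "step (Load r a # K, s) = return_pmf (K, set_reg r (mem s (regs s a)) s)"
| "step (Store a r # K, s) = return_pmf (K, s\<lparr>mem := (mem s)(regs s a := regs s r)\<rparr>)"
| "step (Flip r # K, s) = map_pmf (\<lambda>x. (K, set_reg r x s)) (pmf_of_set {0, 1})"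
| "step (Seq p q # K, s) = return_pmf (p # q # K, s)"
| "step (Cond r p q # K, s) = return_pmf ((if regs s r \<noteq> 0 then p else q) # K, s)"
| "step (While r p # K, s) =
     return_pmf (if regs s r \<noteq> 0 then p # While r p # K else K, s)"

primrec run :: "nat \<Rightarrow> config \<Rightarrow> config pmf" where
  "run 0 c = return_pmf c"
| "run (Suc t) c = bind_pmf (step c) (run t)"

definition halted :: "config \<Rightarrow> bool" where
  "halted c \<longleftrightarrow> fst c = []"

text \<open>
  A graph with vertex set \<open>{0..<n}\<close> is given to the machine by \<open>n\<close> in register \<open>0\<close> and
  its adjacency matrix, row by row, in the first \<open>n * n\<close> memory cells.
\<close>

definition input_state :: "nat ugraph \<Rightarrow> state" where
  "input_state G = (let n = card (verts G) in
     \<lparr>regs = (\<lambda>r. if r = 0 then n else 0),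
      mem = (\<lambda>a. if a < n * n \<and> {a div n, a mod n} \<in> edges G then 1 else 0)\<rparr>)"

text \<open>On halting, memory cell \<open>v\<close> holds the colour of vertex \<open>v\<close>.\<close>

definition output_colouring :: "config \<Rightarrow> nat \<Rightarrow> nat" where
  "output_colouring c = mem (snd c)"

definition colouring_prob :: "com \<Rightarrow> nat \<Rightarrow> nat ugraph \<Rightarrow> real \<Rightarrow> real" where
  "colouring_prob A t G q =
     measure_pmf.prob (run t ([A], input_state G))
       {c. halted c \<and> proper_colouring G (output_colouring c) \<and>
           real (num_colours G (output_colouring c)) \<le> q}"

end

theory Submission
  imports Defs "HOL-Library.Discrete_Functions" "HOL-Real_Asymp.Real_Asymp"
begin

text \<open>
  A vertex of a partial proper colouring with \<open>q\<close> colours is flawed if few colours are missing on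
  its neighbourhood, or if many of its neighbours are blank. Starting from the blank colouring, the
  lowest flaw is repaired over and over again by resampling the neighbourhood of its vertex with
  one-vertex updates that are reversible for a product weight on partial colourings. The adjoint of
  a repair is the same resampling with the order of the updates reversed, so the weight that a
  repair transports from the flawed states to any given state is at most \<open>e\<close> times the weight
  of that state, where \<open>e\<close> bounds the probability that a resampling from an arbitrary state
  ends in the flaw. As \<open>e\<close> is much smaller than the inverse of the number of flaws that a repair
  can create, \<open>n\<^sup>2\<close> repairs leave a flaw with probability at most \<open>2\<^sup>-\<^sup>n\<close>. Once there are no
  flaws, the blank vertices are coloured greedily with few extra colours.

  For short lists, the colour classes on the neighbourhood are resampled one after the other.
  Excluding \<open>F\<^sub>k\<close> makes the neighbourhood sparse, so at small activity a colour that many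
  neighbours could still take is taken by about \<open>ln \<Delta>\<close> of them. The degree only
  suffices for about \<open>\<Delta> / ln \<Delta>\<close> such colours, and each of the remaining ones survives
  with probability at least \<open>\<Delta>\<^sup>-\<^sup>1\<^sup>+\<^sup>c\<close>.
\<close>

section \<open>Markov operators and flaw walks\<close>

text \<open>The bounds on a repair have to hold from an arbitrary state, with everything outside the
  neighbourhood frozen, and must fall below the inverse of a multiple of
  \<open>\<Delta>^2 + 1\<close>, as a repair can create flaws up to distance two. For short lists
  the key is a price \<open>\<theta>\<close> per vertex of the neighbourhood that takes a given
  colour. All prices together are at most \<open>\<theta> * \<Delta>\<close>, whereas a colour
  either survives with probability about \<open>\<Delta> powr (- (1 - \<delta>))\<close> or costs
  about \<open>\<theta> * ln \<Delta>\<close>. Taking \<open>\<theta>\<close> as that power divided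
  by \<open>2 * ln \<Delta>\<close> makes both alternatives shrink one exponential moment by the
  same factor, so no colour has to be classified in advance. Slightly more than
  \<open>\<Delta> / ln \<Delta>\<close> such factors beat \<open>exp (\<theta> * \<Delta>)\<close>
  by roughly the exponential of a small power of \<open>\<Delta>\<close>. Expectations are operators
  on functions. The same operators describe the walk, its adjoint and program fragments, so the
  bounds transfer to the machine directly. The machine fixes the form of the randomness: a colour is
  accepted with probability \<open>1 / 2 ^ b\<close>, and colours are drawn below a power of
  two.\<close>

text \<open>A kernel is represented by its action on functions, and \<open>R\<close> bounds where it
  can go. Asking monotonicity only along \<open>R\<close> encodes the support: functions that agree
  on the reachable states have the same expectation.\<close>

definition markov :: "('s \<Rightarrow> 's \<Rightarrow> bool) \<Rightarrow> (('s \<Rightarrow> real) \<Rightarrow> 's \<Rightarrow> real) \<Rightarrow> bool" where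
  "markov R K \<longleftrightarrow>
     (\<forall>\<sigma> f g. (\<forall>\<tau>. R \<sigma> \<tau> \<longrightarrow> f \<tau> \<le> g \<tau>) \<longrightarrow> K f \<sigma> \<le> K g \<sigma>) \<and>
     (\<forall>\<sigma> f g c. K (\<lambda>\<tau>. f \<tau> + c * g \<tau>) \<sigma> = K f \<sigma> + c * K g \<sigma>) \<and>
     (\<forall>\<sigma> c. K (\<lambda>_. c) \<sigma> = c)"

lemma markov_le: "markov R K \<Longrightarrow> (\<And>\<tau>. R \<sigma> \<tau> \<Longrightarrow> f \<tau> \<le> g \<tau>) \<Longrightarrow> K f \<sigma> \<le> K g \<sigma>"
  unfolding markov_def by blast

lemma markov_eq: "markov R K \<Longrightarrow> (\<And>\<tau>. R \<sigma> \<tau> \<Longrightarrow> f \<tau> = g \<tau>) \<Longrightarrow> K f \<sigma> = K g \<sigma>"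
  by (intro antisym markov_le[of R K]) auto

lemma markov_lin: "markov R K \<Longrightarrow> K (\<lambda>\<tau>. f \<tau> + c * g \<tau>) \<sigma> = K f \<sigma> + c * K g \<sigma>"
  unfolding markov_def by blast

lemma markov_const: "markov R K \<Longrightarrow> K (\<lambda>_. c) \<sigma> = c"
  unfolding markov_def by blast

lemma markov_cmult: "markov R K \<Longrightarrow> K (\<lambda>\<tau>. c * g \<tau>) \<sigma> = c * K g \<sigma>"
  using markov_lin[of R K "\<lambda>_. 0" c g \<sigma>] markov_const[of R K 0 \<sigma>] by simp

lemma markov_add: "markov R K \<Longrightarrow> K (\<lambda>\<tau>. f \<tau> + g \<tau>) \<sigma> = K f \<sigma> + K g \<sigma>"
  using markov_lin[of R K f 1 g \<sigma>] by simp

lemma markov_affine: "markov R K \<Longrightarrow> K (\<lambda>\<tau>. a + c * g \<tau>) \<sigma> = a + c * K g \<sigma>"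
  using markov_lin[of R K "\<lambda>_. a" c g \<sigma>] markov_const[of R K a \<sigma>] by simp

lemma markov_sum:
  assumes "markov R K" "finite S"
  shows "K (\<lambda>\<tau>. \<Sum>i\<in>S. f i \<tau>) \<sigma> = (\<Sum>i\<in>S. K (f i) \<sigma>)"
  using assms(2) by (induction S rule: finite_induct) (simp_all add: markov_const[OF assms(1)] markov_add[OF assms(1)])

lemma markov_le_const: "markov R K \<Longrightarrow> (\<And>\<tau>. R \<sigma> \<tau> \<Longrightarrow> f \<tau> \<le> c) \<Longrightarrow> K f \<sigma> \<le> c"
  using markov_le[of R K \<sigma> f "\<lambda>_. c"] markov_const[of R K c \<sigma>] by auto

lemma markov_ge_const: "markov R K \<Longrightarrow> (\<And>\<tau>. R \<sigma> \<tau> \<Longrightarrow> c \<le> f \<tau>) \<Longrightarrow> c \<le> K f \<sigma>"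
  using markov_le[of R K \<sigma> "\<lambda>_. c" f] markov_const[of R K c \<sigma>] by auto

text \<open>A function that the kernel cannot change acts as a constant. This factorises
  expectations over colours and over vertices that are processed one after the other.\<close>

lemma markov_pull:
  assumes "markov R K" "\<And>\<tau>. R \<sigma> \<tau> \<Longrightarrow> g \<tau> = g \<sigma>"
  shows "K (\<lambda>\<tau>. g \<tau> * f \<tau>) \<sigma> = g \<sigma> * K f \<sigma>"
proof -
  have "K (\<lambda>\<tau>. g \<tau> * f \<tau>) \<sigma> = K (\<lambda>\<tau>. g \<sigma> * f \<tau>) \<sigma>"
    by (rule markov_eq[OF assms(1)]) (simp add: assms(2))
  then show ?thesis by (simp add: markov_cmult[OF assms(1)])
qed

lemma markov_fixed:
  assumes "markov R K" "\<And>\<tau>. R \<sigma> \<tau> \<Longrightarrow> g \<tau> = g \<sigma>"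
  shows "K g \<sigma> = g \<sigma>"
  using markov_pull[of R K \<sigma> g "\<lambda>_. 1", OF assms] markov_const[OF assms(1), of 1] by simp

lemma markov_mono: "markov R K \<Longrightarrow> (\<And>\<sigma> \<tau>. R \<sigma> \<tau> \<Longrightarrow> S \<sigma> \<tau>) \<Longrightarrow> markov S K"
  unfolding markov_def by metis

lemma markov_id: "reflp R \<Longrightarrow> markov R (\<lambda>f. f)"
  unfolding markov_def reflp_def by blast

text \<open>\<open>K (L f)\<close> stands for running \<open>K\<close> first and \<open>L\<close>
  second; in \<open>foldr K xs\<close> the head of the list is therefore executed first.\<close>

lemma markov_comp:
  assumes "transp R" "markov R K" "markov R L"
  shows "markov R (\<lambda>f. K (L f))"
  unfolding markov_def
proof (intro conjI allI impI)
  fix \<sigma> and f g :: "_ \<Rightarrow> real" assume le: "\<forall>\<tau>. R \<sigma> \<tau> \<longrightarrow> f \<tau> \<le> g \<tau>"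
  show "K (L f) \<sigma> \<le> K (L g) \<sigma>"
    by (intro markov_le[OF assms(2)] markov_le[OF assms(3)]) (use le assms(1) in \<open>meson transpD\<close>)
next
  fix \<sigma> and f g :: "_ \<Rightarrow> real" and c
  show "K (L (\<lambda>\<tau>. f \<tau> + c * g \<tau>)) \<sigma> = K (L f) \<sigma> + c * K (L g) \<sigma>"
    using markov_lin[OF assms(2), of "L f" c "L g" \<sigma>]
      ext[of "L (\<lambda>\<tau>. f \<tau> + c * g \<tau>)" "\<lambda>\<tau>. L f \<tau> + c * L g \<tau>", OF markov_lin[OF assms(3)]] by metis
next
  fix \<sigma> c show "K (L (\<lambda>_. c)) \<sigma> = c"
    using markov_const[OF assms(3)] markov_const[OF assms(2)] by presburger
qed

lemma markov_foldr:
  assumes "reflp R" "transp R" "\<And>x. x \<in> set xs \<Longrightarrow> markov R (K x)"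
  shows "markov R (foldr K xs)"
  using assms(3)
proof (induction xs)
  case Nil
  show ?case using markov_id[OF assms(1)] by (simp add: id_def)
next
  case (Cons x xs)
  then show ?case using markov_comp[OF assms(2), of "K x" "foldr K xs"] by (simp add: comp_def)
qed

lemma markov_funpow:
  assumes "reflp R" "transp R" "markov R K"
  shows "markov R (K ^^ m)"
  using markov_foldr[OF assms(1,2), of "replicate m ()" "\<lambda>_. K"] assms(3)
  by (simp add: foldr_replicate)

lemma markov_average:
  assumes "finite S" "S \<noteq> {}" "\<And>x. x \<in> S \<Longrightarrow> markov R (K x)"
  shows "markov R (\<lambda>f \<sigma>. (\<Sum>x\<in>S. K x f \<sigma>) / real (card S))"
  unfolding markov_def
proof (intro conjI allI impI)
  have c: "card S \<noteq> 0" using assms(1,2) by simp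
  fix \<sigma> and f g :: "_ \<Rightarrow> real" 
  { assume le: "\<forall>\<tau>. R \<sigma> \<tau> \<longrightarrow> f \<tau> \<le> g \<tau>"
    show "(\<Sum>x\<in>S. K x f \<sigma>) / real (card S) \<le> (\<Sum>x\<in>S. K x g \<sigma>) / real (card S)"
      by (intro divide_right_mono sum_mono markov_le[OF assms(3)]) (use le in auto) }
  fix d :: real
  have "(\<Sum>x\<in>S. K x (\<lambda>\<tau>. f \<tau> + d * g \<tau>) \<sigma>) = (\<Sum>x\<in>S. K x f \<sigma> + d * K x g \<sigma>)"
    by (intro sum.cong refl markov_lin[OF assms(3)])
  then show "(\<Sum>x\<in>S. K x (\<lambda>\<tau>. f \<tau> + d * g \<tau>) \<sigma>) / real (card S) =
      (\<Sum>x\<in>S. K x f \<sigma>) / real (card S) + d * ((\<Sum>x\<in>S. K x g \<sigma>) / real (card S))"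
    by (simp add: sum.distrib sum_distrib_left add_divide_distrib)
  have "(\<Sum>x\<in>S. K x (\<lambda>_. d) \<sigma>) = (\<Sum>x\<in>S. d)"
    by (intro sum.cong refl markov_const[OF assms(3)])
  then show "(\<Sum>x\<in>S. K x (\<lambda>_. d) \<sigma>) / real (card S) = d" using c by simp
qed

text \<open>For the indicator \<open>f\<close> of a set, \<open>w \<tau> * K' f \<tau>\<close> is
  the weight that \<open>K\<close> carries from that set to \<open>\<tau>\<close>. A kernel that is
  reversible for \<open>w\<close> is its own adjoint.\<close>

definition adjoint :: "'s set \<Rightarrow> ('s \<Rightarrow> real) \<Rightarrow> (('s \<Rightarrow> real) \<Rightarrow> 's \<Rightarrow> real) \<Rightarrow> (('s \<Rightarrow> real) \<Rightarrow> 's \<Rightarrow> real) \<Rightarrow> bool" where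
  "adjoint \<Omega> w K K' \<longleftrightarrow>
     (\<forall>f g. (\<Sum>\<sigma>\<in>\<Omega>. w \<sigma> * f \<sigma> * K g \<sigma>) = (\<Sum>\<sigma>\<in>\<Omega>. w \<sigma> * K' f \<sigma> * g \<sigma>))"

lemma adjointD: "adjoint \<Omega> w K K' \<Longrightarrow> (\<Sum>\<sigma>\<in>\<Omega>. w \<sigma> * f \<sigma> * K g \<sigma>) = (\<Sum>\<sigma>\<in>\<Omega>. w \<sigma> * K' f \<sigma> * g \<sigma>)"
  unfolding adjoint_def by blast

lemma adjoint_comp:
  assumes "adjoint \<Omega> w K K'" "adjoint \<Omega> w L L'"
  shows "adjoint \<Omega> w (\<lambda>f. K (L f)) (\<lambda>f. L' (K' f))"
  unfolding adjoint_def using adjointD[OF assms(1)] adjointD[OF assms(2)] by metis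

text \<open>Adjoints compose in the opposite order, so for self-adjoint factors the adjoint of a
  scan is the scan run backwards.\<close>

lemma adjoint_foldr:
  assumes "\<And>x. x \<in> set xs \<Longrightarrow> adjoint \<Omega> w (K x) (K' x)"
  shows "adjoint \<Omega> w (foldr K xs) (foldr K' (rev xs))"
  using assms
proof (induction xs)
  case Nil
  show ?case by (simp add: adjoint_def)
next
  case (Cons x xs)
  then show ?case using adjoint_comp[of \<Omega> w "K x" "K' x" "foldr K xs" "foldr K' (rev xs)"]
    by (simp add: comp_def foldr_append)
qed

lemma adjoint_funpow: "adjoint \<Omega> w K K \<Longrightarrow> adjoint \<Omega> w (K ^^ m) (K ^^ m)"
  using adjoint_foldr[of "replicate m ()" \<Omega> w "\<lambda>_. K" "\<lambda>_. K"] by (simp add: foldr_replicate)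

lemma adjoint_average:
  assumes "\<And>x. x \<in> S \<Longrightarrow> adjoint \<Omega> w (K x) (K x)"
  shows "adjoint \<Omega> w (\<lambda>f \<sigma>. (\<Sum>x\<in>S. K x f \<sigma>) / c) (\<lambda>f \<sigma>. (\<Sum>x\<in>S. K x f \<sigma>) / c)"
  unfolding adjoint_def
proof (intro allI)
  fix f g
  have "(\<Sum>\<sigma>\<in>\<Omega>. w \<sigma> * f \<sigma> * ((\<Sum>x\<in>S. K x g \<sigma>) / c)) = (\<Sum>x\<in>S. (\<Sum>\<sigma>\<in>\<Omega>. w \<sigma> * f \<sigma> * K x g \<sigma>)) / c"
    by (subst sum.swap) (simp add: sum_divide_distrib sum_distrib_left)
  also have "\<dots> = (\<Sum>x\<in>S. (\<Sum>\<sigma>\<in>\<Omega>. w \<sigma> * K x f \<sigma> * g \<sigma>)) / c"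
    using adjointD[OF assms] by simp
  also have "\<dots> = (\<Sum>\<sigma>\<in>\<Omega>. w \<sigma> * ((\<Sum>x\<in>S. K x f \<sigma>) / c) * g \<sigma>)"
    by (subst sum.swap) (simp add: sum_divide_distrib sum_distrib_left sum_distrib_right)
  finally show "(\<Sum>\<sigma>\<in>\<Omega>. w \<sigma> * f \<sigma> * ((\<Sum>x\<in>S. K x g \<sigma>) / c)) = (\<Sum>\<sigma>\<in>\<Omega>. w \<sigma> * ((\<Sum>x\<in>S. K x f \<sigma>) / c) * g \<sigma>)" .
qed

text \<open>The numbers of larger elements run through \<open>0, ..., card P - 1\<close> exactly
  once. This turns the sum over the possible lowest flaws into a geometric series.\<close>

lemma sum_power_card_greater:
  fixes P :: "'a::linorder set" and y :: real
  assumes "finite P"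
  shows "(\<Sum>f\<in>P. y ^ card {g\<in>P. f < g}) = (\<Sum>j<card P. y ^ j)"
  using assms
proof (induction P rule: finite_linorder_min_induct)
  case empty
  then show ?case by simp
next
  case (insert m P)
  have 1: "{g \<in> insert m P. m < g} = P" using insert.hyps by auto
  have 2: "{g \<in> insert m P. f < g} = {g\<in>P. f < g}" if "f \<in> P" for f
    using insert.hyps that by auto
  have "m \<notin> P" using insert.hyps by auto
  then have "(\<Sum>f\<in>insert m P. y ^ card {g \<in> insert m P. f < g})
      = y ^ card P + (\<Sum>f\<in>P. y ^ card {g\<in>P. f < g})"
    using insert.hyps(1) by (simp only: sum.insert not_False_eq_True if_False 1 2 cong: sum.cong)
  then show ?case using insert \<open>m \<notin> P\<close> by simp
qed

text \<open>Reweighting by a power of \<open>y = 1 + 1/d\<close> per pending flaw makes the number of pending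
  flaws irrelevant: fixing the lowest flaw discards it and adds at most \<open>d\<close> new ones.\<close>

lemma flaw_walk_decay:
  fixes \<Omega> :: "'s set" and w :: "'s \<Rightarrow> real" and flaws :: "'s \<Rightarrow> nat set"
    and K K' :: "nat \<Rightarrow> ('s \<Rightarrow> real) \<Rightarrow> 's \<Rightarrow> real" and \<Gamma> :: "nat \<Rightarrow> nat set"
    and alive :: "nat \<Rightarrow> 's \<Rightarrow> real" and N d :: nat and e :: real
  assumes fin: "finite \<Omega>" and w0: "\<And>\<sigma>. \<sigma> \<in> \<Omega> \<Longrightarrow> 0 \<le> w \<sigma>"
    and fl: "\<And>\<sigma>. flaws \<sigma> \<subseteq> {..<N}"
    and mk: "\<And>f. f < N \<Longrightarrow> markov (R f) (K f)" 
    and adj: "\<And>f. f < N \<Longrightarrow> adjoint \<Omega> w (K f) (K' f)"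
    and loc: "\<And>f \<sigma> \<tau>. f < N \<Longrightarrow> \<sigma> \<in> \<Omega> \<Longrightarrow> R f \<sigma> \<tau> \<Longrightarrow> \<tau> \<in> \<Omega> \<and> flaws \<tau> - \<Gamma> f \<subseteq> flaws \<sigma>"
    and G: "\<And>f. f < N \<Longrightarrow> f \<in> \<Gamma> f" "\<And>f. f < N \<Longrightarrow> finite (\<Gamma> f)" "\<And>f. f < N \<Longrightarrow> card (\<Gamma> f) \<le> d" and d: "d > 0"
    and mono': "\<And>f h h' \<tau>. f < N \<Longrightarrow> \<tau> \<in> \<Omega> \<Longrightarrow> (\<And>\<rho>. \<rho> \<in> \<Omega> \<Longrightarrow> h \<rho> \<le> h' \<rho>) \<Longrightarrow> K' f h \<tau> \<le> K' f h' \<tau>"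
    and eps: "\<And>f \<tau>. f < N \<Longrightarrow> \<tau> \<in> \<Omega> \<Longrightarrow>
        K' f (\<lambda>\<sigma>. of_bool (flaws \<sigma> \<noteq> {} \<and> Min (flaws \<sigma>) = f)) \<tau> \<le> e" and e: "0 \<le> e"
    and al0: "\<And>\<sigma>. \<sigma> \<in> \<Omega> \<Longrightarrow> alive 0 \<sigma> \<le> 1"
    and alpos: "\<And>m \<sigma>. \<sigma> \<in> \<Omega> \<Longrightarrow> 0 \<le> alive m \<sigma>"
    and alS0: "\<And>m \<sigma>. \<sigma> \<in> \<Omega> \<Longrightarrow> flaws \<sigma> = {} \<Longrightarrow> alive (Suc m) \<sigma> = 0"
    and alS: "\<And>m \<sigma>. \<sigma> \<in> \<Omega> \<Longrightarrow> flaws \<sigma> \<noteq> {} \<Longrightarrow> alive (Suc m) \<sigma> = K (Min (flaws \<sigma>)) (alive m) \<sigma>"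
    and P: "P \<subseteq> {..<N}"
  shows "(\<Sum>\<sigma> | \<sigma> \<in> \<Omega> \<and> flaws \<sigma> \<subseteq> P. w \<sigma> * alive m \<sigma>)
      \<le> sum w \<Omega> * (1 + 1 / real d) ^ card P * (3 * real d * e) ^ m"
  using P
proof (induction m arbitrary: P)
  case 0
  have "(\<Sum>\<sigma> | \<sigma> \<in> \<Omega> \<and> flaws \<sigma> \<subseteq> P. w \<sigma> * alive 0 \<sigma>) \<le> (\<Sum>\<sigma>\<in>\<Omega>. w \<sigma> * 1)"
    by (rule order_trans[OF sum_mono2[OF fin]], use w0 alpos in force, use w0 alpos in force)
       (intro sum_mono mult_left_mono, use w0 al0 in auto)
  also have "\<dots> \<le> sum w \<Omega> * (1 + 1 / real d) ^ card P"
    using mult_left_mono[of 1 "(1 + 1 / real d) ^ card P" "sum w \<Omega>"] w0 by (simp add: sum_nonneg)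
  finally show ?case by simp
next
  case (Suc m P)
  define y where "y = 1 + 1 / real d"
  have y1: "y > 1" using d by (simp add: y_def)
  have finP: "finite P" using Suc.prems finite_subset by blast
  define \<Omega>f where "\<Omega>f f = {\<sigma>\<in>\<Omega>. flaws \<sigma> \<subseteq> P \<and> flaws \<sigma> \<noteq> {} \<and> Min (flaws \<sigma>) = f}" for f
  \<comment> \<open>Flaws that may be present after the repair of the lowest flaw \<open>f\<close>:
    the pending ones above \<open>f\<close> and whatever the repair can create. The flaw
    \<open>f\<close> itself counts only as a member of \<open>\<Gamma> f\<close>.\<close>
  define Q where "Q f = ({g\<in>P. f < g} \<union> \<Gamma> f) \<inter> {..<N}" for f
  have flfin: "finite (flaws \<sigma>)" for \<sigma> using fl finite_subset by blast
  have "(\<Sum>\<sigma> | \<sigma> \<in> \<Omega> \<and> flaws \<sigma> \<subseteq> P. w \<sigma> * alive (Suc m) \<sigma>)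
      = (\<Sum>\<sigma> | \<sigma> \<in> \<Omega> \<and> flaws \<sigma> \<subseteq> P \<and> flaws \<sigma> \<noteq> {}. w \<sigma> * alive (Suc m) \<sigma>)"
    by (rule sum.mono_neutral_right) (use fin alS0 in auto)
  also have "{\<sigma>. \<sigma> \<in> \<Omega> \<and> flaws \<sigma> \<subseteq> P \<and> flaws \<sigma> \<noteq> {}} = (\<Union>f\<in>P. \<Omega>f f)"
    unfolding \<Omega>f_def using Min_in[OF flfin] by blast
  also have "(\<Sum>\<sigma>\<in>(\<Union>f\<in>P. \<Omega>f f). w \<sigma> * alive (Suc m) \<sigma>) = (\<Sum>f\<in>P. \<Sum>\<sigma>\<in>\<Omega>f f. w \<sigma> * alive (Suc m) \<sigma>)"
    by (rule sum.UNION_disjoint) (use finP fin in \<open>auto simp: \<Omega>f_def\<close>)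
  also have "\<dots> \<le> (\<Sum>f\<in>P. e * (sum w \<Omega> * y ^ (card {g\<in>P. f < g} + d) * (3 * real d * e) ^ m))"
  proof (rule sum_mono)
    fix f assume f: "f \<in> P"
    then have fN: "f < N" using Suc.prems by auto
    define h where "h \<tau> = (if flaws \<tau> \<subseteq> Q f then alive m \<tau> else 0)" for \<tau>
    have framed: "alive (Suc m) \<sigma> = K f h \<sigma>" if "\<sigma> \<in> \<Omega>f f" for \<sigma>
    proof -
      have s: "\<sigma> \<in> \<Omega>" "flaws \<sigma> \<subseteq> P" "flaws \<sigma> \<noteq> {}" "Min (flaws \<sigma>) = f" using that by (auto simp: \<Omega>f_def)
      have "K f (alive m) \<sigma> = K f h \<sigma>"
      proof (rule markov_eq[OF mk[OF fN]])
        fix \<tau> assume R: "R f \<sigma> \<tau>"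
        have "g \<in> Q f" if g: "g \<in> flaws \<tau>" for g
        proof (cases "g \<in> \<Gamma> f")
          case True then show ?thesis using g fl by (auto simp: Q_def)
        next
          case False
          then have "g \<in> flaws \<sigma>" using loc[OF fN s(1) R] g by auto
          moreover have "g \<noteq> f" using False G(1)[OF fN] by auto
          ultimately have "f < g" using s(4) Min_le[OF flfin, of g \<sigma>] by simp
          then show ?thesis using \<open>g \<in> flaws \<sigma>\<close> s(2) fl by (auto simp: Q_def)
        qed
        then show "alive m \<tau> = h \<tau>" by (auto simp: h_def)
      qed
      then show ?thesis using alS[OF s(1,3)] s(4) by simp
    qed
    have "(\<Sum>\<sigma>\<in>\<Omega>f f. w \<sigma> * alive (Suc m) \<sigma>) = (\<Sum>\<sigma>\<in>\<Omega>f f. w \<sigma> * K f h \<sigma>)"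
      using framed by simp
    also have "\<dots> = (\<Sum>\<sigma>\<in>\<Omega>. w \<sigma> * of_bool (\<sigma> \<in> \<Omega>f f) * K f h \<sigma>)"
      by (rule sum.mono_neutral_cong_left) (auto simp: fin \<Omega>f_def)
    \<comment> \<open>Moving the kernel onto the indicator of the source states leaves a factor that
      \<open>eps\<close> bounds pointwise. What remains is a sum over target states, to which the
      induction hypothesis for \<open>Q f\<close> applies.\<close>
    also have "\<dots> = (\<Sum>\<sigma>\<in>\<Omega>. w \<sigma> * K' f (\<lambda>\<sigma>. of_bool (\<sigma> \<in> \<Omega>f f)) \<sigma> * h \<sigma>)"
      by (rule adjointD[OF adj[OF fN]])
    also have "\<dots> \<le> (\<Sum>\<sigma>\<in>\<Omega>. w \<sigma> * e * h \<sigma>)"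
    proof (intro sum_mono mult_right_mono mult_left_mono)
      fix \<tau> assume t: "\<tau> \<in> \<Omega>"
      show "K' f (\<lambda>\<sigma>. of_bool (\<sigma> \<in> \<Omega>f f)) \<tau> \<le> e"
        using mono'[OF fN t, of "\<lambda>\<sigma>. of_bool (\<sigma> \<in> \<Omega>f f)" "\<lambda>\<sigma>. of_bool (flaws \<sigma> \<noteq> {} \<and> Min (flaws \<sigma>) = f)"]
          eps[OF fN t] by (force simp: \<Omega>f_def)
      show "0 \<le> h \<tau>" using alpos t by (simp add: h_def)
    qed (use w0 in auto)
    also have "\<dots> = e * (\<Sum>\<sigma> | \<sigma> \<in> \<Omega> \<and> flaws \<sigma> \<subseteq> Q f. w \<sigma> * alive m \<sigma>)"
      unfolding sum_distrib_left
      by (rule sum.mono_neutral_cong_right) (auto simp: fin h_def)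
    also have "\<dots> \<le> e * (sum w \<Omega> * y ^ card (Q f) * (3 * real d * e) ^ m)"
      unfolding y_def by (intro mult_left_mono Suc.IH) (auto simp: e Q_def)
    also have "\<dots> \<le> e * (sum w \<Omega> * y ^ (card {g\<in>P. f < g} + d) * (3 * real d * e) ^ m)"
    proof (intro mult_left_mono mult_right_mono power_increasing)
      have "card (Q f) \<le> card ({g\<in>P. f < g} \<union> \<Gamma> f)"
        unfolding Q_def by (rule card_mono) (use finP G(2)[OF fN] in auto)
      also have "\<dots> \<le> card {g\<in>P. f < g} + card (\<Gamma> f)" by (rule card_Un_le)
      finally show "card (Q f) \<le> card {g\<in>P. f < g} + d" using G(3)[OF fN] by linarith
    qed (use y1 e w0 in \<open>auto intro!: sum_nonneg\<close>)
    finally show "(\<Sum>\<sigma>\<in>\<Omega>f f. w \<sigma> * alive (Suc m) \<sigma>) \<le> e * (sum w \<Omega> * y ^ (card {g\<in>P. f < g} + d) * (3 * real d * e) ^ m)" .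
  qed
  also have "\<dots> = e * sum w \<Omega> * (3 * real d * e) ^ m * y ^ d * (\<Sum>f\<in>P. y ^ card {g\<in>P. f < g})"
    by (subst sum_distrib_left) (simp add: power_add mult_ac)
  \<comment> \<open>\<open>y = 1 + 1 / d\<close> balances two losses: the power \<open>y ^ d\<close>
    for the new flaws stays below \<open>3\<close>, and the geometric series over the lowest flaw
    costs \<open>1 / (y - 1) = d\<close>.\<close>
  also have "\<dots> \<le> e * sum w \<Omega> * (3 * real d * e) ^ m * 3 * (real d * y ^ card P)"
  proof (intro mult_mono)
    have "y ^ d \<le> exp (1 / real d) ^ d"
      by (intro power_mono) (use exp_ge_add_one_self[of "1 / real d"] y1 in \<open>auto simp: y_def\<close>)
    also have "\<dots> = exp 1" using d by (simp flip: exp_of_nat_mult)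
    finally show "y ^ d \<le> 3" using exp_le by linarith
    have "(\<Sum>f\<in>P. y ^ card {g\<in>P. f < g}) = (y ^ card P - 1) / (y - 1)"
      using sum_power_card_greater[OF finP, of y] geometric_sum[of y "card P"] y1 by simp
    also have "\<dots> = real d * (y ^ card P - 1)" by (simp add: y_def)
    also have "\<dots> \<le> real d * y ^ card P" by (intro mult_left_mono) auto
    finally show "(\<Sum>f\<in>P. y ^ card {g\<in>P. f < g}) \<le> real d * y ^ card P" .
  qed (use y1 e w0 in \<open>auto intro!: sum_nonneg mult_nonneg_nonneg\<close>)
  also have "\<dots> = sum w \<Omega> * y ^ card P * (3 * real d * e) ^ Suc m" by simp
  finally show ?case unfolding y_def .
qed

section \<open>Partial colourings and single-site resampling\<close>

type_synonym pcol = "nat \<Rightarrow> nat"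

locale graph_on =
  fixes n :: nat and adj :: "nat \<Rightarrow> nat \<Rightarrow> bool"
  assumes adj_sym: "adj u v \<Longrightarrow> adj v u" and adj_irrefl: "\<not> adj u u" and adj_lt: "adj u v \<Longrightarrow> u < n"
begin

definition nb :: "nat \<Rightarrow> nat set" where "nb v = {u. adj v u}"

definition free :: "pcol \<Rightarrow> nat \<Rightarrow> nat \<Rightarrow> bool" where "free \<sigma> u x \<longleftrightarrow> (\<forall>w. adj u w \<longrightarrow> \<sigma> w \<noteq> x)"

lemma adj_lt2: "adj u v \<Longrightarrow> v < n" using adj_sym adj_lt by blast

lemma nb_subset: "nb v \<subseteq> {..<n}" unfolding nb_def using adj_lt2 by blast

lemma finite_nb[simp]: "finite (nb v)" using nb_subset finite_subset by blast

lemma free_upd[simp]: "free (\<sigma>(u := y)) u x = free \<sigma> u x"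
  unfolding free_def using adj_irrefl by (metis fun_upd_other)

end

locale palette = graph_on +
  fixes q b :: nat
  assumes b_pos: "b \<ge> 1"
begin

definition p :: real where "p = 1 / 2 ^ b"

text \<open>\<open>B = (1 - p) / p\<close> is the odds of blanking a vertex, hence the weight of a
  blank vertex relative to a coloured one that makes the updates reversible.\<close>

definition B :: real where "B = 2 ^ b - 1"

lemma p_bounds: "0 < p" "p \<le> 1/2" "p < 1"
proof -
  show "0 < p" by (simp add: p_def)
  have "(2::real) ^ 1 \<le> 2 ^ b" by (rule power_increasing) (use b_pos in auto)
  then show "p \<le> 1/2" by (simp add: p_def field_simps)
  then show "p < 1" by simp
qed

lemma B_ge: "B \<ge> 1"
proof -
  have "(2::real) ^ 1 \<le> 2 ^ b" by (rule power_increasing) (use b_pos in auto)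
  then show ?thesis by (simp add: B_def)
qed

lemma B_p: "p = 1 / (B + 1)" "1 - p = B / (B + 1)"
  by (simp_all add: p_def B_def field_simps)

text \<open>Colour \<open>0\<close> stands for an uncoloured vertex.\<close>

definition \<Omega> :: "pcol set" where
  "\<Omega> = {\<sigma>. (\<forall>v. \<sigma> v \<le> q) \<and> (\<forall>v\<ge>n. \<sigma> v = 0) \<and> (\<forall>u v. adj u v \<longrightarrow> \<sigma> u = \<sigma> v \<longrightarrow> \<sigma> u = 0)}"

definition wt :: "pcol \<Rightarrow> real" where "wt \<sigma> = (\<Prod>v<n. if \<sigma> v = 0 then B else 1)"

text \<open>When the step acts, its outcome does not depend on which of the two values
  \<open>u\<close> had before. This makes it reversible and lets it forget the starting
  state.\<close>

definition upd :: "nat \<Rightarrow> nat \<Rightarrow> (pcol \<Rightarrow> real) \<Rightarrow> pcol \<Rightarrow> real" where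
  "upd u x f \<sigma> = (if (\<sigma> u = 0 \<or> \<sigma> u = x) \<and> free \<sigma> u x
     then p * f (\<sigma>(u := x)) + (1 - p) * f (\<sigma>(u := 0)) else f \<sigma>)"

lemma \<Omega>_free: "\<sigma> \<in> \<Omega> \<Longrightarrow> \<sigma> u = x \<Longrightarrow> x \<noteq> 0 \<Longrightarrow> free \<sigma> u x"
  unfolding \<Omega>_def free_def by force

lemma \<Omega>_zero: "\<sigma> \<in> \<Omega> \<Longrightarrow> \<sigma>(u := 0) \<in> \<Omega>"
  unfolding \<Omega>_def by auto

lemma \<Omega>_upd: "\<sigma> \<in> \<Omega> \<Longrightarrow> free \<sigma> u x \<Longrightarrow> x \<le> q \<Longrightarrow> u < n \<Longrightarrow> \<sigma>(u := x) \<in> \<Omega>"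
  unfolding \<Omega>_def free_def using adj_sym by (auto simp: adj_irrefl)

lemma \<Omega>_subset: "\<Omega> \<subseteq> PiE_dflt {..<n} 0 (\<lambda>_. {..q})"
  unfolding \<Omega>_def PiE_dflt_def by auto

lemma finite_\<Omega>[simp]: "finite \<Omega>"
  using \<Omega>_subset finite_PiE_dflt[of "{..<n}" "\<lambda>_. {..q}" 0] finite_subset by blast

lemma card_\<Omega>: "card \<Omega> \<le> (q + 1) ^ n"
proof -
  have "card \<Omega> \<le> card (PiE_dflt {..<n} 0 (\<lambda>_. {..q}))"
    by (rule card_mono[OF _ \<Omega>_subset]) (auto intro: finite_PiE_dflt)
  also have "\<dots> = (q + 1) ^ n" by (subst card_PiE_dflt) auto
  finally show ?thesis .
qed

lemma wt_nonneg: "0 \<le> wt \<sigma>"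
  unfolding wt_def using B_ge by (intro prod_nonneg) auto

lemma wt_le: "wt \<sigma> \<le> B ^ n"
proof -
  have "wt \<sigma> \<le> (\<Prod>v<n. B)" unfolding wt_def using B_ge by (intro prod_mono) auto
  then show ?thesis by simp
qed

lemma wt_zero: "wt (\<lambda>_. 0) = B ^ n" unfolding wt_def by simp

lemma sum_wt_le: "sum wt \<Omega> \<le> (real q + 1) ^ n * B ^ n"
proof -
  have "sum wt \<Omega> \<le> (\<Sum>\<sigma>\<in>\<Omega>. B ^ n)" by (intro sum_mono wt_le)
  also have "\<dots> = real (card \<Omega>) * B ^ n" by simp
  also have "\<dots> \<le> real ((q + 1) ^ n) * B ^ n"
    using card_\<Omega> B_ge by (intro mult_right_mono) (auto simp del: of_nat_power)
  finally show ?thesis by (simp add: add.commute)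
qed

lemma wt_upd: "\<sigma> u = 0 \<Longrightarrow> u < n \<Longrightarrow> x \<noteq> 0 \<Longrightarrow> wt \<sigma> = B * wt (\<sigma>(u := x))"
  unfolding wt_def
  by (subst (1 2) prod.remove[of _ u]) (auto intro!: prod.cong)

text \<open>The update mixes only pairs \<open>\<sigma>\<close>, \<open>\<sigma>(u := x)\<close>
  with \<open>\<sigma> u = 0\<close>. By \<open>wt_upd\<close> their weights are in the ratio
  \<open>B : 1\<close>, which is the ratio of the probabilities \<open>1 - p\<close> and
  \<open>p\<close> of ending in either.\<close>

lemma adjoint_upd:
  assumes u: "u < n" and x: "1 \<le> x" "x \<le> q"
  shows "adjoint \<Omega> wt (upd u x) (upd u x)"
  unfolding adjoint_def
proof (intro allI)
  fix f g :: "pcol \<Rightarrow> real"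
  define C where "C = {\<sigma>\<in>\<Omega>. \<sigma> u = 0 \<and> free \<sigma> u x}"
  define D where "D = {\<sigma>\<in>\<Omega>. \<sigma> u = x \<and> free \<sigma> u x}"
  define E where "E = {\<sigma>\<in>\<Omega>. \<not> ((\<sigma> u = 0 \<or> \<sigma> u = x) \<and> free \<sigma> u x)}"
  have fin: "finite C" "finite D" "finite E" by (auto simp: C_def D_def E_def)
  have part: "\<Omega> = E \<union> (C \<union> D)" "E \<inter> (C \<union> D) = {}" "C \<inter> D = {}" using x by (auto simp: C_def D_def E_def)
  have split: "sum h \<Omega> = sum h E + (\<Sum>\<sigma>\<in>C. h \<sigma> + h (\<sigma>(u := x)))" for h :: "pcol \<Rightarrow> real"
  proof -
    have "sum h D = (\<Sum>\<sigma>\<in>C. h (\<sigma>(u := x)))"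
      by (rule sum.reindex_bij_witness[of _ "\<lambda>\<sigma>. \<sigma>(u := x)" "\<lambda>\<sigma>. \<sigma>(u := 0)"])
         (use u x in \<open>auto simp: C_def D_def intro: \<Omega>_zero \<Omega>_upd\<close>)
    then show ?thesis unfolding part(1)
      using sum.union_disjoint[OF fin(3) _ part(2), of h] sum.union_disjoint[OF fin(1,2) part(3), of h] fin
      by (simp add: sum.distrib)
  qed
  have E: "upd u x h \<sigma> = h \<sigma>" if "\<sigma> \<in> E" for h \<sigma> using that by (auto simp: upd_def E_def)
  have C: "upd u x h \<sigma> = (h (\<sigma>(u := x)) + B * h \<sigma>) / (B + 1)"
    "upd u x h (\<sigma>(u := x)) = (h (\<sigma>(u := x)) + B * h \<sigma>) / (B + 1)"
    if "\<sigma> \<in> C" for h \<sigma>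
  proof -
    have "\<sigma>(u := 0) = \<sigma>" using that by (auto simp: C_def)
    then show "upd u x h \<sigma> = (h (\<sigma>(u := x)) + B * h \<sigma>) / (B + 1)"
       "upd u x h (\<sigma>(u := x)) = (h (\<sigma>(u := x)) + B * h \<sigma>) / (B + 1)"
      using that by (simp_all add: upd_def C_def B_p(2)) (simp_all add: B_p(1) add_divide_distrib)
  qed
  have "(\<Sum>\<sigma>\<in>C. wt \<sigma> * f \<sigma> * upd u x g \<sigma> + wt (\<sigma>(u := x)) * f (\<sigma>(u := x)) * upd u x g (\<sigma>(u := x)))
      = (\<Sum>\<sigma>\<in>C. wt \<sigma> * upd u x f \<sigma> * g \<sigma> + wt (\<sigma>(u := x)) * upd u x f (\<sigma>(u := x)) * g (\<sigma>(u := x)))"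
  proof (rule sum.cong[OF refl])
    fix \<sigma> assume s: "\<sigma> \<in> C"
    then have w: "wt \<sigma> = B * wt (\<sigma>(u := x))" by (intro wt_upd) (use u x in \<open>auto simp: C_def\<close>)
    show "wt \<sigma> * f \<sigma> * upd u x g \<sigma> + wt (\<sigma>(u := x)) * f (\<sigma>(u := x)) * upd u x g (\<sigma>(u := x))
      = wt \<sigma> * upd u x f \<sigma> * g \<sigma> + wt (\<sigma>(u := x)) * upd u x f (\<sigma>(u := x)) * g (\<sigma>(u := x))"
      unfolding C[OF s] w using B_ge by (simp add: divide_simps) (simp add: algebra_simps)
  qed
  then show "(\<Sum>\<sigma>\<in>\<Omega>. wt \<sigma> * f \<sigma> * upd u x g \<sigma>) = (\<Sum>\<sigma>\<in>\<Omega>. wt \<sigma> * upd u x f \<sigma> * g \<sigma>)"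
    unfolding split using E by (simp cong: sum.cong)
qed

section \<open>What a resampling step may change\<close>

definition near :: "nat \<Rightarrow> pcol \<Rightarrow> pcol \<Rightarrow> bool" where
  "near v \<sigma> \<tau> \<longleftrightarrow> (\<sigma> \<in> \<Omega> \<longrightarrow> \<tau> \<in> \<Omega>) \<and> (\<forall>u. \<not> adj v u \<longrightarrow> \<tau> u = \<sigma> u)"

definition near_class :: "nat \<Rightarrow> nat \<Rightarrow> pcol \<Rightarrow> pcol \<Rightarrow> bool" where
  "near_class v x \<sigma> \<tau> \<longleftrightarrow> near v \<sigma> \<tau> \<and> (\<forall>u. \<tau> u = \<sigma> u \<or> \<sigma> u \<in> {0, x} \<and> \<tau> u \<in> {0, x})"

definition near_vertex :: "nat \<Rightarrow> pcol \<Rightarrow> pcol \<Rightarrow> bool" where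
  "near_vertex u \<sigma> \<tau> \<longleftrightarrow> (\<sigma> \<in> \<Omega> \<longrightarrow> \<tau> \<in> \<Omega>) \<and> (\<forall>w. w \<noteq> u \<longrightarrow> \<tau> w = \<sigma> w)"

lemma near_refl_trans[simp, intro]: "reflp (near v)" "transp (near v)"
  unfolding near_def by (auto intro!: reflpI transpI)

lemma near_class_refl_trans[simp, intro]: "reflp (near_class v x)" "transp (near_class v x)"
  unfolding near_class_def near_def by (auto intro!: reflpI transpI) metis+

lemma near_vertex_refl_trans[simp, intro]: "reflp (near_vertex v)" "transp (near_vertex v)"
  unfolding near_vertex_def by (auto intro!: reflpI transpI)

lemma markov_upd:
  assumes "reflp R" "\<And>\<sigma>. \<sigma> u \<in> {0, x} \<Longrightarrow> free \<sigma> u x \<Longrightarrow> R \<sigma> (\<sigma>(u := x)) \<and> R \<sigma> (\<sigma>(u := 0))"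
  shows "markov R (upd u x)"
  unfolding markov_def
proof (intro conjI allI impI)
  fix \<sigma> and f g :: "pcol \<Rightarrow> real" assume "\<forall>\<tau>. R \<sigma> \<tau> \<longrightarrow> f \<tau> \<le> g \<tau>"
  then show "upd u x f \<sigma> \<le> upd u x g \<sigma>"
    using assms p_bounds by (auto simp: upd_def reflp_def intro!: add_mono mult_left_mono)
qed (auto simp: upd_def algebra_simps)

lemma markov_upd_class:
  assumes "adj v u" "x \<le> q"
  shows "markov (near_class v x) (upd u x)"
  by (rule markov_upd) (use assms adj_lt2 \<Omega>_upd \<Omega>_zero in \<open>auto simp: near_class_def near_def\<close>)

lemma markov_upd_vertex:
  assumes "u < n" "x \<le> q"
  shows "markov (near_vertex u) (upd u x)"
  by (rule markov_upd) (use assms \<Omega>_upd \<Omega>_zero in \<open>auto simp: near_vertex_def\<close>)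

end

section \<open>Repairing short lists\<close>

text \<open>The product of the right-hand side with \<open>1 + y + y^2 / 2\<close>, which is at most
  \<open>exp y\<close>, equals \<open>1 + y^4 / 4\<close> and is thus at least
  \<open>1\<close>.\<close>

lemma exp_minus_le: "0 \<le> y \<Longrightarrow> exp (- y) \<le> 1 - y + y\<^sup>2 / 2" for y :: real
proof -
  assume y: "0 \<le> y"
  have pos: "1 - y + y\<^sup>2 / 2 > 0"
  proof -
    have "1 - y + y\<^sup>2 / 2 = ((1 - y)\<^sup>2 + 1) / 2" by (simp add: power2_eq_square field_simps)
    also have "\<dots> > 0" by (intro divide_pos_pos add_nonneg_pos) auto
    finally show ?thesis .
  qed
  have "(1 - y + y\<^sup>2 / 2) * (1 + y + y\<^sup>2 / 2) = 1 + y ^ 4 / 4"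
    by (simp add: field_simps power2_eq_square power4_eq_xxxx)
  then have "1 \<le> (1 - y + y\<^sup>2 / 2) * (1 + y + y\<^sup>2 / 2)" by simp
  also have "\<dots> \<le> (1 - y + y\<^sup>2 / 2) * exp y"
    using exp_lower_Taylor_quadratic[OF y] pos by (intro mult_left_mono) auto
  finally show ?thesis by (simp add: exp_minus divide_simps)
qed

text \<open>Dropping an element of value at least \<open>c\<close> keeps the average at most
  \<open>c\<close>; if there is none, any element may be dropped.\<close>

lemma exists_subset_sum_le:
  fixes f :: "'a \<Rightarrow> real" and c :: real
  assumes "finite F" "(\<Sum>u\<in>F. f u) \<le> c * card F" "m \<le> card F"
  shows "\<exists>F'\<subseteq>F. card F' = m \<and> (\<Sum>u\<in>F'. f u) \<le> c * m"
  using assms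
proof (induction "card F - m" arbitrary: F)
  case 0
  then show ?case by (intro exI[of _ F]) auto
next
  case (Suc k)
  have ne: "F \<noteq> {}" using Suc.hyps(2) by auto
  have "\<exists>a\<in>F. (\<Sum>u\<in>F - {a}. f u) \<le> c * real (card (F - {a}))"
  proof (cases "\<exists>a\<in>F. f a \<ge> c")
    case True
    then obtain a where a: "a \<in> F" "f a \<ge> c" by blast
    then have "(\<Sum>u\<in>F - {a}. f u) = (\<Sum>u\<in>F. f u) - f a" using Suc.prems(1) by (simp add: sum_diff1)
    moreover have "real (card (F - {a})) = real (card F) - 1" using a Suc.prems(1) ne
      by (simp add: card_Diff_singleton of_nat_diff card_gt_0_iff Suc_leI)
    ultimately show ?thesis using a Suc.prems(2) by (intro bexI[of _ a]) (auto simp: algebra_simps)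
  next
    case False
    obtain a where a: "a \<in> F" using ne by blast
    have "(\<Sum>u\<in>F - {a}. f u) \<le> (\<Sum>u\<in>F - {a}. c)" by (rule sum_mono) (use False in force)
    then show ?thesis using a by (intro bexI[of _ a]) (auto simp: mult.commute)
  qed
  then obtain a where a: "a \<in> F" "(\<Sum>u\<in>F - {a}. f u) \<le> c * real (card (F - {a}))" by blast
  have "card (F - {a}) = card F - 1" using a by simp
  then have "k = card (F - {a}) - m" "m \<le> card (F - {a})" using Suc.hyps(2) by linarith+
  then obtain F' where "F' \<subseteq> F - {a}" "card F' = m" "(\<Sum>u\<in>F'. f u) \<le> c * m"
    using Suc.hyps(1)[of "F - {a}"] Suc.prems(1) a(2) by blast
  then show ?case by blast
qed

context palette
begin

abbreviation word :: "nat list \<Rightarrow> nat \<Rightarrow> (pcol \<Rightarrow> real) \<Rightarrow> pcol \<Rightarrow> real" where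
  "word us x \<equiv> foldr (\<lambda>u. upd u x) us"

text \<open>The second pass makes every vertex forget its initial state: whatever a vertex sees
  during that pass was already resampled.\<close>

definition phase :: "nat list \<Rightarrow> nat \<Rightarrow> (pcol \<Rightarrow> real) \<Rightarrow> pcol \<Rightarrow> real" where
  "phase us x = word (us @ us) x"

text \<open>Neighbours of \<open>v\<close> that could take \<open>x\<close> if the rest of the
  neighbourhood stayed out of the way. Only colours outside the neighbourhood and the distinction
  between \<open>{0, x}\<close> and other colours enter, so the set is constant while class
  \<open>x\<close> is resampled.\<close>

definition candidates :: "nat \<Rightarrow> nat \<Rightarrow> pcol \<Rightarrow> nat set" where
  "candidates v x \<tau> = {u \<in> nb v. \<tau> u \<in> {0, x} \<and> (\<forall>w. adj u w \<longrightarrow> \<not> adj v w \<longrightarrow> \<tau> w \<noteq> x)}"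

lemma candidates_eq: "near_class v x \<sigma> \<tau> \<Longrightarrow> candidates v x \<tau> = candidates v x \<sigma>"
proof -
  assume a: "near_class v x \<sigma> \<tau>"
  have "\<tau> u \<in> {0, x} \<longleftrightarrow> \<sigma> u \<in> {0, x}" for u
    using a unfolding near_class_def by metis
  moreover have "\<tau> w = \<sigma> w" if "\<not> adj v w" for w using a that unfolding near_class_def near_def by blast
  ultimately show ?thesis unfolding candidates_def by auto
qed

lemma candidates_subset: "candidates v x \<tau> \<subseteq> nb v" by (auto simp: candidates_def)

lemma finite_candidates[simp]: "finite (candidates v x \<tau>)"
  by (rule finite_subset[OF candidates_subset finite_nb])

lemma near_class_\<Omega>: "near_class v x \<sigma> \<tau> \<Longrightarrow> \<sigma> \<in> \<Omega> \<Longrightarrow> \<tau> \<in> \<Omega>"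
  unfolding near_class_def near_def by blast

lemma markov_word_class: "set us \<subseteq> nb v \<Longrightarrow> x \<le> q \<Longrightarrow> markov (near_class v x) (word us x)"
  by (intro markov_foldr markov_upd_class) (auto simp: nb_def)

lemma markov_word_other:
  assumes "w \<notin> set us" shows "markov (\<lambda>\<sigma> \<tau>. \<tau> w = \<sigma> w) (word us x)"
  by (intro markov_foldr markov_upd) (use assms in \<open>auto intro!: reflpI transpI\<close>)

text \<open>The last update of \<open>w\<close> decides. In a proper state a vertex coloured
  \<open>x\<close> can always be updated, so an update that does nothing finds another value, and
  one that acts chooses \<open>x\<close> with probability \<open>p\<close>.\<close>

lemma word_occupied_le:
  assumes "w \<in> set ws" "set ws \<subseteq> nb v" "1 \<le> x" "x \<le> q" "\<sigma> \<in> \<Omega>"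
  shows "word ws x (\<lambda>\<tau>. of_bool (\<tau> w = x)) \<sigma> \<le> p"
proof -
  obtain a c where ws: "ws = a @ w # c" "w \<notin> set c" using split_list_last[OF assms(1)] by blast
  have c: "word c x (\<lambda>\<tau>. of_bool (\<tau> w = x)) = (\<lambda>\<tau>. of_bool (\<tau> w = x))"
    by (rule ext, rule markov_fixed[OF markov_word_other[OF ws(2)]]) simp
  have "word a x (upd w x (\<lambda>\<tau>. of_bool (\<tau> w = x))) \<sigma> \<le> p"
  proof (rule markov_le_const[OF markov_word_class[of a v x]])
    fix \<tau> assume "near_class v x \<sigma> \<tau>"
    then have "\<tau> \<in> \<Omega>" using assms(5) near_class_\<Omega> by blast
    then show "upd w x (\<lambda>\<tau>. of_bool (\<tau> w = x)) \<tau> \<le> p"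
      using p_bounds assms(3) \<Omega>_free[of \<tau> w x] by (auto simp: upd_def)
  qed (use assms ws in auto)
  then show ?thesis by (simp add: ws(1) c)
qed

text \<open>It suffices that every update that acts leaves its vertex blank. Only candidates can be
  updated, each is left blank with probability \<open>1 - p\<close> irrespective of the past, and a
  vertex that cannot be updated does not carry \<open>x\<close>.\<close>

lemma word_none_ge:
  assumes "distinct us" "set us \<subseteq> nb v" "1 \<le> x" "x \<le> q" "\<sigma> \<in> \<Omega>"
  shows "(1 - p) ^ card (candidates v x \<sigma> \<inter> set us) \<le> word us x (\<lambda>\<tau>. of_bool (\<forall>u\<in>set us. \<tau> u \<noteq> x)) \<sigma>"
  using assms
proof (induction us arbitrary: \<sigma>)
  case Nil
  then show ?case by simp
next
  case (Cons u us)
  define h :: "pcol \<Rightarrow> real" where "h \<tau> = of_bool (\<forall>w\<in>set us. \<tau> w \<noteq> x)" for \<tau>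
  have IH: "(1 - p) ^ card (candidates v x \<tau> \<inter> set us) \<le> word us x h \<tau>" if "\<tau> \<in> \<Omega>" for \<tau>
    using Cons that unfolding h_def by auto
  have split: "word us x (\<lambda>\<tau>. of_bool (\<forall>w\<in>set (u # us). \<tau> w \<noteq> x)) \<tau> = of_bool (\<tau> u \<noteq> x) * word us x h \<tau>" for \<tau>
  proof -
    have "(\<lambda>\<tau>. of_bool (\<forall>w\<in>set (u # us). \<tau> w \<noteq> x)) = (\<lambda>\<tau>. of_bool (\<tau> u \<noteq> x) * h \<tau>)"
      by (auto simp: h_def)
    then show ?thesis
      using markov_pull[OF markov_word_other[of u us x], of \<tau> "\<lambda>\<tau>. of_bool (\<tau> u \<noteq> x)" h] Cons.prems(1) by simp
  qed
  have step: "word (u # us) x (\<lambda>\<tau>. of_bool (\<forall>w\<in>set (u # us). \<tau> w \<noteq> x)) \<sigma> =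
     (if (\<sigma> u = 0 \<or> \<sigma> u = x) \<and> free \<sigma> u x
      then p * (of_bool ((\<sigma>(u := x)) u \<noteq> x) * word us x h (\<sigma>(u := x)))
        + (1 - p) * (of_bool ((\<sigma>(u := 0)) u \<noteq> x) * word us x h (\<sigma>(u := 0)))
      else of_bool (\<sigma> u \<noteq> x) * word us x h \<sigma>)"
    unfolding split[symmetric] by (simp only: upd_def[of u x] foldr.simps comp_def)
  have u: "adj v u" using Cons.prems by (auto simp: nb_def)
  show ?case
  proof (cases "\<sigma> u \<in> {0, x} \<and> free \<sigma> u x")
    case True
    have s0: "\<sigma>(u := 0) \<in> \<Omega>" using Cons.prems \<Omega>_zero by blast
    have F: "candidates v x (\<sigma>(u := 0)) = candidates v x \<sigma>"
      by (rule candidates_eq) (use True u s0 in \<open>auto simp: near_class_def near_def\<close>)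
    have "u \<in> candidates v x \<sigma>" using True u by (auto simp: candidates_def nb_def free_def)
    then have "candidates v x \<sigma> \<inter> set (u # us) = insert u (candidates v x \<sigma> \<inter> set us)" by auto
    then have "card (candidates v x \<sigma> \<inter> set (u # us)) = Suc (card (candidates v x \<sigma> \<inter> set us))"
      using Cons.prems(1) by simp
    then show ?thesis unfolding step using IH[OF s0] Cons.prems(3) p_bounds True
      by (simp add: F mult_left_mono)
  next
    case False
    then have "\<sigma> u \<noteq> x" using \<Omega>_free[of \<sigma> u x] Cons.prems by auto
    moreover have "(1 - p) ^ card (candidates v x \<sigma> \<inter> set (u # us)) \<le> (1 - p) ^ card (candidates v x \<sigma> \<inter> set us)"
      using p_bounds by (intro power_decreasing card_mono) auto
    moreover have "word (u # us) x (\<lambda>\<tau>. of_bool (\<forall>w\<in>set (u # us). \<tau> w \<noteq> x)) \<sigma> = of_bool (\<sigma> u \<noteq> x) * word us x h \<sigma>"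
      using False by (subst step) auto
    ultimately show ?thesis using IH[of \<sigma>] Cons.prems by simp
  qed
qed

text \<open>The first pass may do anything, since it preserves the candidates; the bound comes from
  the second pass.\<close>

lemma phase_none_ge:
  assumes "distinct us" "set us = nb v" "1 \<le> x" "x \<le> q" "\<sigma> \<in> \<Omega>"
  shows "(1 - p) ^ card (candidates v x \<sigma>) \<le> phase us x (\<lambda>\<tau>. of_bool (free \<tau> v x)) \<sigma>"
proof -
  have eq: "(\<lambda>\<tau>. of_bool (free \<tau> v x)) = (\<lambda>\<tau>. of_bool (\<forall>u\<in>set us. \<tau> u \<noteq> x) :: real)"
    by (auto simp: assms(2) nb_def free_def)
  have cap: "candidates v x \<tau> \<inter> set us = candidates v x \<tau>" for \<tau> using candidates_subset assms(2) by blast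
  have "(1 - p) ^ card (candidates v x \<sigma>) \<le> word us x (word us x (\<lambda>\<tau>. of_bool (\<forall>u\<in>set us. \<tau> u \<noteq> x))) \<sigma>"
  proof (rule markov_ge_const[OF markov_word_class[of us v x]])
    fix \<tau> assume t: "near_class v x \<sigma> \<tau>"
    then show "(1 - p) ^ card (candidates v x \<sigma>) \<le> word us x (\<lambda>\<tau>. of_bool (\<forall>u\<in>set us. \<tau> u \<noteq> x)) \<tau>"
      using word_none_ge[of us v x \<tau>] assms near_class_\<Omega>[OF t] cap[of \<tau>] candidates_eq[OF t] by simp
  qed (use assms in auto)
  then show ?thesis unfolding phase_def eq by simp
qed

text \<open>At the update of \<open>u\<close> in the second pass, each neighbour of \<open>v\<close>
  carries \<open>x\<close> with probability at most \<open>p\<close>. By a union bound over the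
  candidates adjacent to \<open>u\<close>, the colour is then likely to be free for
  \<open>u\<close>, which takes it with probability \<open>p\<close>.\<close>

lemma phase_hit_ge:
  assumes "distinct us" "set us = nb v" "1 \<le> x" "x \<le> q" "\<sigma> \<in> \<Omega>" "u \<in> candidates v x \<sigma>"
  shows "p * (1 - p * card {w \<in> candidates v x \<sigma>. adj u w}) \<le> phase us x (\<lambda>\<tau>. of_bool (\<tau> u = x)) \<sigma>"
proof -
  define F where "F = candidates v x \<sigma>"
  define A where "A = {w\<in>F. adj u w}"
  have "u \<in> set us" using assms(2,6) candidates_subset by blast
  then obtain us1 us2 where us: "us = us1 @ u # us2" "u \<notin> set us2" using split_list_last by metis
  \<comment> \<open>Everything before the last update of \<open>u\<close>. Thanks to the first pass,
    \<open>W\<close> contains every neighbour of \<open>v\<close>, including those that come after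
    \<open>u\<close>.\<close>
  define W where "W = us @ us1"
  have WW: "us @ us = W @ u # us2" by (simp add: W_def us)
  have Wset: "set W = nb v" using assms(2) us by (auto simp: W_def)
  have mW: "markov (near_class v x) (word W x)" by (rule markov_word_class) (use Wset assms in auto)
  have us2: "word us2 x (\<lambda>\<tau>. of_bool (\<tau> u = x)) = (\<lambda>\<tau>. of_bool (\<tau> u = x))"
    by (rule ext, rule markov_fixed[OF markov_word_other[OF us(2)]]) simp
  have finA: "finite A" by (simp add: A_def F_def)
  have "p * (1 - p * card A) \<le> p * (1 - (\<Sum>w\<in>A. word W x (\<lambda>\<tau>. of_bool (\<tau> w = x)) \<sigma>))"
  proof -
    have "(\<Sum>w\<in>A. word W x (\<lambda>\<tau>. of_bool (\<tau> w = x)) \<sigma>) \<le> (\<Sum>w\<in>A. p)"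
      by (intro sum_mono word_occupied_le[of _ _ v])
         (use Wset assms candidates_subset[of v x \<sigma>] in \<open>auto simp: A_def F_def\<close>)
    then show ?thesis using p_bounds by (simp add: mult.commute)
  qed
  also have "\<dots> = word W x (\<lambda>\<tau>. p + (- p) * (\<Sum>w\<in>A. of_bool (\<tau> w = x))) \<sigma>"
    by (simp only: markov_affine[OF mW] markov_sum[OF mW finA]) (simp add: algebra_simps)
  also have "\<dots> \<le> word W x (upd u x (\<lambda>\<tau>. of_bool (\<tau> u = x))) \<sigma>"
  proof (rule markov_le[OF mW])
    fix \<tau> assume t: "near_class v x \<sigma> \<tau>"
    have tO: "\<tau> \<in> \<Omega>" using near_class_\<Omega>[OF t] assms by blast
    have uF: "u \<in> candidates v x \<tau>" using candidates_eq[OF t] assms(6) by simp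
    show "p + - p * (\<Sum>w\<in>A. of_bool (\<tau> w = x)) \<le> upd u x (\<lambda>\<tau>. of_bool (\<tau> u = x)) \<tau>"
    proof (cases "free \<tau> u x")
      case True
      have "0 \<le> (\<Sum>w\<in>A. of_bool (\<tau> w = x) :: real)" by (intro sum_nonneg) auto
      then show ?thesis using True uF p_bounds assms(3) by (auto simp: upd_def candidates_def)
    next
      case False
      then obtain w where w: "adj u w" "\<tau> w = x" by (auto simp: free_def)
      then have "adj v w" using uF by (auto simp: candidates_def)
      \<comment> \<open>A blocking vertex carries \<open>x\<close> in a proper state, so it is a
        candidate itself. Hence only the candidates adjacent to \<open>u\<close> count, and sparsity
        controls their number on average.\<close>
      then have "w \<in> candidates v x \<tau>" using w \<Omega>_free[OF tO w(2)] assms(3)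
        by (auto simp: candidates_def nb_def free_def)
      then have wA: "w \<in> A" using candidates_eq[OF t] w by (auto simp: A_def F_def)
      have "(1::real) \<le> (\<Sum>w\<in>A. of_bool (\<tau> w = x))"
        using member_le_sum[OF wA, of "\<lambda>w. of_bool (\<tau> w = x) :: real"] finA w by auto
      then have "p * 1 \<le> p * (\<Sum>w\<in>A. of_bool (\<tau> w = x))" using p_bounds by (intro mult_left_mono) auto
      moreover have "0 \<le> upd u x (\<lambda>\<tau>. of_bool (\<tau> u = x)) \<tau>" using p_bounds by (simp add: upd_def)
      ultimately show ?thesis by simp
    qed
  qed
  finally show ?thesis unfolding phase_def WW by (simp add: us2 A_def F_def)
qed

section \<open>An exponential moment for the size of a list\<close>

definition occ :: "nat \<Rightarrow> nat \<Rightarrow> pcol \<Rightarrow> nat" where "occ v x \<tau> = card {u \<in> nb v. \<tau> u = x}"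

text \<open>\<open>\<theta>\<close> is the price of one occurrence. Summed over all colours, the
  cost is at most the list size plus \<open>\<theta>\<close> times the degree, so a short list
  forces a small total cost.\<close>

definition cost :: "real \<Rightarrow> nat \<Rightarrow> nat \<Rightarrow> pcol \<Rightarrow> real" where
  "cost \<theta> v x \<tau> = of_bool (free \<tau> v x) + \<theta> * occ v x \<tau>"

text \<open>Lower bound for the expected number of hits among \<open>Z\<close> candidates of average
  inner degree \<open>d\<close>, less the second-order loss of linearising
  \<open>exp (- \<theta> * N)\<close> for \<open>N \<le> Z\<close>.\<close>

definition gain :: "real \<Rightarrow> nat \<Rightarrow> real \<Rightarrow> real" where
  "gain \<theta> Z d = p * Z * (1 - d * p) - \<theta> * (real Z)\<^sup>2 / 2"

lemma markov_phase: "set us \<subseteq> nb v \<Longrightarrow> x \<le> q \<Longrightarrow> markov (near_class v x) (phase us x)"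
  unfolding phase_def by (rule markov_word_class) auto

text \<open>With at most \<open>Z\<close> candidates the colour survives with probability at least
  \<open>(1 - p) ^ Z\<close>, and survival lowers \<open>exp (- cost)\<close> by at least one half.
  With more, \<open>Z\<close> candidates of low average degree are hit often enough. The second
  condition on \<open>\<theta>\<close> lets the first alternative gain as much as the
  second.\<close>

lemma phase_cost_le:
  fixes d \<theta> :: real
  assumes us: "distinct us" "set us = nb v" and x: "1 \<le> x" "x \<le> q" and s: "\<sigma> \<in> \<Omega>"
    and sparse: "\<And>F. F \<subseteq> nb v \<Longrightarrow> (\<Sum>u\<in>F. real (card {w\<in>F. adj u w})) \<le> d * card F"
    and \<theta>: "0 \<le> \<theta>" "\<theta> * gain \<theta> Z d \<le> (1 - p) ^ Z / 2"
  shows "phase us x (\<lambda>\<tau>. exp (- cost \<theta> v x \<tau>)) \<sigma> \<le> exp (- \<theta> * gain \<theta> Z d)"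
proof -
  define F where "F = candidates v x \<sigma>"
  have mk: "markov (near_class v x) (phase us x)" using markov_phase us x by auto
  show ?thesis
  proof (cases "card F \<le> Z")
    case True
    have "phase us x (\<lambda>\<tau>. exp (- cost \<theta> v x \<tau>)) \<sigma> \<le> phase us x (\<lambda>\<tau>. 1 + (- 1/2) * of_bool (free \<tau> v x)) \<sigma>"
    proof (rule markov_le[OF mk])
      fix \<tau>
      have "exp (- cost \<theta> v x \<tau>) \<le> exp (- of_bool (free \<tau> v x))" using \<theta>(1) by (simp add: cost_def)
      also have "\<dots> \<le> 1 + (- 1/2) * of_bool (free \<tau> v x)"
        using exp_ge_add_one_self[of 1] by (cases "free \<tau> v x") (auto simp: exp_minus field_simps)
      finally show "exp (- cost \<theta> v x \<tau>) \<le> 1 + (- 1/2) * of_bool (free \<tau> v x)" .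
    qed
    also have "\<dots> = 1 + (- 1/2) * phase us x (\<lambda>\<tau>. of_bool (free \<tau> v x)) \<sigma>" by (rule markov_affine[OF mk])
    also have "\<dots> \<le> 1 - (1 - p) ^ Z / 2"
    proof -
      have "(1 - p) ^ Z \<le> (1 - p) ^ card F" using True p_bounds by (intro power_decreasing) auto
      then show ?thesis using phase_none_ge[OF us x s] by (simp add: F_def)
    qed
    also have "\<dots> \<le> 1 + (- \<theta> * gain \<theta> Z d)" using \<theta>(2) by simp
    also have "\<dots> \<le> exp (- \<theta> * gain \<theta> Z d)" by (rule exp_ge_add_one_self)
    finally show ?thesis .
  next
    case False
    have finF: "finite F" by (simp add: F_def)
    have "F \<subseteq> nb v" using candidates_subset by (simp add: F_def)
    \<comment> \<open>The degrees count neighbours in all of \<open>F\<close>, because every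
      candidate, chosen or not, can block a member of \<open>F'\<close>.\<close>
    then obtain F' where F': "F' \<subseteq> F" "card F' = Z" "(\<Sum>u\<in>F'. real (card {w\<in>F. adj u w})) \<le> d * Z"
      using exists_subset_sum_le[OF finF sparse, of Z] False by auto
    have finF': "finite F'" using F' finF finite_subset by blast
    define N where "N \<tau> = (\<Sum>u\<in>F'. of_bool (\<tau> u = x) :: real)" for \<tau>
    have N: "0 \<le> N \<tau>" "N \<tau> \<le> Z" "N \<tau> \<le> occ v x \<tau>" for \<tau>
    proof -
      show "0 \<le> N \<tau>" unfolding N_def by (intro sum_nonneg) auto
      have "N \<tau> \<le> (\<Sum>u\<in>F'. 1)" unfolding N_def by (intro sum_mono) auto
      then show "N \<tau> \<le> Z" using F' by simp
      have "N \<tau> = card {u\<in>F'. \<tau> u = x}" unfolding N_def using finF' by (simp add: sum.If_cases Int_def of_bool_def)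
      also have "\<dots> \<le> occ v x \<tau>" unfolding occ_def of_nat_le_iff
        by (rule card_mono) (use F' \<open>F \<subseteq> nb v\<close> in auto)
      finally show "N \<tau> \<le> occ v x \<tau>" .
    qed
    have EN: "p * Z * (1 - d * p) \<le> phase us x N \<sigma>"
    proof -
      have "p * Z * (1 - d * p) = p * Z - p * p * (d * Z)" by (simp add: algebra_simps)
      also have "\<dots> \<le> p * Z - p * p * (\<Sum>u\<in>F'. real (card {w\<in>F. adj u w}))"
        using F'(3) p_bounds by (intro diff_left_mono mult_left_mono) auto
      also have "\<dots> = (\<Sum>u\<in>F'. p * (1 - p * card {w\<in>F. adj u w}))"
        by (simp add: F'(2)[symmetric] algebra_simps sum_subtractf sum_distrib_left)
      also have "\<dots> \<le> (\<Sum>u\<in>F'. phase us x (\<lambda>\<tau>. of_bool (\<tau> u = x)) \<sigma>)"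
        unfolding F_def by (intro sum_mono phase_hit_ge[OF us x s]) (use F' in \<open>auto simp: F_def\<close>)
      also have "\<dots> = phase us x N \<sigma>" unfolding N_def by (rule markov_sum[OF mk finF', symmetric])
      finally show ?thesis .
    qed
    have "phase us x (\<lambda>\<tau>. exp (- cost \<theta> v x \<tau>)) \<sigma> \<le> phase us x (\<lambda>\<tau>. (1 + \<theta>\<^sup>2 * (real Z)\<^sup>2 / 2) + (- \<theta>) * N \<tau>) \<sigma>"
    proof (rule markov_le[OF mk])
      fix \<tau>
      have "exp (- cost \<theta> v x \<tau>) \<le> exp (- (\<theta> * N \<tau>))"
        using mult_left_mono[OF N(3)[of \<tau>] \<theta>(1)] by (simp add: cost_def)
      also have "\<dots> \<le> 1 - \<theta> * N \<tau> + (\<theta> * N \<tau>)\<^sup>2 / 2" using N \<theta> by (intro exp_minus_le) auto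
      also have "\<dots> \<le> 1 - \<theta> * N \<tau> + (\<theta> * Z)\<^sup>2 / 2"
        using N \<theta> by (intro add_left_mono divide_right_mono power_mono mult_left_mono) auto
      finally show "exp (- cost \<theta> v x \<tau>) \<le> (1 + \<theta>\<^sup>2 * (real Z)\<^sup>2 / 2) + (- \<theta>) * N \<tau>"
        by (simp add: power_mult_distrib)
    qed
    also have "\<dots> = (1 + \<theta>\<^sup>2 * (real Z)\<^sup>2 / 2) + (- \<theta>) * phase us x N \<sigma>"
      by (rule markov_affine[OF mk])
    also have "\<dots> \<le> (1 + \<theta>\<^sup>2 * (real Z)\<^sup>2 / 2) + (- \<theta>) * (p * Z * (1 - d * p))"
      using mult_left_mono[OF EN \<theta>(1)] by simp
    also have "\<dots> = 1 + (- \<theta> * gain \<theta> Z d)" by (simp add: gain_def algebra_simps power2_eq_square)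
    also have "\<dots> \<le> exp (- \<theta> * gain \<theta> Z d)" by (rule exp_ge_add_one_self)
    finally show ?thesis .
  qed
qed

lemma cost_other: "near_class v x \<sigma> \<tau> \<Longrightarrow> y \<noteq> x \<Longrightarrow> y \<noteq> 0 \<Longrightarrow> cost \<theta> v y \<tau> = cost \<theta> v y \<sigma>"
proof -
  assume a: "near_class v x \<sigma> \<tau>" "y \<noteq> x" "y \<noteq> 0"
  then have "\<tau> u = y \<longleftrightarrow> \<sigma> u = y" for u unfolding near_class_def by (metis empty_iff insert_iff)
  then show ?thesis by (simp add: cost_def free_def occ_def)
qed

text \<open>Resampling later classes does not change the cost of an earlier colour, so its factor is
  pulled out. The moments multiply because each bound is uniform in the state in which its phase
  starts.\<close>

lemma sweep_cost_le:
  fixes d \<theta> :: real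
  assumes us: "distinct us" "set us = nb v" and xs: "distinct xs" "set xs \<subseteq> {1..q}" and s: "\<sigma> \<in> \<Omega>"
    and sparse: "\<And>F. F \<subseteq> nb v \<Longrightarrow> (\<Sum>u\<in>F. real (card {w\<in>F. adj u w})) \<le> d * card F"
    and \<theta>: "0 \<le> \<theta>" "\<theta> * gain \<theta> Z d \<le> (1 - p) ^ Z / 2"
  shows "foldr (phase us) xs (\<lambda>\<tau>. exp (- (\<Sum>x\<in>set xs. cost \<theta> v x \<tau>))) \<sigma> \<le> exp (- \<theta> * gain \<theta> Z d) ^ length xs"
  using xs s
proof (induction xs arbitrary: \<sigma>)
  case Nil
  then show ?case by simp
next
  case (Cons x xs)
  define g where "g \<tau> = exp (- cost \<theta> v x \<tau>)" for \<tau>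
  define G where "G \<tau> = exp (- (\<Sum>x\<in>set xs. cost \<theta> v x \<tau>))" for \<tau>
  have x: "1 \<le> x" "x \<le> q" using Cons.prems by auto
  define Rs where "Rs \<sigma> \<tau> \<longleftrightarrow> near v \<sigma> \<tau> \<and> g \<tau> = g \<sigma>" for \<sigma> \<tau>
  have mk: "markov Rs (foldr (phase us) xs)"
  proof (rule markov_foldr)
    show "reflp Rs" "transp Rs" unfolding Rs_def near_def by (auto intro!: reflpI transpI)
    fix y assume y: "y \<in> set xs"
    show "markov Rs (phase us y)"
    proof (rule markov_mono[OF markov_phase[of us v y]])
      fix \<sigma> \<tau> assume nc: "near_class v y \<sigma> \<tau>"
      have "cost \<theta> v x \<tau> = cost \<theta> v x \<sigma>" by (rule cost_other[OF nc]) (use y Cons.prems x in auto)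
      then show "Rs \<sigma> \<tau>" using nc by (simp add: Rs_def g_def near_class_def)
    qed (use y Cons.prems us in auto)
  qed
  have "foldr (phase us) (x # xs) (\<lambda>\<tau>. exp (- (\<Sum>x\<in>set (x # xs). cost \<theta> v x \<tau>))) \<sigma>
      = phase us x (foldr (phase us) xs (\<lambda>\<tau>. g \<tau> * G \<tau>)) \<sigma>"
    using Cons.prems(1) by (simp add: g_def G_def mult_exp_exp)
  also have "\<dots> \<le> phase us x (\<lambda>\<tau>. exp (- \<theta> * gain \<theta> Z d) ^ length xs * g \<tau>) \<sigma>"
  proof (rule markov_le[OF markov_phase[of us v x]])
    fix \<tau> assume t: "near_class v x \<sigma> \<tau>"
    have "foldr (phase us) xs (\<lambda>\<tau>. g \<tau> * G \<tau>) \<tau> = g \<tau> * foldr (phase us) xs G \<tau>"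
      by (rule markov_pull[OF mk]) (simp add: Rs_def)
    also have "\<dots> \<le> g \<tau> * exp (- \<theta> * gain \<theta> Z d) ^ length xs"
      unfolding G_def using Cons.prems near_class_\<Omega>[OF t]
      by (intro mult_left_mono Cons.IH) (auto simp: g_def)
    finally show "foldr (phase us) xs (\<lambda>\<tau>. g \<tau> * G \<tau>) \<tau> \<le> exp (- \<theta> * gain \<theta> Z d) ^ length xs * g \<tau>"
      by (simp add: mult.commute)
  qed (use us x in auto)
  also have "\<dots> = exp (- \<theta> * gain \<theta> Z d) ^ length xs * phase us x g \<sigma>"
    by (rule markov_cmult[OF markov_phase[of us v x]]) (use us x in auto)
  also have "\<dots> \<le> exp (- \<theta> * gain \<theta> Z d) ^ length xs * exp (- \<theta> * gain \<theta> Z d)"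
    unfolding g_def using Cons.prems
    by (intro mult_left_mono phase_cost_le[OF us x _ sparse \<theta>]) auto
  finally show ?case by (simp add: mult.commute)
qed

definition avail :: "pcol \<Rightarrow> nat \<Rightarrow> nat set" where "avail \<sigma> v = {x\<in>{1..q}. free \<sigma> v x}"

lemma markov_sweep_near:
  assumes "set us \<subseteq> nb v" "set xs \<subseteq> {1..q}"
  shows "markov (near v) (foldr (phase us) xs)"
  by (intro markov_foldr markov_mono[OF markov_phase[of us v]])
     (use assms in \<open>auto simp: near_class_def\<close>)

text \<open>Exponential Markov inequality for the total cost: fewer than \<open>l\<close> free
  colours and at most \<open>\<Delta>\<close> occurrences force it below
  \<open>l + \<theta> * \<Delta>\<close>.\<close>

lemma sweep_avail_le:
  fixes d \<theta> :: real
  assumes us: "distinct us" "set us = nb v" and xs: "distinct xs" "set xs = {1..q}" and s: "\<sigma> \<in> \<Omega>"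
    and sparse: "\<And>F. F \<subseteq> nb v \<Longrightarrow> (\<Sum>u\<in>F. real (card {w\<in>F. adj u w})) \<le> d * card F"
    and \<theta>: "0 \<le> \<theta>" "\<theta> * gain \<theta> Z d \<le> (1 - p) ^ Z / 2" and deg: "card (nb v) \<le> \<Delta>"
  shows "foldr (phase us) xs (\<lambda>\<tau>. of_bool (card (avail \<tau> v) < l)) \<sigma> \<le> exp (l + \<theta> * \<Delta> - \<theta> * gain \<theta> Z d * q)"
proof -
  have mk: "markov (near v) (foldr (phase us) xs)" by (rule markov_sweep_near) (use us xs in auto)
  have len: "length xs = q" using distinct_card[OF xs(1)] xs(2) by simp
  have "foldr (phase us) xs (\<lambda>\<tau>. of_bool (card (avail \<tau> v) < l)) \<sigma>
     \<le> foldr (phase us) xs (\<lambda>\<tau>. exp (l + \<theta> * \<Delta>) * exp (- (\<Sum>x\<in>set xs. cost \<theta> v x \<tau>))) \<sigma>"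
  proof (rule markov_le[OF mk])
    fix \<tau>
    have av: "(\<Sum>x\<in>{1..q}. of_bool (free \<tau> v x) :: real) = card (avail \<tau> v)"
      unfolding avail_def of_bool_def by (simp add: sum.If_cases Int_def)
    have "(\<Sum>x\<in>{1..q}. occ v x \<tau>) \<le> card (nb v)"
    proof -
      have "(\<Sum>x\<in>{1..q}. occ v x \<tau>) = card (\<Union>x\<in>{1..q}. {u \<in> nb v. \<tau> u = x})"
        unfolding occ_def by (rule card_UN_disjoint[symmetric]) auto
      also have "\<dots> \<le> card (nb v)" by (rule card_mono) auto
      finally show ?thesis .
    qed
    then have "real (\<Sum>x\<in>{1..q}. occ v x \<tau>) \<le> real \<Delta>" using deg by linarith
    then have "\<theta> * real (\<Sum>x\<in>{1..q}. occ v x \<tau>) \<le> \<theta> * \<Delta>"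
      using \<theta>(1) by (rule mult_left_mono)
    then have c: "(\<Sum>x\<in>{1..q}. cost \<theta> v x \<tau>) \<le> card (avail \<tau> v) + \<theta> * \<Delta>"
      unfolding cost_def sum.distrib av of_nat_sum sum_distrib_left by simp
    show "of_bool (card (avail \<tau> v) < l) \<le> exp (l + \<theta> * \<Delta>) * exp (- (\<Sum>x\<in>set xs. cost \<theta> v x \<tau>))"
    proof (cases "card (avail \<tau> v) < l")
      case True
      then have "0 \<le> l + \<theta> * \<Delta> + - (\<Sum>x\<in>set xs. cost \<theta> v x \<tau>)" using c xs(2) by simp
      then have "1 \<le> exp (l + \<theta> * \<Delta> + - (\<Sum>x\<in>set xs. cost \<theta> v x \<tau>))" by simp
      then show ?thesis using True unfolding exp_add[of "l + \<theta> * \<Delta>"] by simp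
    qed simp
  qed
  also have "\<dots> = exp (l + \<theta> * \<Delta>) * foldr (phase us) xs (\<lambda>\<tau>. exp (- (\<Sum>x\<in>set xs. cost \<theta> v x \<tau>))) \<sigma>"
    by (rule markov_cmult[OF mk])
  also have "\<dots> \<le> exp (l + \<theta> * \<Delta>) * exp (- \<theta> * gain \<theta> Z d) ^ length xs"
  proof (rule mult_left_mono)
    have "set xs \<subseteq> {1..q}" using xs by auto
    then show "foldr (phase us) xs (\<lambda>\<tau>. exp (- (\<Sum>x\<in>set xs. cost \<theta> v x \<tau>))) \<sigma> \<le> exp (- \<theta> * gain \<theta> Z d) ^ length xs"
      by (rule sweep_cost_le[OF us xs(1) _ s sparse \<theta>])
  qed simp
  also have "exp (l + \<theta> * \<Delta>) * exp (- \<theta> * gain \<theta> Z d) ^ length xs = exp (l + \<theta> * \<Delta> - \<theta> * gain \<theta> Z d * q)"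
    unfolding len exp_of_nat_mult[symmetric] mult_exp_exp by (rule arg_cong[of _ _ exp]) (simp add: algebra_simps)
  finally show ?thesis .
qed

end

section \<open>Repairing vertices with many blank neighbours\<close>

locale scheme = palette +
  fixes l r Y R :: nat
  assumes q_less_Y: "q < Y"
begin

text \<open>A machine with fair coins can draw uniformly only from ranges whose size is a power of two.
  Instead of recolouring \<open>u\<close> uniformly from its list, it makes \<open>R\<close> attempts with random colours below
  \<open>Y\<close>; drawn numbers that are not colours are ignored.\<close>

definition mix :: "nat \<Rightarrow> (pcol \<Rightarrow> real) \<Rightarrow> pcol \<Rightarrow> real" where
  "mix u f \<sigma> = (\<Sum>x<Y. if 1 \<le> x \<and> x \<le> q then upd u x f \<sigma> else f \<sigma>) / Y"

definition renew :: "nat \<Rightarrow> (pcol \<Rightarrow> real) \<Rightarrow> pcol \<Rightarrow> real" where "renew u = mix u ^^ R"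

lemma mix_alt: "mix u = (\<lambda>f \<sigma>. (\<Sum>x\<in>{..<Y}. (\<lambda>x. if 1 \<le> x \<and> x \<le> q then upd u x else (\<lambda>f. f)) x f \<sigma>) / real (card {..<Y}))"
  by (intro ext) (simp add: mix_def if_distrib[of "\<lambda>K. K _ _"] cong: if_cong)

lemma markov_mix: "u < n \<Longrightarrow> markov (near_vertex u) (mix u)"
  unfolding mix_alt using q_less_Y
  by (intro markov_average) (auto intro: markov_upd_vertex markov_id)

lemma markov_renew: "u < n \<Longrightarrow> markov (near_vertex u) (renew u)"
  unfolding renew_def by (intro markov_funpow markov_mix) auto

lemma adjoint_mix: "u < n \<Longrightarrow> adjoint \<Omega> wt (mix u) (mix u)"
  unfolding mix_alt by (rule adjoint_average) (auto intro: adjoint_upd simp: adjoint_def[of _ _ "\<lambda>f. f"])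

lemma adjoint_renew: "u < n \<Longrightarrow> adjoint \<Omega> wt (renew u) (renew u)"
  unfolding renew_def by (intro adjoint_funpow adjoint_mix)

lemma finite_avail[simp]: "finite (avail \<tau> u)" by (simp add: avail_def)

lemma card_avail_le: "card (avail \<tau> u) \<le> q"
proof -
  have "card (avail \<tau> u) \<le> card {1..q}" by (rule card_mono) (auto simp: avail_def)
  then show ?thesis by simp
qed

lemma avail_near_vertex: "near_vertex u \<sigma> \<tau> \<Longrightarrow> avail \<tau> u = avail \<sigma> u"
  unfolding avail_def free_def near_vertex_def using adj_irrefl by metis

text \<open>One attempt is an affine map on the probability of being blank: a blank vertex gets
  coloured with probability \<open>p * card (avail \<sigma> u) / Y\<close>, and a coloured one can
  become blank only when its own colour is drawn.\<close>

lemma mix_blank: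
  assumes s: "\<sigma> \<in> \<Omega>"
  shows "mix u (\<lambda>\<tau>. of_bool (\<tau> u = 0)) \<sigma> =
    (1 - p) / Y + (1 - (card (avail \<sigma> u) * p + 1 - p) / Y) * of_bool (\<sigma> u = 0)"
proof (cases "\<sigma> u = 0")
  case True
  have "(\<Sum>x<Y. if 1 \<le> x \<and> x \<le> q then upd u x (\<lambda>\<tau>. of_bool (\<tau> u = 0)) \<sigma> else of_bool (\<sigma> u = 0))
      = (\<Sum>x<Y. 1 - p * of_bool (x \<in> avail \<sigma> u))"
    by (rule sum.cong) (use True in \<open>auto simp: upd_def avail_def\<close>)
  also have "\<dots> = Y - p * card (avail \<sigma> u)"
  proof -
    have "avail \<sigma> u \<subseteq> {..<Y}" using q_less_Y by (auto simp: avail_def)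
    then have "{..<Y} \<inter> {x. x \<in> avail \<sigma> u} = avail \<sigma> u" by auto
    then have "(\<Sum>x<Y. of_bool (x \<in> avail \<sigma> u) :: real) = card (avail \<sigma> u)"
      unfolding of_bool_def by (simp add: sum.If_cases)
    then show ?thesis by (simp add: sum_subtractf flip: sum_distrib_left)
  qed
  finally have "mix u (\<lambda>\<tau>. of_bool (\<tau> u = 0)) \<sigma> = (Y - p * card (avail \<sigma> u)) / Y" by (simp add: mix_def)
  moreover have "(Y - p * card (avail \<sigma> u)) / Y = 1 - p * card (avail \<sigma> u) / Y"
    using q_less_Y by (simp add: diff_divide_distrib)
  ultimately show ?thesis using True by (simp add: add_divide_distrib diff_divide_distrib algebra_simps)
next
  case False
  have y: "\<sigma> u \<in> {1..q}" using False s by (auto simp: \<Omega>_def)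
  have "(\<Sum>x<Y. if 1 \<le> x \<and> x \<le> q then upd u x (\<lambda>\<tau>. of_bool (\<tau> u = 0)) \<sigma> else of_bool (\<sigma> u = 0))
      = (\<Sum>x<Y. if x = \<sigma> u then 1 - p else 0)"
    by (rule sum.cong) (use False y \<Omega>_free[OF s] in \<open>auto simp: upd_def\<close>)
  also have "\<dots> = 1 - p" using y q_less_Y by simp
  finally show ?thesis using False by (simp add: mix_def)
qed

text \<open>Iterates the affine map of \<open>mix_blank\<close>: the first term bounds its fixed
  point \<open>(1 - p) / (M * p + 1 - p)\<close>, the second the remaining influence of the initial
  value. The list of \<open>u\<close> stays the same meanwhile, as it depends on the neighbours
  only.\<close>

lemma renew_blank_le:
  fixes m :: real
  assumes u: "u < n" and s: "\<sigma> \<in> \<Omega>" and m: "0 < m" "m \<le> card (avail \<sigma> u)"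
  shows "renew u (\<lambda>\<tau>. of_bool (\<tau> u = 0)) \<sigma> \<le> 1 / (p * m) + (1 - 1 / (2 * Y)) ^ R"
proof -
  define M where "M = card (avail \<sigma> u)"
  define a where "a = (1 - p) / Y"
  define k where "k = 1 - (M * p + 1 - p) / Y"
  have M: "1 \<le> real M" "real M \<le> q" "m \<le> real M" using m card_avail_le[of \<sigma> u] by (auto simp: M_def)
  have Y: "real q + 1 \<le> Y" using q_less_Y by linarith
  have Mp: "0 \<le> (real M - 1) * p" "(real M - 1) * p \<le> (real M - 1) * 1" "0 \<le> M * p" using M p_bounds by (auto intro: mult_left_mono mult_left_le)
  have k0: "0 \<le> k" using Mp M Y by (simp add: k_def field_simps)
  have k1: "k \<le> 1 - 1 / (2 * Y)"
  proof -
    have "1 / (2 * Y) = (1 / 2) / Y" by simp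
    also have "\<dots> \<le> (M * p + 1 - p) / Y" using Mp p_bounds by (intro divide_right_mono) auto
    finally show ?thesis by (simp add: k_def)
  qed
  have ka: "1 - k = (M * p + 1 - p) / Y" by (simp add: k_def)
  have iter: "(mix u ^^ j) (\<lambda>\<tau>. of_bool (\<tau> u = 0)) \<tau> = a * (\<Sum>i<j. k ^ i) + k ^ j * of_bool (\<tau> u = 0)"
    if "near_vertex u \<sigma> \<tau>" for j \<tau>
    using that
  proof (induction j arbitrary: \<tau>)
    case 0
    then show ?case by simp
  next
    case (Suc j)
    have t: "\<tau> \<in> \<Omega>" using Suc.prems s by (auto simp: near_vertex_def)
    have "(mix u ^^ Suc j) (\<lambda>\<tau>. of_bool (\<tau> u = 0)) \<tau> = mix u (\<lambda>\<tau>. a * (\<Sum>i<j. k ^ i) + k ^ j * of_bool (\<tau> u = 0)) \<tau>"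
      unfolding funpow.simps comp_def
    proof (rule markov_eq[OF markov_mix[OF u]])
      fix \<rho> assume "near_vertex u \<tau> \<rho>"
      then have "near_vertex u \<sigma> \<rho>" using Suc.prems near_vertex_refl_trans(2) transpD by metis
      then show "(mix u ^^ j) (\<lambda>\<tau>. of_bool (\<tau> u = 0)) \<rho> = a * (\<Sum>i<j. k ^ i) + k ^ j * of_bool (\<rho> u = 0)"
        by (rule Suc.IH)
    qed
    also have "\<dots> = a * (\<Sum>i<j. k ^ i) + k ^ j * mix u (\<lambda>\<tau>. of_bool (\<tau> u = 0)) \<tau>"
      by (rule markov_affine[OF markov_mix[OF u]])
    also have "mix u (\<lambda>\<tau>. of_bool (\<tau> u = 0)) \<tau> = a + k * of_bool (\<tau> u = 0)"
      unfolding mix_blank[OF t] avail_near_vertex[OF Suc.prems] a_def k_def M_def ..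
    finally show ?case by (simp add: algebra_simps)
  qed
  have "near_vertex u \<sigma> \<sigma>" by (simp add: near_vertex_def)
  then have "renew u (\<lambda>\<tau>. of_bool (\<tau> u = 0)) \<sigma> = a * (\<Sum>i<R. k ^ i) + k ^ R * of_bool (\<sigma> u = 0)"
    using iter unfolding renew_def by blast
  also have "\<dots> \<le> 1 / (p * m) + (1 - 1 / (2 * Y)) ^ R"
  proof (rule add_mono)
    have D: "M * p + 1 - p > 0" using Mp p_bounds by linarith
    have k1': "k < 1" using D Y by (simp add: k_def)
    have "(\<Sum>i<R. k ^ i) = (1 - k ^ R) / (1 - k)" using sum_gp_strict[of k R] k1' by simp
    also have "\<dots> \<le> 1 / (1 - k)" using k0 k1' by (intro divide_right_mono) auto
    finally have "a * (\<Sum>i<R. k ^ i) \<le> a * (1 / (1 - k))" using p_bounds by (intro mult_left_mono) (auto simp: a_def)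
    also have "\<dots> = (1 - p) / (M * p + 1 - p)" using Y unfolding ka a_def by simp
    also have "\<dots> \<le> 1 / (p * m)"
    proof -
      have "p * m \<le> M * p" using M p_bounds by (simp add: mult.commute)
      then have "p * m \<le> M * p + 1 - p" using p_bounds by linarith
      moreover have "0 < p * m" using p_bounds m by simp
      ultimately show ?thesis using p_bounds by (intro frac_le) auto
    qed
    finally show "a * (\<Sum>i<R. k ^ i) \<le> 1 / (p * m)" .
    have "k ^ R * of_bool (\<sigma> u = 0) \<le> k ^ R" using k0 by simp
    also have "\<dots> \<le> (1 - 1 / (2 * Y)) ^ R" using k0 k1 by (intro power_mono) auto
    finally show "k ^ R * of_bool (\<sigma> u = 0) \<le> (1 - 1 / (2 * Y)) ^ R" .
  qed
  finally show ?thesis .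
qed

lemma near_vertex_near: "adj v u \<Longrightarrow> near_vertex u \<sigma> \<tau> \<Longrightarrow> near v \<sigma> \<tau>"
  unfolding near_vertex_def near_def by metis

lemma markov_renew_near: "adj v u \<Longrightarrow> markov (near v) (renew u)"
  by (rule markov_mono[OF markov_renew]) (auto intro: adj_lt2 near_vertex_near)

text \<open>The bound of \<open>renew_blank_le\<close> for the guaranteed list size
  \<open>m = l / 2\<close>.\<close>

definition blank_rate :: real where
  "blank_rate = 2 / (p * l) + (1 - 1 / (2 * Y)) ^ R"

text \<open>\<open>T\<close> collects vertices whose lists stay long whatever happens inside the
  neighbourhood, so the bound for each vertex holds conditionally on all the others. The factor
  \<open>2\<close> comes from \<open>exp 1 \<le> 3\<close>.\<close>

lemma scan_blank_le:
  assumes us: "distinct us" "set us \<subseteq> nb v" and l: "0 < l"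
    and T: "\<And>\<tau> u. near v \<sigma>0 \<tau> \<Longrightarrow> u \<in> T \<Longrightarrow> l / 2 \<le> card (avail \<tau> u)"
    and s: "\<sigma>0 \<in> \<Omega>" "near v \<sigma>0 \<sigma>"
  shows "foldr renew us (\<lambda>\<tau>. exp (\<Sum>u\<in>set us. of_bool (u \<in> T \<and> \<tau> u = 0))) \<sigma> \<le> (1 + 2 * blank_rate) ^ length us"
  using us s(2)
proof (induction us arbitrary: \<sigma>)
  case Nil
  then show ?case by simp
next
  case (Cons u us)
  have u: "adj v u" using Cons.prems by (auto simp: nb_def)
  then have un: "u < n" by (rule adj_lt2)
  have rate0: "0 \<le> blank_rate" unfolding blank_rate_def using p_bounds q_less_Y
    by (intro add_nonneg_nonneg zero_le_power) (auto simp: field_simps)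
  define g where "g \<tau> = exp (of_bool (u \<in> T \<and> \<tau> u = (0::nat)) :: real)" for \<tau> :: pcol
  define G where "G \<tau> = exp (\<Sum>u\<in>set us. of_bool (u \<in> T \<and> \<tau> u = (0::nat)) :: real)" for \<tau> :: pcol
  have mk: "markov (\<lambda>\<sigma> \<tau>. \<tau> u = \<sigma> u) (foldr renew us)"
  proof (rule markov_foldr)
    fix x assume x: "x \<in> set us"
    then show "markov (\<lambda>\<sigma> \<tau>. \<tau> u = \<sigma> u) (renew x)"
    proof (intro markov_mono[OF markov_renew])
      show "x < n" using x Cons.prems adj_lt2 by (auto simp: nb_def)
      have "u \<noteq> x" using x Cons.prems by auto
      then show "near_vertex x \<sigma> \<tau> \<Longrightarrow> \<tau> u = \<sigma> u" for \<sigma> \<tau> by (simp add: near_vertex_def)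
    qed
  qed (auto intro!: reflpI transpI)
  have "foldr renew (u # us) (\<lambda>\<tau>. exp (\<Sum>u\<in>set (u # us). of_bool (u \<in> T \<and> \<tau> u = 0))) \<sigma>
     = renew u (foldr renew us (\<lambda>\<tau>. g \<tau> * G \<tau>)) \<sigma>"
  proof -
    have "u \<notin> set us" using Cons.prems(1) by simp
    then have "(\<lambda>\<tau>. exp (\<Sum>u\<in>set (u # us). of_bool (u \<in> T \<and> \<tau> u = (0::nat)))) = (\<lambda>\<tau>. g \<tau> * G \<tau>)"
      unfolding g_def G_def mult_exp_exp by (simp only: list.set sum.insert finite_set not_False_eq_True)
    then show ?thesis by simp
  qed
  also have "\<dots> \<le> renew u (\<lambda>\<tau>. (1 + 2 * blank_rate) ^ length us * g \<tau>) \<sigma>"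
  proof (rule markov_le[OF markov_renew_near[OF u]])
    fix \<tau> assume t: "near v \<sigma> \<tau>"
    then have t0: "near v \<sigma>0 \<tau>" using Cons.prems(3) near_refl_trans(2) transpD by metis
    have "foldr renew us (\<lambda>\<tau>. g \<tau> * G \<tau>) \<tau> = g \<tau> * foldr renew us G \<tau>"
      by (rule markov_pull[OF mk]) (simp add: g_def)
    also have "\<dots> \<le> g \<tau> * (1 + 2 * blank_rate) ^ length us"
      unfolding G_def by (intro mult_left_mono Cons.IH t0) (use Cons.prems in \<open>auto simp: g_def\<close>)
    finally show "foldr renew us (\<lambda>\<tau>. g \<tau> * G \<tau>) \<tau> \<le> (1 + 2 * blank_rate) ^ length us * g \<tau>"
      by (simp add: mult.commute)
  qed
  also have "\<dots> = (1 + 2 * blank_rate) ^ length us * renew u g \<sigma>"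
    by (rule markov_cmult[OF markov_renew[OF un]])
  also have "\<dots> \<le> (1 + 2 * blank_rate) ^ length us * (1 + 2 * blank_rate)"
  proof (rule mult_left_mono)
    have g: "g \<tau> \<le> 1 + 2 * of_bool (u \<in> T \<and> \<tau> u = 0)" for \<tau>
      unfolding g_def using exp_le by auto
    show "renew u g \<sigma> \<le> 1 + 2 * blank_rate"
    proof (cases "u \<in> T")
      case False
      then have "g = (\<lambda>_. 1)" by (auto simp: g_def)
      then show ?thesis using markov_const[OF markov_renew[OF un], of 1 \<sigma>] rate0 by simp
    next
      case True
      have "renew u g \<sigma> \<le> renew u (\<lambda>\<tau>. 1 + 2 * of_bool (\<tau> u = 0)) \<sigma>"
        by (rule markov_le[OF markov_renew[OF un]]) (use g True in auto)
      also have "\<dots> = 1 + 2 * renew u (\<lambda>\<tau>. of_bool (\<tau> u = 0)) \<sigma>"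
        by (rule markov_affine[OF markov_renew[OF un]])
      also have "renew u (\<lambda>\<tau>. of_bool (\<tau> u = 0)) \<sigma> \<le> 1 / (p * (l / 2)) + (1 - 1 / (2 * Y)) ^ R"
        by (rule renew_blank_le[OF un]) (use Cons.prems(3) s(1) T[OF Cons.prems(3) True] l in \<open>auto simp: near_def\<close>)
      finally show ?thesis by (simp add: blank_rate_def)
    qed
    show "0 \<le> (1 + 2 * blank_rate) ^ length us" using rate0 by simp
  qed
  finally show ?case by (simp add: mult.commute)
qed

text \<open>The condition that all final lists are long is what the order of repairs buys: in the
  reversed picture the final state is the one whose lowest flaw is the crowded vertex. The scan
  cannot change which colours are seen outside the neighbourhood, so long final lists mean that
  enough colours were unseen there all along.\<close>

lemma scan_flaw_le:
  fixes d :: real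
  assumes us: "distinct us" "set us = nb v" and l: "0 < l" and s: "\<sigma> \<in> \<Omega>" and deg: "card (nb v) \<le> \<Delta>"
    and sparse: "\<And>F. F \<subseteq> nb v \<Longrightarrow> (\<Sum>u\<in>F. real (card {w\<in>F. adj u w})) \<le> d * card F"
    and d: "0 \<le> d" "2 * d * \<Delta> / l \<le> r / 2"
  shows "foldr renew us (\<lambda>\<tau>. of_bool (card {u\<in>nb v. \<tau> u = 0} > r \<and> (\<forall>u\<in>nb v. l \<le> card (avail \<tau> u)))) \<sigma>
     \<le> exp (- (r / 2) + 2 * blank_rate * \<Delta>)"
proof -
  define inner where "inner u = {w\<in>nb v. adj u w}" for u
  define out where "out u = {x\<in>{1..q}. \<forall>w. adj u w \<longrightarrow> \<not> adj v w \<longrightarrow> \<sigma> w \<noteq> x}" for u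
  \<comment> \<open>With \<open>l\<close> colours unseen outside and at most \<open>l / 2\<close>
    neighbours inside, \<open>l / 2\<close> colours stay free. \<open>H\<close> holds the exceptions
    of large inner degree; sparsity leaves room for at most \<open>r / 2\<close> of them, so more
    than half of the blank vertices of a crowded neighbourhood lie in \<open>T\<close>.\<close>
  define T where "T = {u\<in>nb v. 2 * card (inner u) \<le> l \<and> l \<le> card (out u)}"
  define H where "H = {u\<in>nb v. 2 * card (inner u) > l}"
  have fin: "finite (inner u)" "finite (out u)" for u by (auto simp: inner_def out_def)
  have mk: "markov (near v) (foldr renew us)"
    by (intro markov_foldr markov_renew_near) (use us in \<open>auto simp: nb_def\<close>)
  have T: "l / 2 \<le> card (avail \<tau> u)" if "near v \<sigma> \<tau>" "u \<in> T" for \<tau> u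
  proof -
    have "x \<in> avail \<tau> u \<union> \<tau> ` inner u" if "x \<in> out u" for x
    proof (cases "free \<tau> u x")
      case True then show ?thesis using that by (auto simp: avail_def out_def)
    next
      case False
      then obtain w where w: "adj u w" "\<tau> w = x" by (auto simp: free_def)
      then have "adj v w" using that \<open>near v \<sigma> \<tau>\<close> unfolding out_def near_def by force
      then show ?thesis using w by (auto simp: inner_def nb_def)
    qed
    then have "card (out u) \<le> card (avail \<tau> u \<union> \<tau> ` inner u)" by (intro card_mono) (use fin in auto)
    also have "\<dots> \<le> card (avail \<tau> u) + card (\<tau> ` inner u)" by (rule card_Un_le)
    also have "\<dots> \<le> card (avail \<tau> u) + card (inner u)" using card_image_le[OF fin(1)] by simp
    finally have "card (out u) \<le> card (avail \<tau> u) + card (inner u)" .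
    moreover have "2 * card (inner u) \<le> l" "l \<le> card (out u)" using that by (auto simp: T_def)
    ultimately have "l \<le> 2 * card (avail \<tau> u)" by linarith
    then show ?thesis by linarith
  qed
  have H: "real (card H) \<le> r / 2"
  proof -
    have finH: "finite H" by (auto simp: H_def)
    have "card H * (l / 2) = (\<Sum>u\<in>H. real l / 2)" by simp
    also have "\<dots> \<le> (\<Sum>u\<in>H. real (card (inner u)))" by (intro sum_mono) (auto simp: H_def)
    also have "\<dots> \<le> (\<Sum>u\<in>nb v. real (card (inner u)))" by (intro sum_mono2) (auto simp: H_def)
    also have "\<dots> \<le> d * card (nb v)" using sparse[of "nb v"] by (simp add: inner_def)
    also have "\<dots> \<le> d * \<Delta>" using d deg by (intro mult_left_mono) auto
    finally have "real (card H) \<le> 2 * d * \<Delta> / l" using l by (simp add: field_simps)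
    then show ?thesis using d by linarith
  qed
  have rate0: "0 \<le> blank_rate" unfolding blank_rate_def using p_bounds q_less_Y
    by (intro add_nonneg_nonneg zero_le_power) (auto simp: field_simps)
  have "foldr renew us (\<lambda>\<tau>. of_bool (card {u\<in>nb v. \<tau> u = 0} > r \<and> (\<forall>u\<in>nb v. l \<le> card (avail \<tau> u)))) \<sigma>
     \<le> foldr renew us (\<lambda>\<tau>. exp (- (r / 2)) * exp (\<Sum>u\<in>set us. of_bool (u \<in> T \<and> \<tau> u = 0))) \<sigma>"
  proof (rule markov_le[OF mk])
    fix \<tau> assume t: "near v \<sigma> \<tau>"
    show "of_bool (card {u\<in>nb v. \<tau> u = 0} > r \<and> (\<forall>u\<in>nb v. l \<le> card (avail \<tau> u)))
       \<le> exp (- (r / 2)) * exp (\<Sum>u\<in>set us. of_bool (u \<in> T \<and> \<tau> u = 0))"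
    proof (cases "card {u\<in>nb v. \<tau> u = 0} > r \<and> (\<forall>u\<in>nb v. l \<le> card (avail \<tau> u))")
      case True
      have "l \<le> card (out u)" if u: "u \<in> nb v" for u
      proof -
        have "avail \<tau> u \<subseteq> out u"
          using t by (fastforce simp: avail_def out_def free_def near_def)
        then have "card (avail \<tau> u) \<le> card (out u)" by (intro card_mono fin)
        then show ?thesis using True u by force
      qed
      then have "{u\<in>nb v. \<tau> u = 0} \<subseteq> H \<union> {u\<in>T. \<tau> u = 0}" by (auto simp: H_def T_def)
      then have "card {u\<in>nb v. \<tau> u = 0} \<le> card (H \<union> {u\<in>T. \<tau> u = 0})"
        by (intro card_mono) (auto simp: H_def T_def)
      also have "\<dots> \<le> card H + card {u\<in>T. \<tau> u = 0}" by (rule card_Un_le)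
      finally have "r / 2 \<le> card {u\<in>T. \<tau> u = 0}" using H True by linarith
      also have "\<dots> = (\<Sum>u\<in>nb v. of_bool (u \<in> T \<and> \<tau> u = 0))"
      proof -
        have "nb v \<inter> {u. u \<in> T \<and> \<tau> u = 0} = {u\<in>T. \<tau> u = 0}" by (auto simp: T_def)
        then show ?thesis unfolding of_bool_def by (simp add: sum.If_cases)
      qed
      finally have "1 \<le> exp (- (r / 2) + (\<Sum>u\<in>nb v. of_bool (u \<in> T \<and> \<tau> u = 0)))" by simp
      moreover have "of_bool (card {u\<in>nb v. \<tau> u = 0} > r \<and> (\<forall>u\<in>nb v. l \<le> card (avail \<tau> u))) = (1::real)"
        using True by simp
      ultimately show ?thesis by (simp only: mult_exp_exp us(2))
    qed auto
  qed
  also have "\<dots> = exp (- (r / 2)) * foldr renew us (\<lambda>\<tau>. exp (\<Sum>u\<in>set us. of_bool (u \<in> T \<and> \<tau> u = 0))) \<sigma>"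
    by (rule markov_cmult[OF mk])
  also have "\<dots> \<le> exp (- (r / 2)) * (1 + 2 * blank_rate) ^ length us"
    by (intro mult_left_mono scan_blank_le[of us v \<sigma> T \<sigma>]) (use us l T s in \<open>auto simp: near_def\<close>)
  also have "\<dots> \<le> exp (- (r / 2)) * exp (2 * blank_rate) ^ \<Delta>"
  proof (rule mult_left_mono)
    have "(1 + 2 * blank_rate) ^ length us \<le> exp (2 * blank_rate) ^ length us"
      using exp_ge_add_one_self[of "2 * blank_rate"] rate0 by (intro power_mono) auto
    also have "\<dots> \<le> exp (2 * blank_rate) ^ \<Delta>"
      using rate0 deg us distinct_card[OF us(1)] by (intro power_increasing) auto
    finally show "(1 + 2 * blank_rate) ^ length us \<le> exp (2 * blank_rate) ^ \<Delta>" .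
  qed simp
  also have "\<dots> = exp (- (r / 2) + 2 * blank_rate * \<Delta>)"
    unfolding exp_of_nat_mult[symmetric] mult_exp_exp by (rule arg_cong[of _ _ exp]) (simp add: algebra_simps)
  finally show ?thesis .
qed

end

section \<open>The random walk\<close>

lemma card_UN_le_const:
  assumes "finite I" "\<And>i. i \<in> I \<Longrightarrow> card (A i) \<le> k" "card I \<le> m"
  shows "card (\<Union>i\<in>I. A i) \<le> m * k"
proof -
  have "card (\<Union>i\<in>I. A i) \<le> (\<Sum>i\<in>I. card (A i))" by (rule card_UN_le[OF assms(1)])
  also have "\<dots> \<le> card I * k" using sum_bounded_above[of I "\<lambda>i. card (A i)" k] assms(2) by simp
  also have "\<dots> \<le> m * k" using assms(3) by simp
  finally show ?thesis .
qed

context scheme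
begin

text \<open>Decreasing order, because the loops of the program count down.\<close>

definition nb_list :: "nat \<Rightarrow> nat list" where "nb_list v = rev (filter (adj v) [0..<n])"

lemma nb_list: "distinct (nb_list v)" "set (nb_list v) = nb v"
  using adj_lt2 by (auto simp: nb_list_def nb_def)

definition sweep_at :: "nat \<Rightarrow> (pcol \<Rightarrow> real) \<Rightarrow> pcol \<Rightarrow> real" where
  "sweep_at v = foldr (phase (nb_list v)) (rev [1..<Suc q])"

definition scan_at :: "nat \<Rightarrow> (pcol \<Rightarrow> real) \<Rightarrow> pcol \<Rightarrow> real" where
  "scan_at v = foldr renew (nb_list v)"

definition short_list :: "pcol \<Rightarrow> nat \<Rightarrow> bool" where "short_list \<sigma> v \<longleftrightarrow> card (avail \<sigma> v) < l"

definition crowded :: "pcol \<Rightarrow> nat \<Rightarrow> bool" where "crowded \<sigma> v \<longleftrightarrow> card {u\<in>nb v. \<sigma> u = 0} > r"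

text \<open>Flaw \<open>v < n\<close> is a short list at \<open>v\<close>, flaw \<open>n + v\<close> is too many blank neighbours of \<open>v\<close>;
  short lists are thus always repaired first.\<close>

definition flaws :: "pcol \<Rightarrow> nat set" where
  "flaws \<sigma> = {v. v < n \<and> short_list \<sigma> v} \<union> (\<lambda>v. n + v) ` {v. v < n \<and> crowded \<sigma> v}"

definition repair :: "nat \<Rightarrow> (pcol \<Rightarrow> real) \<Rightarrow> pcol \<Rightarrow> real" where
  "repair f = (if f < n then sweep_at f else scan_at (f - n))"

definition iter :: "(pcol \<Rightarrow> real) \<Rightarrow> pcol \<Rightarrow> real" where
  "iter g \<sigma> = (if flaws \<sigma> = {} then g \<sigma> else repair (Min (flaws \<sigma>)) g \<sigma>)"

text \<open>Undoes the offset \<open>n\<close> of the flaws for crowded vertices.\<close>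

definition site :: "nat \<Rightarrow> nat" where "site f = (if f < n then f else f - n)"

definition ball2 :: "nat \<Rightarrow> nat set" where "ball2 v = insert v (\<Union>u\<in>nb v. nb u)"

definition \<Gamma> :: "nat \<Rightarrow> nat set" where
  "\<Gamma> f = ball2 (site f) \<union> (\<lambda>v. n + v) ` ball2 (site f)"

text \<open>Time reversal of \<open>repair\<close>: the orders of colours and of vertices are
  reversed, while single updates and renewals are self-adjoint.\<close>

definition repair' :: "nat \<Rightarrow> (pcol \<Rightarrow> real) \<Rightarrow> pcol \<Rightarrow> real" where
  "repair' f = (if f < n then foldr (phase (rev (nb_list f))) [1..<Suc q] else foldr renew (rev (nb_list (f - n))))"

lemma adjoint_phase:
  assumes "set us \<subseteq> nb v" "x \<in> {1..q}"
  shows "adjoint \<Omega> wt (phase us x) (phase (rev us) x)"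
  unfolding phase_def rev_append[symmetric]
  by (rule adjoint_foldr, rule adjoint_upd) (use assms nb_subset in auto)

lemma adjoint_repair: "adjoint \<Omega> wt (repair f) (repair' f)"
proof (cases "f < n")
  case True
  have "adjoint \<Omega> wt (foldr (phase (nb_list f)) (rev [1..<Suc q])) (foldr (phase (rev (nb_list f))) (rev (rev [1..<Suc q])))"
    by (intro adjoint_foldr adjoint_phase[of _ f]) (auto simp: nb_list)
  then show ?thesis using True by (simp add: repair_def repair'_def sweep_at_def)
next
  case False
  have "adjoint \<Omega> wt (foldr renew (nb_list (f - n))) (foldr renew (rev (nb_list (f - n))))"
    by (intro adjoint_foldr adjoint_renew) (use nb_subset in \<open>auto simp: nb_list\<close>)
  then show ?thesis using False by (simp add: repair_def repair'_def scan_at_def)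
qed

lemma markov_repair: "markov (near (site f)) (repair f)" "markov (near (site f)) (repair' f)"
proof -
  have "markov (near v) (foldr (phase us) xs)" if "set us = nb v" "set xs = {1..q}" for us xs v
    by (rule markov_sweep_near) (use that in auto)
  moreover have "markov (near v) (foldr renew us)" if "set us = nb v" for us v
    by (intro markov_foldr markov_renew_near) (use that in \<open>auto simp: nb_def\<close>)
  ultimately show "markov (near (site f)) (repair f)" "markov (near (site f)) (repair' f)"
    by (auto simp: repair_def repair'_def sweep_at_def scan_at_def site_def nb_list atLeastLessThanSuc_atLeastAtMost simp del: upt_Suc)
qed

lemma flaws_subset: "flaws \<sigma> \<subseteq> {..<2 * n}" by (auto simp: flaws_def)

text \<open>Both flaws at \<open>u\<close> are read off the colours on \<open>nb u\<close>, and
  \<open>nb u\<close> meets \<open>nb v\<close> only for \<open>u\<close> in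
  \<open>ball2 v\<close>.\<close>

lemma near_flaw_iff:
  assumes "near v \<sigma> \<tau>" "u \<notin> ball2 v"
  shows "short_list \<tau> u = short_list \<sigma> u" "crowded \<tau> u = crowded \<sigma> u"
proof -
  have "\<tau> w = \<sigma> w" if "w \<in> nb u" for w
  proof -
    have "w \<notin> nb v" using that assms(2) adj_sym by (auto simp: ball2_def nb_def)
    then show ?thesis using assms(1) by (auto simp: near_def nb_def)
  qed
  then have "free \<tau> u x = free \<sigma> u x" "{w\<in>nb u. \<tau> w = 0} = {w\<in>nb u. \<sigma> w = 0}" for x
    by (auto simp: free_def nb_def)
  then show "short_list \<tau> u = short_list \<sigma> u" "crowded \<tau> u = crowded \<sigma> u"
    by (simp_all add: short_list_def crowded_def avail_def)
qed

lemma repair_local: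
  assumes "near (site f) \<sigma> \<tau>"
  shows "flaws \<tau> - \<Gamma> f \<subseteq> flaws \<sigma>"
  using near_flaw_iff[OF assms] by (auto simp: flaws_def \<Gamma>_def)

lemma finite_ball2: "finite (ball2 v)" by (simp add: ball2_def)

lemma card_\<Gamma>:
  assumes "\<And>v. card (nb v) \<le> \<Delta>"
  shows "card (\<Gamma> f) \<le> 2 * (\<Delta>\<^sup>2 + 1)"
proof -
  have b: "card (ball2 v) \<le> \<Delta>\<^sup>2 + 1" for v
  proof -
    have "card (\<Union>u\<in>nb v. nb u) \<le> \<Delta> * \<Delta>" by (rule card_UN_le_const) (auto intro: assms)
    then show ?thesis unfolding ball2_def power2_eq_square
      by (simp add: card_insert_if)
  qed
  have "card (\<Gamma> f) \<le> card (ball2 (site f)) + card ((\<lambda>v. n + v) ` ball2 (site f))"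
    unfolding \<Gamma>_def by (rule card_Un_le)
  moreover have "card ((\<lambda>v. n + v) ` ball2 (site f)) = card (ball2 (site f))" by (rule card_image) auto
  ultimately have "card (\<Gamma> f) \<le> card (ball2 (site f)) + card (ball2 (site f))" by simp
  also have "\<dots> \<le> (\<Delta>\<^sup>2 + 1) + (\<Delta>\<^sup>2 + 1)" by (intro add_mono b)
  finally show ?thesis by simp
qed

lemma markov_iter: "markov (\<lambda>\<sigma> \<tau>. \<sigma> \<in> \<Omega> \<longrightarrow> \<tau> \<in> \<Omega>) iter"
proof -
  have mk: "markov (\<lambda>\<sigma> \<tau>. \<sigma> \<in> \<Omega> \<longrightarrow> \<tau> \<in> \<Omega>) (repair f)" for f
    by (rule markov_mono[OF markov_repair(1)]) (auto simp: near_def)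
  show ?thesis
    unfolding markov_def
    by (auto simp: iter_def markov_lin[OF mk] markov_const[OF mk] intro!: markov_le[OF mk])
qed

text \<open>The sweep and scan bounds hold for every order of the vertices and colours, hence for
  the reversed operators. If the lowest flaw is a crowded vertex, then no list is short, since short
  lists have smaller indices; this supplies the list condition of
  \<open>scan_flaw_le\<close>.\<close>

lemma repair_flaw_le:
  fixes d \<theta> :: real
  assumes sparse: "\<And>v F. F \<subseteq> nb v \<Longrightarrow> (\<Sum>u\<in>F. real (card {w\<in>F. adj u w})) \<le> d * card F"
    and deg: "\<And>v. card (nb v) \<le> \<Delta>"
    and \<theta>: "0 \<le> \<theta>" "\<theta> * gain \<theta> Z d \<le> (1 - p) ^ Z / 2"
    and d: "0 \<le> d" "2 * d * \<Delta> / l \<le> r / 2" and l: "0 < l"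
    and eA: "exp (l + \<theta> * \<Delta> - \<theta> * gain \<theta> Z d * q) \<le> e"
    and eZ: "exp (- (r / 2) + 2 * blank_rate * \<Delta>) \<le> e"
    and f: "f < 2 * n" and s: "\<tau> \<in> \<Omega>"
  shows "repair' f (\<lambda>\<sigma>. of_bool (flaws \<sigma> \<noteq> {} \<and> Min (flaws \<sigma>) = f)) \<tau> \<le> e"
proof -
  have fin: "finite (flaws \<sigma>)" for \<sigma> using flaws_subset finite_subset by blast
  note mk = markov_repair(2)[of f]
  show ?thesis
  proof (cases "f < n")
    case True
    have "repair' f (\<lambda>\<sigma>. of_bool (flaws \<sigma> \<noteq> {} \<and> Min (flaws \<sigma>) = f)) \<tau> \<le> repair' f (\<lambda>\<sigma>. of_bool (card (avail \<sigma> f) < l)) \<tau>"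
    proof (rule markov_le[OF mk])
      fix \<sigma>
      have "short_list \<sigma> f" if "flaws \<sigma> \<noteq> {}" "Min (flaws \<sigma>) = f"
        using Min_in[OF fin that(1)] that(2) True by (auto simp: flaws_def)
      then show "of_bool (flaws \<sigma> \<noteq> {} \<and> Min (flaws \<sigma>) = f) \<le> (of_bool (card (avail \<sigma> f) < l) :: real)"
        by (auto simp: short_list_def)
    qed
    also have "\<dots> = foldr (phase (rev (nb_list f))) [1..<Suc q] (\<lambda>\<sigma>. of_bool (card (avail \<sigma> f) < l)) \<tau>"
      using True by (simp add: repair'_def)
    also have "\<dots> \<le> exp (l + \<theta> * \<Delta> - \<theta> * gain \<theta> Z d * q)"
      by (rule sweep_avail_le[OF _ _ _ _ s sparse \<theta> deg]) (auto simp: nb_list)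
    finally show ?thesis using eA by linarith
  next
    case False
    define v where "v = f - n"
    have v: "v < n" "f = n + v" using False f by (auto simp: v_def)
    have "repair' f (\<lambda>\<sigma>. of_bool (flaws \<sigma> \<noteq> {} \<and> Min (flaws \<sigma>) = f)) \<tau> \<le>
       repair' f (\<lambda>\<tau>. of_bool (card {u\<in>nb v. \<tau> u = 0} > r \<and> (\<forall>u\<in>nb v. l \<le> card (avail \<tau> u)))) \<tau>"
    proof (rule markov_le[OF mk])
      fix \<sigma>
      have "card {u\<in>nb v. \<sigma> u = 0} > r \<and> (\<forall>u\<in>nb v. l \<le> card (avail \<sigma> u))"
        if h: "flaws \<sigma> \<noteq> {}" "Min (flaws \<sigma>) = f"
      proof
        have "f \<in> flaws \<sigma>" using Min_in[OF fin h(1)] h(2) by simp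
        then show "card {u\<in>nb v. \<sigma> u = 0} > r" using v by (auto simp: flaws_def crowded_def)
        show "\<forall>u\<in>nb v. l \<le> card (avail \<sigma> u)"
        proof (rule ballI, rule ccontr)
          fix u assume u: "u \<in> nb v" "\<not> l \<le> card (avail \<sigma> u)"
          then have "u \<in> flaws \<sigma>" "u < n" using nb_subset by (auto simp: flaws_def short_list_def)
          then show False using Min_le[OF fin, of u \<sigma>] h(2) v by simp
        qed
      qed
      then show "of_bool (flaws \<sigma> \<noteq> {} \<and> Min (flaws \<sigma>) = f) \<le>
         (of_bool (card {u\<in>nb v. \<sigma> u = 0} > r \<and> (\<forall>u\<in>nb v. l \<le> card (avail \<sigma> u))) :: real)" by auto
    qed
    also have "\<dots> = foldr renew (rev (nb_list v)) (\<lambda>\<tau>. of_bool (card {u\<in>nb v. \<tau> u = 0} > r \<and> (\<forall>u\<in>nb v. l \<le> card (avail \<tau> u)))) \<tau>"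
      using False by (simp add: repair'_def v_def)
    also have "\<dots> \<le> exp (- (r / 2) + 2 * blank_rate * \<Delta>)"
      by (rule scan_flaw_le[OF _ _ l s deg sparse d]) (auto simp: nb_list)
    finally show ?thesis using eZ by linarith
  qed
qed

text \<open>\<open>flaw_walk_decay\<close> bounds a weighted sum. The blank start alone has weight
  \<open>B ^ n\<close>, while the total is at most \<open>(q + 1) ^ n * B ^ n\<close>; so the loss
  is \<open>(q + 1) ^ n\<close>, besides \<open>4 ^ n\<close> for two possible flaws per
  vertex.\<close>

lemma iter_fails_le:
  fixes d \<theta> :: real
  assumes sparse: "\<And>v F. F \<subseteq> nb v \<Longrightarrow> (\<Sum>u\<in>F. real (card {w\<in>F. adj u w})) \<le> d * card F"
    and deg: "\<And>v. card (nb v) \<le> \<Delta>"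
    and \<theta>: "0 \<le> \<theta>" "\<theta> * gain \<theta> Z d \<le> (1 - p) ^ Z / 2"
    and d: "0 \<le> d" "2 * d * \<Delta> / l \<le> r / 2" and l: "0 < l"
    and eA: "exp (l + \<theta> * \<Delta> - \<theta> * gain \<theta> Z d * q) \<le> e"
    and eZ: "exp (- (r / 2) + 2 * blank_rate * \<Delta>) \<le> e"
    and e: "12 * (real \<Delta> ^ 2 + 1) * e \<le> 1"
  shows "1 - (4 * (real q + 1)) ^ n * (1 / 2) ^ m \<le> (iter ^^ m) (\<lambda>\<sigma>. of_bool (flaws \<sigma> = {})) (\<lambda>_. 0)"
proof -
  define D where "D = 2 * (\<Delta>\<^sup>2 + 1)"
  have D: "D \<ge> 1" "real D = 2 * (real \<Delta> ^ 2 + 1)" by (auto simp: D_def)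
  have e0: "0 \<le> e" by (rule order_trans[OF _ eA]) simp
  have mk: "markov (\<lambda>\<sigma> \<tau>. \<sigma> \<in> \<Omega> \<longrightarrow> \<tau> \<in> \<Omega>) (iter ^^ m)" for m
    by (intro markov_funpow markov_iter) (auto intro!: reflpI transpI)
  define al where "al m = (iter ^^ m) (\<lambda>\<sigma>. of_bool (flaws \<sigma> \<noteq> {}))" for m
  have zero: "(\<lambda>_. 0) \<in> \<Omega>" by (auto simp: \<Omega>_def)
  have "(\<Sum>\<sigma> | \<sigma> \<in> \<Omega> \<and> flaws \<sigma> \<subseteq> {..<2*n}. wt \<sigma> * al m \<sigma>)
      \<le> sum wt \<Omega> * (1 + 1 / real D) ^ card {..<2*n} * (3 * real D * e) ^ m"
  proof (rule flaw_walk_decay[where K = repair and K' = repair' and R = "\<lambda>f. near (site f)" and \<Gamma> = \<Gamma>])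
    show "repair' f h \<tau> \<le> repair' f h' \<tau>" if "\<tau> \<in> \<Omega>" "\<And>\<rho>. \<rho> \<in> \<Omega> \<Longrightarrow> h \<rho> \<le> h' \<rho>" for f h h' \<tau>
      by (rule markov_le[OF markov_repair(2)]) (use that in \<open>auto simp: near_def\<close>)
    show "f \<in> \<Gamma> f" if "f < 2 * n" for f using that by (auto simp: \<Gamma>_def site_def ball2_def)
    show "finite (\<Gamma> f)" for f by (simp add: \<Gamma>_def finite_ball2)
    show "card (\<Gamma> f) \<le> D" for f unfolding D_def by (rule card_\<Gamma>[OF deg])
    show "0 \<le> al m \<sigma>" for m \<sigma> unfolding al_def by (rule markov_ge_const[OF mk]) simp
    show "al (Suc m) \<sigma> = 0" if "flaws \<sigma> = {}" for m \<sigma>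
    proof -
      have "al j \<sigma> = 0" for j by (induction j) (use that in \<open>auto simp: al_def iter_def\<close>)
      then show ?thesis .
    qed
  qed (use D e0 wt_nonneg flaws_subset markov_repair(1) adjoint_repair repair_local
        repair_flaw_le[OF sparse deg \<theta> d l eA eZ] in \<open>auto simp: al_def iter_def near_def\<close>)
  also have "{\<sigma>. \<sigma> \<in> \<Omega> \<and> flaws \<sigma> \<subseteq> {..<2*n}} = \<Omega>" using flaws_subset by auto
  also have "sum wt \<Omega> * (1 + 1 / real D) ^ card {..<2*n} * (3 * real D * e) ^ m
     \<le> ((real q + 1) ^ n * B ^ n) * 2 ^ (2 * n) * (1 / 2) ^ m"
  proof (intro mult_mono power_mono sum_wt_le)
    show "(1 + 1 / real D) ^ card {..<2*n} \<le> 2 ^ (2 * n)"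
    proof -
      have "1 + 1 / real D \<le> 2" using D(1) by simp
      then show ?thesis using power_mono[of "1 + 1 / real D" 2 "2 * n"] by simp
    qed
    \<comment> \<open>As \<open>D = 2 * (\<Delta>^2 + 1)\<close>, this is half of the inequality
      assumed for \<open>e\<close>.\<close>
    show "3 * real D * e \<le> 1 / 2" using e D(2) by (simp add: algebra_simps)
  qed (use e0 B_ge in \<open>auto intro!: mult_nonneg_nonneg sum_nonneg wt_nonneg\<close>)
  finally have "(\<Sum>\<sigma>\<in>\<Omega>. wt \<sigma> * al m \<sigma>) \<le> B ^ n * ((4 * (real q + 1)) ^ n * (1 / 2) ^ m)"
  proof -
    assume "(\<Sum>\<sigma>\<in>\<Omega>. wt \<sigma> * al m \<sigma>) \<le> ((real q + 1) ^ n * B ^ n) * 2 ^ (2 * n) * (1 / 2) ^ m"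
    moreover have "(2::real) ^ (2 * n) = 4 ^ n" by (simp add: power_mult)
    ultimately show ?thesis unfolding power_mult_distrib by (simp only: mult_ac)
  qed
  moreover have "wt (\<lambda>_. 0) * al m (\<lambda>_. 0) \<le> (\<Sum>\<sigma>\<in>\<Omega>. wt \<sigma> * al m \<sigma>)"
    by (rule member_le_sum[OF zero]) (auto intro!: mult_nonneg_nonneg wt_nonneg markov_ge_const[OF mk] simp: al_def)
  ultimately have "B ^ n * al m (\<lambda>_. 0) \<le> B ^ n * ((4 * (real q + 1)) ^ n * (1 / 2) ^ m)"
    by (simp add: wt_zero)
  then have "al m (\<lambda>_. 0) \<le> (4 * (real q + 1)) ^ n * (1 / 2) ^ m"
    using B_ge by (simp add: mult_le_cancel_left_pos)
  moreover have "(iter ^^ m) (\<lambda>\<sigma>. of_bool (flaws \<sigma> = {})) (\<lambda>_. 0) = 1 - al m (\<lambda>_. 0)"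
  proof -
    have "(iter ^^ m) (\<lambda>\<sigma>. 1 + (-1) * of_bool (flaws \<sigma> \<noteq> {})) (\<lambda>_. 0) = 1 + (-1) * al m (\<lambda>_. 0)"
      unfolding al_def by (rule markov_affine[OF mk])
    moreover have "(\<lambda>\<sigma>. 1 + (-1) * of_bool (flaws \<sigma> \<noteq> {})) = (\<lambda>\<sigma>. of_bool (flaws \<sigma> = {}) :: real)" by auto
    ultimately show ?thesis by simp
  qed
  ultimately show ?thesis by simp
qed

end

section \<open>Reasoning about programs\<close>

definition success :: "state set \<Rightarrow> nat \<Rightarrow> config \<Rightarrow> real" where
  "success X t c = measure_pmf.prob (run t c) {c. halted c \<and> snd c \<in> X}"

lemma prob_bind_pmf_of_set:
  assumes "finite A" "A \<noteq> {}"
  shows "measure_pmf.prob (bind_pmf (pmf_of_set A) f) S = (\<Sum>x\<in>A. measure_pmf.prob (f x) S) / card A"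
proof -
  have c: "real (card A) > 0" using assms by (simp add: card_gt_0_iff)
  have "ennreal (measure_pmf.prob (bind_pmf (pmf_of_set A) f) S) = (\<Sum>x\<in>A. emeasure (f x) S) / card A"
    by (simp add: measure_pmf.emeasure_eq_measure[symmetric] nn_integral_pmf_of_set assms)
  also have "\<dots> = ennreal ((\<Sum>x\<in>A. measure_pmf.prob (f x) S) / card A)"
    using c by (simp add: measure_pmf.emeasure_eq_measure sum_nonneg divide_ennreal ennreal_of_nat_eq_real_of_nat)
  finally show ?thesis by (subst (asm) ennreal_inj) (auto intro!: divide_nonneg_nonneg sum_nonneg)
qed

lemma success_halted: "success X t ([], s) = of_bool (s \<in> X)"
proof -
  have "run t ([], s) = return_pmf ([], s)" by (induction t) (simp_all add: bind_return_pmf)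
  then show ?thesis by (simp add: success_def halted_def indicator_def)
qed

lemma success_step:
  "success X (Suc t) (Skip # K, s) = success X t (K, s)"
  "success X (Suc t) (Const r x # K, s) = success X t (K, set_reg r x s)"
  "success X (Suc t) (Add r a b # K, s) = success X t (K, set_reg r (regs s a + regs s b) s)"
  "success X (Suc t) (Sub r a b # K, s) = success X t (K, set_reg r (regs s a - regs s b) s)"
  "success X (Suc t) (Half r a # K, s) = success X t (K, set_reg r (regs s a div 2) s)"
  "success X (Suc t) (Load r a # K, s) = success X t (K, set_reg r (mem s (regs s a)) s)"
  "success X (Suc t) (Store a r # K, s) = success X t (K, s\<lparr>mem := (mem s)(regs s a := regs s r)\<rparr>)"
  "success X (Suc t) (Seq p q # K, s) = success X t (p # q # K, s)"
  "success X (Suc t) (Cond r p q # K, s) = success X t ((if regs s r \<noteq> 0 then p else q) # K, s)"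
  "success X (Suc t) (While r p # K, s) = success X t (if regs s r \<noteq> 0 then p # While r p # K else K, s)"
  by (simp_all add: success_def bind_return_pmf)

lemma success_flip: "success X (Suc t) (Flip r # K, s) = (success X t (K, set_reg r 0 s) + success X t (K, set_reg r 1 s)) / 2"
  by (simp add: success_def bind_map_pmf prob_bind_pmf_of_set)

text \<open>A deterministic step is an average over two equal successors, and a halted configuration
  is its own successor. In this uniform shape, monotonicity in time follows by induction without
  inspecting commands.\<close>

lemma success_average: "\<exists>c1 c2. \<forall>t. success X (Suc t) c = (success X t c1 + success X t c2) / 2"
proof (cases c)
  case (Pair L s)
  show ?thesis
  proof (cases L)
    case Nil
    then show ?thesis using Pair success_halted[of X _ s] by (intro exI[of _ c]) simp
  next
    case (Cons p K)
    have det: ?thesis if "\<And>t. success X (Suc t) c = success X t c'" for c'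
      by (rule exI[of _ c'], rule exI[of _ c']) (simp add: that)
    show ?thesis
      using Pair Cons by (cases p) (rule det, simp add: success_step; fail | use success_flip in blast)+
  qed
qed

lemma success_nonneg: "0 \<le> success X t c" by (simp add: success_def)

lemma success_mono_Suc: "success X t c \<le> success X (Suc t) c"
proof (induction t arbitrary: c)
  case 0
  show ?case
  proof (cases "halted c")
    case True
    then obtain s where "c = ([], s)" by (cases c) (auto simp: halted_def)
    then show ?thesis by (simp add: success_halted)
  next
    case False
    then have "success X 0 c = 0" by (simp add: success_def)
    then show ?thesis using success_nonneg by simp
  qed
next
  case (Suc t)
  obtain c1 c2 where c: "\<And>t. success X (Suc t) c = (success X t c1 + success X t c2) / 2" using success_average by blast
  show ?case unfolding c[of t] c[of "Suc t"] using Suc.IH[of c1] Suc.IH[of c2] by simp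
qed

lemma success_mono: "t \<le> t' \<Longrightarrow> success X t c \<le> success X t' c"
  by (rule lift_Suc_mono_le[of "\<lambda>t. success X t c"]) (rule success_mono_Suc)

text \<open>An expectation transformer \<open>T\<close> relates lower bounds on the success probability after and
  before running a command. As a halted machine stays halted, success is monotone in the time, so
  \<open>b\<close> only has to bound the running time from above.\<close>

definition sim :: "('g \<Rightarrow> state \<Rightarrow> bool) \<Rightarrow> com \<Rightarrow> nat \<Rightarrow> (('h \<Rightarrow> real) \<Rightarrow> 'g \<Rightarrow> real) \<Rightarrow> ('h \<Rightarrow> state \<Rightarrow> bool) \<Rightarrow> bool" where
  "sim P p b T Q \<longleftrightarrow> (\<forall>X K t f \<sigma> s. P \<sigma> s \<longrightarrow> (\<forall>\<sigma>' s'. Q \<sigma>' s' \<longrightarrow> f \<sigma>' \<le> success X t (K, s')) \<longrightarrow>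
     T f \<sigma> \<le> success X (t + b) (p # K, s))"

text \<open>Deterministic counterpart of \<open>sim\<close>: a number \<open>a\<close> replaces the
  function. Quantifying over the continuation \<open>K\<close> reduces sequencing to the command
  stack of the machine.\<close>

definition hoare :: "(state \<Rightarrow> bool) \<Rightarrow> com \<Rightarrow> nat \<Rightarrow> (state \<Rightarrow> bool) \<Rightarrow> bool" where
  "hoare P p b Q \<longleftrightarrow> (\<forall>X K t a s. P s \<longrightarrow> (\<forall>s'. Q s' \<longrightarrow> a \<le> success X t (K, s')) \<longrightarrow> a \<le> success X (t + b) (p # K, s))"

lemma simI:
  assumes "\<And>X K t f \<sigma> s. P \<sigma> s \<Longrightarrow> (\<And>\<sigma>' s'. Q \<sigma>' s' \<Longrightarrow> f \<sigma>' \<le> success X t (K, s')) \<Longrightarrow> T f \<sigma> \<le> success X (t + b) (p # K, s)"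
  shows "sim P p b T Q"
  using assms unfolding sim_def by blast

lemma simD:
  "sim P p b T Q \<Longrightarrow> P \<sigma> s \<Longrightarrow> (\<And>\<sigma>' s'. Q \<sigma>' s' \<Longrightarrow> f \<sigma>' \<le> success X t (K, s')) \<Longrightarrow> T f \<sigma> \<le> success X (t + b) (p # K, s)"
  unfolding sim_def by blast

lemma hoareI:
  assumes "\<And>X K t a s. P s \<Longrightarrow> (\<And>s'. Q s' \<Longrightarrow> a \<le> success X t (K, s')) \<Longrightarrow> a \<le> success X (t + b) (p # K, s)"
  shows "hoare P p b Q"
  using assms unfolding hoare_def by blast

lemma hoareD:
  "hoare P p b Q \<Longrightarrow> P s \<Longrightarrow> (\<And>s'. Q s' \<Longrightarrow> a \<le> success X t (K, s')) \<Longrightarrow> a \<le> success X (t + b) (p # K, s)"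
  unfolding hoare_def by blast

lemma hoare_pre:
  assumes "hoare P p b Q" "\<And>s. P' s \<Longrightarrow> P s" "b \<le> b'"
  shows "hoare P' p b' Q"
proof (rule hoareI)
  fix X K t a s assume P: "P' s" and Q: "\<And>s'. Q s' \<Longrightarrow> a \<le> success X t (K, s')"
  have "a \<le> success X (t + b) (p # K, s)" by (rule hoareD[OF assms(1) assms(2)[OF P] Q])
  also have "\<dots> \<le> success X (t + b') (p # K, s)" by (rule success_mono) (use assms(3) in simp)
  finally show "a \<le> success X (t + b') (p # K, s)" .
qed

lemma hoare_post: "hoare P p b Q \<Longrightarrow> (\<And>s. Q s \<Longrightarrow> Q' s) \<Longrightarrow> hoare P p b Q'"
  unfolding hoare_def by blast

lemma hoare_basic:
  "hoare Q Skip 1 Q"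
  "hoare (\<lambda>s. Q (set_reg r x s)) (Const r x) 1 Q"
  "hoare (\<lambda>s. Q (set_reg r (regs s a + regs s c) s)) (Add r a c) 1 Q"
  "hoare (\<lambda>s. Q (set_reg r (regs s a - regs s c) s)) (Sub r a c) 1 Q"
  "hoare (\<lambda>s. Q (set_reg r (regs s a div 2) s)) (Half r a) 1 Q"
  "hoare (\<lambda>s. Q (set_reg r (mem s (regs s a)) s)) (Load r a) 1 Q"
  "hoare (\<lambda>s. Q (s\<lparr>mem := (mem s)(regs s a := regs s r)\<rparr>)) (Store a r) 1 Q"
  unfolding hoare_def by (simp_all add: success_step)

lemma hoare_seq:
  assumes "hoare M q b2 Q" "hoare P p b1 M"
  shows "hoare P (Seq p q) (b1 + b2 + 1) Q"
proof (rule hoareI)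
  fix X K t a s assume "P s" "\<And>s'. Q s' \<Longrightarrow> a \<le> success X t (K, s')"
  then have "a \<le> success X (t + b2 + b1) (p # q # K, s)"
    by (intro hoareD[OF assms(2)] hoareD[OF assms(1)]) auto
  then show "a \<le> success X (t + (b1 + b2 + 1)) (Seq p q # K, s)" by (simp add: success_step ac_simps)
qed

lemma hoare_cond:
  assumes "hoare P1 p b1 Q" "hoare P2 q b2 Q"
  shows "hoare (\<lambda>s. if regs s r \<noteq> 0 then P1 s else P2 s) (Cond r p q) (max b1 b2 + 1) Q"
proof (rule hoareI)
  fix X K t a s
  assume P: "if regs s r \<noteq> 0 then P1 s else P2 s" and Q: "\<And>s'. Q s' \<Longrightarrow> a \<le> success X t (K, s')"
  have 1: "hoare P1 p (max b1 b2) Q" "hoare P2 q (max b1 b2) Q"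
    by (rule hoare_pre[OF assms(1)]; simp) (rule hoare_pre[OF assms(2)]; simp)
  show "a \<le> success X (t + (max b1 b2 + 1)) (Cond r p q # K, s)"
    using P hoareD[OF 1(1) _ Q] hoareD[OF 1(2) _ Q] by (simp add: success_step split: if_splits)
qed

lemma hoare_while:
  assumes "\<And>j. j < m \<Longrightarrow> hoare (I (Suc j)) p b (I j)"
    and "\<And>j s. j < m \<Longrightarrow> I (Suc j) s \<Longrightarrow> regs s r \<noteq> 0" and "\<And>s. I 0 s \<Longrightarrow> regs s r = 0"
  shows "hoare (I m) (While r p) (m * (b + 1) + 1) (I 0)"
  using assms(1,2)
proof (induction m)
  case 0
  show ?case by (rule hoareI) (use assms(3) in \<open>simp add: success_step\<close>)
next
  case (Suc m)
  have IH: "hoare (I m) (While r p) (m * (b + 1) + 1) (I 0)"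
    by (rule Suc.IH) (use Suc.prems less_SucI in blast)+
  show ?case
  proof (rule hoareI)
    fix X K t a s assume P: "I (Suc m) s" and Q: "\<And>s'. I 0 s' \<Longrightarrow> a \<le> success X t (K, s')"
    have "a \<le> success X (t + (m * (b + 1) + 1) + b) (p # While r p # K, s)"
      by (rule hoareD[OF Suc.prems(1)[of m] P]) (use hoareD[OF IH _ Q] in auto)
    then show "a \<le> success X (t + (Suc m * (b + 1) + 1)) (While r p # K, s)"
      using Suc.prems(2)[of m s] P by (simp add: success_step ac_simps)
  qed
qed

text \<open>Turns a specification relative to the initial state into weakest-precondition form,
  which can be chained backwards with an unknown \<open>Q\<close>.\<close>

lemma hoare_spec:
  assumes "\<And>s0. pre s0 \<Longrightarrow> hoare (\<lambda>s. s = s0) p b (post s0)"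
  shows "hoare (\<lambda>s. pre s \<and> (\<forall>s'. post s s' \<longrightarrow> Q s')) p b Q"
  by (rule hoareI) (use hoareD[OF assms] in blast)

lemma hoare_specD:
  assumes "\<And>Q. hoare (\<lambda>s. pre s \<and> (\<forall>s'. post s s' \<longrightarrow> Q s')) p b Q"
    and "\<And>s. P s \<Longrightarrow> pre s" "\<And>s s'. P s \<Longrightarrow> post s s' \<Longrightarrow> Q s'"
  shows "hoare P p b Q"
  by (rule hoare_pre[OF assms(1)]) (use assms(2,3) in auto)

lemma sim_hoare:
  assumes "\<And>\<sigma>. hoare (P \<sigma>) p b (Q (g \<sigma>))"
  shows "sim P p b (\<lambda>f \<sigma>. f (g \<sigma>)) Q"
  by (rule simI) (use hoareD[OF assms] in blast)

lemma sim_id: "(\<And>\<sigma>. hoare (P \<sigma>) p b (Q \<sigma>)) \<Longrightarrow> sim P p b (\<lambda>f. f) Q"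
  using sim_hoare[of P p b Q "\<lambda>x. x"] by simp

lemma sim_weaken:
  assumes "sim P p b T Q" "\<And>\<sigma> s. P' \<sigma> s \<Longrightarrow> P \<sigma> s" "b \<le> b'" "\<And>\<sigma> s. Q \<sigma> s \<Longrightarrow> Q' \<sigma> s" "\<And>f \<sigma> s. P' \<sigma> s \<Longrightarrow> T' f \<sigma> = T f \<sigma>"
  shows "sim P' p b' T' Q'"
proof (rule simI)
  fix X K t f \<sigma> s assume "P' \<sigma> s" "\<And>\<sigma>' s'. Q' \<sigma>' s' \<Longrightarrow> f \<sigma>' \<le> success X t (K, s')"
  then have "T f \<sigma> \<le> success X (t + b) (p # K, s)" by (intro simD[OF assms(1)]) (auto intro: assms(2,4))
  also have "\<dots> \<le> success X (t + b') (p # K, s)" by (rule success_mono) (use assms(3) in simp)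
  finally show "T' f \<sigma> \<le> success X (t + b') (p # K, s)" using assms(5) \<open>P' \<sigma> s\<close> by simp
qed

lemma sim_seq:
  assumes "sim P p b1 T1 M" "sim M q b2 T2 Q"
  shows "sim P (Seq p q) (b1 + b2 + 1) (\<lambda>f. T1 (T2 f)) Q"
proof (rule simI)
  fix X K t f \<sigma> s assume "P \<sigma> s" "\<And>\<sigma>' s'. Q \<sigma>' s' \<Longrightarrow> f \<sigma>' \<le> success X t (K, s')"
  then have "T1 (T2 f) \<sigma> \<le> success X (t + b2 + b1) (p # q # K, s)"
    by (intro simD[OF assms(1)] simD[OF assms(2)]) auto
  then show "T1 (T2 f) \<sigma> \<le> success X (t + (b1 + b2 + 1)) (Seq p q # K, s)" by (simp add: success_step ac_simps)
qed

lemma sim_cond: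
  assumes "sim (\<lambda>\<sigma> s. P \<sigma> s \<and> regs s r \<noteq> 0) p b1 T1 Q" "sim (\<lambda>\<sigma> s. P \<sigma> s \<and> regs s r = 0) q b2 T2 Q"
    and c: "\<And>\<sigma> s. P \<sigma> s \<Longrightarrow> regs s r \<noteq> 0 \<longleftrightarrow> c \<sigma>"
  shows "sim P (Cond r p q) (max b1 b2 + 1) (\<lambda>f \<sigma>. if c \<sigma> then T1 f \<sigma> else T2 f \<sigma>) Q"
proof (rule simI)
  fix X K t f \<sigma> s
  assume P: "P \<sigma> s" and Q: "\<And>\<sigma>' s'. Q \<sigma>' s' \<Longrightarrow> f \<sigma>' \<le> success X t (K, s')"
  have 1: "sim (\<lambda>\<sigma> s. P \<sigma> s \<and> regs s r \<noteq> 0) p (max b1 b2) T1 Q" "sim (\<lambda>\<sigma> s. P \<sigma> s \<and> regs s r = 0) q (max b1 b2) T2 Q"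
    by (rule sim_weaken[OF assms(1)]; simp) (rule sim_weaken[OF assms(2)]; simp)
  show "(if c \<sigma> then T1 f \<sigma> else T2 f \<sigma>) \<le> success X (t + (max b1 b2 + 1)) (Cond r p q # K, s)"
    using P c[OF P] simD[OF 1(1) _ Q, of \<sigma> s] simD[OF 1(2) _ Q, of \<sigma> s] by (auto simp add: success_step)
qed

text \<open>A loop with counter \<open>m\<close> runs \<open>T (m - 1)\<close> first and
  \<open>T 0\<close> last.\<close>

fun downto :: "(nat \<Rightarrow> ('g \<Rightarrow> real) \<Rightarrow> 'g \<Rightarrow> real) \<Rightarrow> nat \<Rightarrow> ('g \<Rightarrow> real) \<Rightarrow> 'g \<Rightarrow> real" where
  "downto T 0 = (\<lambda>f. f)"
| "downto T (Suc m) = (\<lambda>f. T m (downto T m f))"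

lemma sim_while:
  assumes "\<And>j. j < m \<Longrightarrow> sim (I (Suc j)) p b (T j) (I j)"
    and "\<And>j \<sigma> s. j < m \<Longrightarrow> I (Suc j) \<sigma> s \<Longrightarrow> regs s r \<noteq> 0" and "\<And>\<sigma> s. I 0 \<sigma> s \<Longrightarrow> regs s r = 0"
  shows "sim (I m) (While r p) (m * (b + 1) + 1) (downto T m) (I 0)"
  using assms(1,2)
proof (induction m)
  case 0
  show ?case by (rule simI) (use assms(3) in \<open>simp add: success_step\<close>)
next
  case (Suc m)
  have IH: "sim (I m) (While r p) (m * (b + 1) + 1) (downto T m) (I 0)"
    by (rule Suc.IH) (use Suc.prems less_SucI in blast)+
  show ?case
  proof (rule simI)
    fix X K t f \<sigma> s assume P: "I (Suc m) \<sigma> s" and Q: "\<And>\<sigma>' s'. I 0 \<sigma>' s' \<Longrightarrow> f \<sigma>' \<le> success X t (K, s')"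
    have "T m (downto T m f) \<sigma> \<le> success X (t + (m * (b + 1) + 1) + b) (p # While r p # K, s)"
      by (rule simD[OF Suc.prems(1)[of m] P]) (use simD[OF IH _ Q] in auto)
    then show "downto T (Suc m) f \<sigma> \<le> success X (t + (Suc m * (b + 1) + 1)) (While r p # K, s)"
      using Suc.prems(2)[of m \<sigma> s] P by (simp add: success_step ac_simps)
  qed
qed

lemma downto_foldr:
  "downto (\<lambda>j. if Q j then T j else (\<lambda>f. f)) m = foldr T (rev (filter Q [0..<m]))"
  by (induction m) (simp_all add: comp_def id_def)

lemma downto_foldr_Suc: "downto (\<lambda>j. T (Suc j)) m = foldr T (rev [1..<Suc m])"
proof (induction m)
  case (Suc m)
  have "rev [1..<Suc (Suc m)] = Suc m # rev [1..<Suc m]" by simp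
  then show ?case using Suc by (simp only: downto.simps foldr.simps comp_def)
qed (simp add: id_def)

lemma downto_funpow: "downto (\<lambda>_. T) m = T ^^ m"
  by (induction m) (simp_all add: comp_def id_def)

lemma set_reg_simps[simp]: "regs (set_reg r x s) = (regs s)(r := x)" "mem (set_reg r x s) = mem s"
  by (auto simp: set_reg_def)

definition agree :: "nat set \<Rightarrow> state \<Rightarrow> state \<Rightarrow> bool" where
  "agree S s s' \<longleftrightarrow> mem s' = mem s \<and> (\<forall>r. r \<notin> S \<longrightarrow> regs s' r = regs s r)"

section \<open>The program\<close>

lemma hoare_while':
  assumes "\<And>j. j < m \<Longrightarrow> hoare (I (Suc j)) p b (I j)"
    and "\<And>j s. j < m \<Longrightarrow> I (Suc j) s \<Longrightarrow> regs s r \<noteq> 0" and "\<And>s. I 0 s \<Longrightarrow> regs s r = 0"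
  shows "hoare (\<lambda>s. I m s \<and> (\<forall>s'. I 0 s' \<longrightarrow> Q s')) (While r p) (m * (b + 1) + 1) Q"
proof -
  have "hoare (I m) (While r p) (m * (b + 1) + 1) (I 0)" by (rule hoare_while) (use assms in auto)
  then show ?thesis unfolding hoare_def by blast
qed

abbreviation seq :: "com \<Rightarrow> com \<Rightarrow> com" (infixr ";;" 60) where "p ;; q \<equiv> Seq p q"

text \<open>Registers \<open>0\<close>, \<open>2\<close>, \<open>31\<close> hold \<open>n\<close>, \<open>0\<close>, \<open>1\<close>, and \<open>3\<close> to \<open>7\<close> hold
  \<open>n * n\<close>, \<open>q\<close>, \<open>r\<close>, \<open>l\<close>, \<open>Y\<close>. In the loops, \<open>11\<close> is the vertex under
  consideration, \<open>12\<close> a colour and \<open>13\<close> a neighbour; \<open>20\<close> to \<open>30\<close> are scratch registers.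
  The colour of vertex \<open>v\<close> is kept in cell \<open>n * n + v\<close>, behind the adjacency matrix.\<close>

definition adj_com :: "nat \<Rightarrow> nat \<Rightarrow> com" where
  "adj_com a c = Add 20 c 2 ;; Add 21 a 2 ;; While 21 (Sub 21 21 31 ;; Add 20 20 0) ;; Load 20 20"

text \<open>Two colours are compared by adding both truncated differences; the sum is
  \<open>0\<close> exactly if they are equal.\<close>

definition free_com :: "nat \<Rightarrow> nat \<Rightarrow> com" where
  "free_com u x = Const 22 1 ;; Add 23 0 2 ;; While 23 (Sub 23 23 31 ;; adj_com u 23 ;;
     Cond 20 (Add 24 3 23 ;; Load 24 24 ;; Sub 25 24 x ;; Sub 26 x 24 ;; Add 25 25 26 ;;
       Cond 25 Skip (Const 22 0)) Skip)"

text \<open>Started with \<open>1\<close>, register \<open>29\<close> keeps it exactly if all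
  \<open>k\<close> flips give \<open>0\<close>, an event of probability
  \<open>1 / 2 ^ k\<close>.\<close>

primrec flips :: "nat \<Rightarrow> com" where
  "flips 0 = Skip"
| "flips (Suc k) = Flip 30 ;; Cond 30 (Const 29 0) Skip ;; flips k"

definition guard_com :: com where
  "guard_com = (Add 27 3 13 ;; Load 28 27 ;;
     Cond 28 (Sub 25 28 12 ;; Sub 26 12 28 ;; Add 25 25 26 ;; Cond 25 (Const 28 0) (Const 28 1)) (Const 28 1)) ;;
     free_com 13 12 ;; Cond 28 (Add 28 22 2) Skip"

definition upd_com :: "nat \<Rightarrow> com" where
  "upd_com b = guard_com ;; Cond 28 ((Const 29 1 ;; flips b) ;; Cond 29 (Store 27 12) (Store 27 2)) Skip"

lemma agree_mem: "agree S s s' \<Longrightarrow> mem s' = mem s" by (simp add: agree_def)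

lemma agree_reg: "agree S s s' \<Longrightarrow> r \<notin> S \<Longrightarrow> regs s' r = regs s r" by (simp add: agree_def)

lemma agree_refl[simp]: "agree S s s" by (simp add: agree_def)

lemma agree_trans: "agree S s s' \<Longrightarrow> agree S' s' s'' \<Longrightarrow> S \<subseteq> T \<Longrightarrow> S' \<subseteq> T \<Longrightarrow> agree T s s''"
  unfolding agree_def by (metis subsetD)

lemma agree_set_reg[simp]: "r \<in> S \<Longrightarrow> agree S s (set_reg r x s') \<longleftrightarrow> agree S s s'"
  by (auto simp: agree_def)

definition adj_cost :: "nat \<Rightarrow> nat" where "adj_cost n = 4 * n + 20"

definition free_cost :: "nat \<Rightarrow> nat" where "free_cost n = n * (adj_cost n + 40) + 20"

definition upd_cost :: "nat \<Rightarrow> nat \<Rightarrow> nat" where "upd_cost n b = free_cost n + 5 * b + 60"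

text \<open>The cell index is computed by repeated addition of \<open>n\<close>, since the machine
  cannot multiply; this makes the cost linear in \<open>n\<close>.\<close>

lemma hoare_adj_com:
  assumes "a \<notin> {20, 21}" "c \<notin> {20, 21}"
  shows "hoare (\<lambda>s. (regs s 31 = 1 \<and> regs s 2 = 0 \<and> regs s a \<le> N) \<and>
     (\<forall>s'. agree {20, 21} s s' \<and> regs s' 20 = mem s (regs s a * regs s 0 + regs s c) \<longrightarrow> Q s')) (adj_com a c) (adj_cost N) Q"
proof (rule hoare_spec)
  fix s0 :: state assume pre: "regs s0 31 = 1 \<and> regs s0 2 = 0 \<and> regs s0 a \<le> N"
  define A where "A = regs s0 a"
  define I where "I j s \<longleftrightarrow> agree {20, 21} s0 s \<and> j \<le> A \<and> regs s 21 = j \<and> regs s 20 = regs s0 c + (A - j) * regs s0 0" for j s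
  have W: "hoare (\<lambda>s. I A s \<and> (\<forall>s'. I 0 s' \<longrightarrow> Q s')) (While 21 (Sub 21 21 31 ;; Add 20 20 0)) (A * (3 + 1) + 1) Q" for Q
  proof (rule hoare_while')
    fix j assume "j < A"
    show "hoare (I (Suc j)) (Sub 21 21 31 ;; Add 20 20 0) 3 (I j)"
      by (rule hoare_pre, (rule hoare_seq hoare_basic)+)
         (use \<open>j < A\<close> pre in \<open>auto simp: I_def agree_reg Suc_diff_Suc simp flip: Suc_diff_Suc\<close>)
  qed (auto simp: I_def)
  show "hoare (\<lambda>s. s = s0) (adj_com a c) (adj_cost N)
     (\<lambda>s'. agree {20, 21} s0 s' \<and> regs s' 20 = mem s0 (regs s0 a * regs s0 0 + regs s0 c))"
    unfolding adj_com_def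
    by (rule hoare_pre, (rule hoare_seq hoare_basic W)+)
       (use pre assms in \<open>auto simp: I_def A_def adj_cost_def agree_mem add.commute\<close>)
qed

locale machine = scheme +
  fixes \<beta> :: nat
  assumes n_pos: "n \<ge> 1" and Y_eq: "Y = 2 ^ \<beta>" and R_eq: "R = n * n"
begin

definition consts_ok :: "state \<Rightarrow> bool" where
  "consts_ok s \<longleftrightarrow> regs s 0 = n \<and> regs s 31 = 1 \<and> regs s 2 = 0 \<and> regs s 3 = n * n \<and>
     regs s 4 = q \<and> regs s 5 = r \<and> regs s 6 = l \<and> regs s 7 = Y"

definition adj_ok :: "state \<Rightarrow> bool" where
  "adj_ok s \<longleftrightarrow> (\<forall>u<n. \<forall>v<n. mem s (u * n + v) = of_bool (adj u v))"

text \<open>Links the analysis to the machine: the partial colouring on which the operators act is a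
  ghost variable that mirrors the colour cells.\<close>

definition env :: "pcol \<Rightarrow> state \<Rightarrow> bool" where
  "env \<sigma> s \<longleftrightarrow> consts_ok s \<and> adj_ok s \<and> (\<forall>v<n. mem s (n * n + v) = \<sigma> v)"

lemma cell_less: "u < n \<Longrightarrow> v < n \<Longrightarrow> u * n + v < n * n"
proof -
  assume "u < n" "v < n"
  then have "u * n + v < Suc u * n" by simp
  also have "\<dots> \<le> n * n" using \<open>u < n\<close> by (intro mult_le_mono1) simp
  finally show ?thesis .
qed

lemma envD: "env \<sigma> s \<Longrightarrow> regs s 0 = n \<and> regs s 31 = 1 \<and> regs s 2 = 0 \<and> regs s 3 = n * n \<and>
     regs s 4 = q \<and> regs s 5 = r \<and> regs s 6 = l \<and> regs s 7 = Y"
  "env \<sigma> s \<Longrightarrow> u < n \<Longrightarrow> v < n \<Longrightarrow> mem s (u * n + v) = of_bool (adj u v)"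
  "env \<sigma> s \<Longrightarrow> v < n \<Longrightarrow> mem s (n * n + v) = \<sigma> v"
  by (auto simp: env_def consts_ok_def adj_ok_def)

lemma env_agree: "env \<sigma> s \<Longrightarrow> agree S s s' \<Longrightarrow> \<forall>r\<in>{0, 2, 3, 4, 5, 6, 7, 31}. r \<notin> S \<Longrightarrow> env \<sigma> s'"
  unfolding env_def consts_ok_def adj_ok_def agree_def by simp

lemma env_store:
  assumes "env \<sigma> s" "u < n" shows "env (\<sigma>(u := x)) (s\<lparr>mem := (mem s)(n * n + u := x)\<rparr>)"
proof -
  have "w * n + v \<noteq> n * n + u" if "w < n" "v < n" for w v using cell_less[OF that] by linarith
  then show ?thesis using assms unfolding env_def consts_ok_def adj_ok_def by simp
qed

lemma hoare_free_com:
  assumes "u \<notin> {20,21,22,23,24,25,26}" "x \<notin> {20,21,22,23,24,25,26}"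
  shows "hoare (\<lambda>s. (\<exists>\<sigma>. env \<sigma> s \<and> regs s u < n) \<and>
     (\<forall>s'. agree {20,21,22,23,24,25,26} s s' \<and> (\<forall>\<sigma>. env \<sigma> s \<longrightarrow> regs s' 22 = of_bool (free \<sigma> (regs s u) (regs s x))) \<longrightarrow> Q s'))
     (free_com u x) (free_cost n) Q"
proof (rule hoare_spec)
  fix s0 :: state assume "\<exists>\<sigma>. env \<sigma> s0 \<and> regs s0 u < n"
  then obtain \<sigma> where e: "env \<sigma> s0" and u: "regs s0 u < n" by blast
  define U where "U = regs s0 u"
  define X where "X = regs s0 x"
  define I where "I j s \<longleftrightarrow> agree {20,21,22,23,24,25,26} s0 s \<and> j \<le> n \<and> regs s 23 = j \<and>
    regs s 22 = of_bool (\<forall>w. w < n \<longrightarrow> j \<le> w \<longrightarrow> adj U w \<longrightarrow> \<sigma> w \<noteq> X)" for j s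
  have ux: "u \<noteq> 20" "u \<noteq> 21" "u \<noteq> 22" "u \<noteq> 23" "u \<noteq> 24" "u \<noteq> 25" "u \<noteq> 26"
    "x \<noteq> 20" "x \<noteq> 21" "x \<noteq> 22" "x \<noteq> 23" "x \<noteq> 24" "x \<noteq> 25" "x \<noteq> 26" using assms by auto
  let ?body = "Sub 23 23 31 ;; adj_com u 23 ;;
     Cond 20 (Add 24 3 23 ;; Load 24 24 ;; Sub 25 24 x ;; Sub 26 x 24 ;; Add 25 25 26 ;;
       Cond 25 Skip (Const 22 0)) Skip"
  have W: "hoare (\<lambda>s. I n s \<and> (\<forall>s'. I 0 s' \<longrightarrow> Q s')) (While 23 ?body) (n * (adj_cost n + 30 + 1) + 1) Q" for Q
  proof (rule hoare_while')
    fix j assume j: "j < n"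
    have split: "(\<forall>w. w < n \<longrightarrow> j \<le> w \<longrightarrow> adj U w \<longrightarrow> \<sigma> w \<noteq> X) \<longleftrightarrow>
       (adj U j \<longrightarrow> \<sigma> j \<noteq> X) \<and> (\<forall>w. w < n \<longrightarrow> Suc j \<le> w \<longrightarrow> adj U w \<longrightarrow> \<sigma> w \<noteq> X)"
      using j by (auto simp: Suc_le_eq order.order_iff_strict)
    have A: "u \<notin> {20, 21}" "(23::nat) \<notin> {20, 21}" using ux by auto
    show "hoare (I (Suc j)) ?body (adj_cost n + 30) (I j)"
    proof (rule hoare_pre, (rule hoare_seq hoare_basic hoare_cond hoare_adj_com[OF A, where N = n])+, goal_cases)
      case (1 s)
      have c0: "regs s0 0 = n" "regs s0 31 = 1" "regs s0 2 = 0" "regs s0 3 = n * n" "regs s0 u = U" "regs s0 x = X"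
        using envD(1)[OF e] by (auto simp: U_def X_def)
      have mm: "mem s0 (U * n + j) = of_bool (adj U j)" "mem s0 (n * n + j) = \<sigma> j"
        using envD(2,3)[OF e] u j by (auto simp: U_def)
      have U: "U \<le> n" using u by (simp add: U_def)
      have c1: "regs s 0 = n" "regs s 31 = 1" "regs s 2 = 0" "regs s 3 = n * n" "regs s u = U" "regs s x = X"
        "regs s 23 = Suc j" "mem s = mem s0" "regs s 22 = of_bool (\<forall>w. w < n \<longrightarrow> Suc j \<le> w \<longrightarrow> adj U w \<longrightarrow> \<sigma> w \<noteq> X)"
        "\<And>r. r \<notin> {20,21,22,23,24,25,26} \<Longrightarrow> regs s r = regs s0 r"
        using 1 c0 ux assms unfolding I_def agree_def by auto
      show ?case
      proof (rule conjI, simp add: c1 ux U, intro allI impI, goal_cases)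
        case (1 s')
        then have "mem s' = mem s0" "regs s' 23 = j" "regs s' 20 = of_bool (adj U j)" "regs s' u = U" "regs s' x = X"
          "regs s' 3 = n * n" "\<And>r. r \<notin> {20,21,22,23,24,25,26} \<Longrightarrow> regs s' r = regs s0 r" "regs s' 22 = regs s 22"
          using c1 ux mm by (simp_all add: agree_def)
        then show ?case using mm j unfolding I_def agree_def split by (simp add: ux add.commute c1)
      qed
    qed (use ux in \<open>auto simp: adj_cost_def\<close>)
  qed (auto simp: I_def)
  show "hoare (\<lambda>s. s = s0) (free_com u x) (free_cost n)
     (\<lambda>s'. agree {20,21,22,23,24,25,26} s0 s' \<and> (\<forall>\<sigma>. env \<sigma> s0 \<longrightarrow> regs s' 22 = of_bool (free \<sigma> (regs s0 u) (regs s0 x))))"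
    unfolding free_com_def
  proof (rule hoare_pre, (rule hoare_seq hoare_basic W)+, goal_cases)
    case (1 s)
    have "free \<sigma>' U X \<longleftrightarrow> (\<forall>w. w < n \<longrightarrow> adj U w \<longrightarrow> \<sigma> w \<noteq> X)" if "env \<sigma>' s0" for \<sigma>'
      using envD(3)[OF that] envD(3)[OF e] adj_lt2 unfolding free_def by metis
    then show ?case using 1 envD(1)[OF e] by (auto simp: I_def U_def X_def)
  qed (simp add: free_cost_def algebra_simps)
qed

end

text \<open>Frame condition: \<open>F\<close> does not look at the registers in \<open>S\<close>.
  What a caller knows about its registers is passed as a predicate that is stable under the scratch
  registers of the callee.\<close>

definition stable :: "nat set \<Rightarrow> ((nat \<Rightarrow> nat) \<Rightarrow> bool) \<Rightarrow> bool" where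
  "stable S F \<longleftrightarrow> (\<forall>g g'. F g \<longrightarrow> (\<forall>r. r \<notin> S \<longrightarrow> g' r = g r) \<longrightarrow> F g')"

lemma stable_upd: "stable S F \<Longrightarrow> a \<in> S \<Longrightarrow> F (g(a := j)) \<longleftrightarrow> F g"
  unfolding stable_def by (metis fun_upd_apply)

lemma stable_mono: "stable S F \<Longrightarrow> S' \<subseteq> S \<Longrightarrow> stable S' F"
  unfolding stable_def by (meson subsetD)

context machine
begin

lemma env_set_reg[simp]: "a \<notin> {0, 2, 3, 4, 5, 6, 7, 31} \<Longrightarrow> env \<sigma> (set_reg a x s) \<longleftrightarrow> env \<sigma> s"
  unfolding env_def consts_ok_def adj_ok_def by auto

lemma hoare_guard:
  "hoare (\<lambda>s. ((\<exists>\<sigma>. env \<sigma> s) \<and> regs s 13 < n) \<and>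
     (\<forall>s'. agree {20,21,22,23,24,25,26,27,28} s s' \<and> (\<forall>\<sigma>. env \<sigma> s \<longrightarrow> regs s' 27 = n * n + regs s 13 \<and>
        regs s' 28 = of_bool ((\<sigma> (regs s 13) = 0 \<or> \<sigma> (regs s 13) = regs s 12) \<and> free \<sigma> (regs s 13) (regs s 12))) \<longrightarrow> Q s'))
     guard_com (free_cost n + 40) Q"
proof (rule hoare_spec)
  fix s0 :: state assume "(\<exists>\<sigma>. env \<sigma> s0) \<and> regs s0 13 < n"
  then obtain \<sigma> where e: "env \<sigma> s0" and u: "regs s0 13 < n" by blast
  have A: "(13::nat) \<notin> {20,21,22,23,24,25,26}" "(12::nat) \<notin> {20,21,22,23,24,25,26}" by auto
  define ok where "ok = (\<sigma> (regs s0 13) = 0 \<or> \<sigma> (regs s0 13) = regs s0 12)"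
  define fr where "fr = free \<sigma> (regs s0 13) (regs s0 12)"
  note c0 = envD(1)[OF e]
  have m: "mem s0 (n * n + regs s0 13) = \<sigma> (regs s0 13)" using envD(3)[OF e u] .
  have same: "\<sigma>' (regs s0 13) = \<sigma> (regs s0 13)" "free \<sigma>' (regs s0 13) = free \<sigma> (regs s0 13)" if "env \<sigma>' s0" for \<sigma>'
    using envD(3)[OF that] envD(3)[OF e] u adj_lt2 unfolding free_def by (auto simp: fun_eq_iff)
  have half: "hoare (\<lambda>s. s = s0)
     (Add 27 3 13 ;; Load 28 27 ;;
     Cond 28 (Sub 25 28 12 ;; Sub 26 12 28 ;; Add 25 25 26 ;; Cond 25 (Const 28 0) (Const 28 1)) (Const 28 1)) 20
     (\<lambda>s. agree {25,26,27,28} s0 s \<and> regs s 27 = n * n + regs s0 13 \<and> regs s 28 = of_bool ok)"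
    by (rule hoare_pre, (rule hoare_seq hoare_basic hoare_cond)+)
       (use c0 m in \<open>auto simp: ok_def\<close>)
  have "hoare (\<lambda>s. agree {25,26,27,28} s0 s \<and> regs s 27 = n * n + regs s0 13 \<and> regs s 28 = of_bool ok)
    (free_com 13 12 ;; Cond 28 (Add 28 22 2) Skip) (free_cost n + 15)
    (\<lambda>s. agree {20,21,22,23,24,25,26,27,28} s0 s \<and> regs s 27 = n * n + regs s0 13 \<and> regs s 28 = of_bool (ok \<and> fr))"
  proof (rule hoare_pre, (rule hoare_seq hoare_basic hoare_cond hoare_free_com[OF A])+, goal_cases)
    case (1 s)
    then have a: "agree {25,26,27,28} s0 s" by blast
    have es: "env \<sigma> s" by (rule env_agree[OF e a]) auto
    have rs: "regs s 13 = regs s0 13" "regs s 12 = regs s0 12" "regs s 2 = 0" using a c0 by (auto simp: agree_def)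
    show ?case
    proof (intro conjI exI[of _ \<sigma>] allI impI es, goal_cases)
      case 1 show ?case using rs u by simp
    next
      case (2 s')
      have a2: "agree {20,21,22,23,24,25,26,27,28} s0 s'" by (rule agree_trans[OF a conjunct1[OF 2]]) auto
      have "regs s' 22 = of_bool fr" "regs s' 28 = of_bool ok" "regs s' 27 = n * n + regs s0 13" "regs s' 2 = 0"
        using 2 es rs \<open>agree {25,26,27,28} s0 s \<and> _\<close> by (auto simp: agree_def fr_def)
      then show ?case using a2 by auto
    qed
  qed auto
  note hoare_seq[OF this half]
  then have "hoare (\<lambda>s. s = s0) guard_com (20 + (free_cost n + 15) + 1)
    (\<lambda>s. agree {20,21,22,23,24,25,26,27,28} s0 s \<and> regs s 27 = n * n + regs s0 13 \<and> regs s 28 = of_bool (ok \<and> fr))"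
    unfolding guard_com_def .
  then show "hoare (\<lambda>s. s = s0) guard_com (free_cost n + 40)
     (\<lambda>s'. agree {20,21,22,23,24,25,26,27,28} s0 s' \<and> (\<forall>\<sigma>. env \<sigma> s0 \<longrightarrow> regs s' 27 = n * n + regs s0 13 \<and>
        regs s' 28 = of_bool ((\<sigma> (regs s0 13) = 0 \<or> \<sigma> (regs s0 13) = regs s0 12) \<and> free \<sigma> (regs s0 13) (regs s0 12))))"
    by (rule hoare_post[OF hoare_pre]) (use same in \<open>auto simp: ok_def fr_def\<close>)
qed

text \<open>Once register \<open>29\<close> is \<open>0\<close> it stays so. Hence \<open>A\<close>
  is reached only if all flips give \<open>0\<close>, and all other outcomes are bounded by
  \<open>C\<close>.\<close>

lemma success_flips:
  assumes "\<And>s'. agree {29,30} s0 s' \<Longrightarrow> regs s' 29 = 1 \<Longrightarrow> A \<le> success X t (K, s')"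
    and "\<And>s'. agree {29,30} s0 s' \<Longrightarrow> regs s' 29 = 0 \<Longrightarrow> C \<le> success X t (K, s')"
    and "agree {29,30} s0 s"
  shows "(regs s 29 = 0 \<longrightarrow> C \<le> success X (t + (5 * k + 1)) (flips k # K, s)) \<and>
    (regs s 29 = 1 \<longrightarrow> A / 2 ^ k + (1 - 1 / 2 ^ k) * C \<le> success X (t + (5 * k + 1)) (flips k # K, s))"
  using assms(3)
proof (induction k arbitrary: s)
  case 0
  then show ?case using assms(1,2) by (simp add: success_step)
next
  case (Suc k)
  have e: "t + (5 * Suc k + 1) = Suc (Suc (Suc (Suc (Suc (t + (5 * k + 1))))))" by simp
  have a: "agree {29,30} s0 (set_reg 30 x s)" "agree {29,30} s0 (set_reg 29 y (set_reg 30 x s))" for x y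
    using Suc.prems by auto
  have step: "success X (t + (5 * Suc k + 1)) (flips (Suc k) # K, s) =
     (success X (t + (5 * k + 1)) (flips k # K, set_reg 30 0 s) +
      success X (t + (5 * k + 1)) (flips k # K, set_reg 29 0 (set_reg 30 1 s))) / 2"
    unfolding e by (simp add: success_step success_flip del: add_Suc_right)
  have z: "C \<le> success X (t + (5 * k + 1)) (flips k # K, set_reg 29 0 (set_reg 30 1 s))"
    using Suc.IH[OF a(2)] by simp
  have half: "A / 2 ^ Suc k + (1 - 1 / 2 ^ Suc k) * C = ((A / 2 ^ k + (1 - 1 / 2 ^ k) * C) + C) / 2"
    by (simp add: field_simps)
  show ?case unfolding step
    using Suc.IH[OF a(1), of 0] z half by auto
qed

definition framed :: "((nat \<Rightarrow> nat) \<Rightarrow> bool) \<Rightarrow> pcol \<Rightarrow> state \<Rightarrow> bool" where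
  "framed F \<sigma> s \<longleftrightarrow> env \<sigma> s \<and> F (regs s)"

lemma framed_agree: "framed F \<sigma> s \<Longrightarrow> agree S s s' \<Longrightarrow> stable S F \<Longrightarrow> \<forall>r\<in>{0, 2, 3, 4, 5, 6, 7, 31}. r \<notin> S \<Longrightarrow> framed F \<sigma> s'"
  unfolding framed_def stable_def using env_agree by (meson agree_def)

definition scratch :: "nat set" where "scratch = {20,21,22,23,24,25,26,27,28,29,30}"

text \<open>The guard computes the condition in \<open>upd\<close>, and the coin of bias
  \<open>p\<close> is the event that \<open>b\<close> flips are all \<open>0\<close>.\<close>

lemma sim_upd:
  assumes F: "stable scratch F" "\<And>g. F g \<Longrightarrow> g 13 = u \<and> g 12 = x" and u: "u < n"
  shows "sim (framed F) (upd_com b) (upd_cost n b) (upd u x) (framed F)"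
proof -
  define c where "c \<sigma> \<longleftrightarrow> (\<sigma> u = 0 \<or> \<sigma> u = x) \<and> free \<sigma> u x" for \<sigma>
  define M where "M \<sigma> s \<longleftrightarrow> framed F \<sigma> s \<and> regs s 27 = n * n + u \<and> regs s 28 = of_bool (c \<sigma>)" for \<sigma> s
  have 1: "sim (framed F) guard_com (free_cost n + 40) (\<lambda>f. f) M"
  proof (rule sim_id, rule hoare_specD[OF hoare_guard])
    fix \<sigma> s assume s: "framed F \<sigma> s"
    then show "(\<exists>\<sigma>. env \<sigma> s) \<and> regs s 13 < n" using F(2) u by (auto simp: framed_def)
    fix s' assume p: "agree {20,21,22,23,24,25,26,27,28} s s' \<and> (\<forall>\<sigma>. env \<sigma> s \<longrightarrow> regs s' 27 = n * n + regs s 13 \<and>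
        regs s' 28 = of_bool ((\<sigma> (regs s 13) = 0 \<or> \<sigma> (regs s 13) = regs s 12) \<and> free \<sigma> (regs s 13) (regs s 12)))"
    have "framed F \<sigma> s'"
      by (rule framed_agree[OF s conjunct1[OF p] stable_mono[OF F(1)]]) (auto simp: scratch_def)
    then show "M \<sigma> s'" using p s F(2)[of "regs s"] by (auto simp: M_def framed_def c_def)
  qed
  have 2: "sim (\<lambda>\<sigma> s. M \<sigma> s \<and> regs s 28 \<noteq> 0) ((Const 29 1 ;; flips b) ;; Cond 29 (Store 27 12) (Store 27 2))
     (5 * b + 10) (\<lambda>f \<sigma>. p * f (\<sigma>(u := x)) + (1 - p) * f (\<sigma>(u := 0))) (framed F)"
  proof (rule simI)
    fix X K t f \<sigma> s
    assume M: "M \<sigma> s \<and> regs s 28 \<noteq> 0" and Q: "\<And>\<sigma>' s'. framed F \<sigma>' s' \<Longrightarrow> f \<sigma>' \<le> success X t (K, s')"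
    define K' where "K' = Cond 29 (Store 27 12) (Store 27 2) # K"
    define s1 where "s1 = set_reg 29 1 s"
    have fin: "f (\<sigma>(u := y)) \<le> success X t (K, s'\<lparr>mem := (mem s')(regs s' 27 := y)\<rparr>)" if a: "agree {29,30} s1 s'" for s' y
    proof -
      have a': "agree {29,30} s s'" using a by (auto simp: s1_def agree_def)
      have "framed F \<sigma> s'" by (rule framed_agree[OF _ a' stable_mono[OF F(1)]]) (use M in \<open>auto simp: scratch_def M_def\<close>)
      then have "framed F (\<sigma>(u := y)) (s'\<lparr>mem := (mem s')(n * n + u := y)\<rparr>)"
        using env_store[OF _ u] by (auto simp: framed_def)
      moreover have "regs s' 27 = n * n + u" using a' M by (auto simp: agree_def M_def)
      ultimately show ?thesis using Q by simp
    qed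
    have r12: "regs s' 12 = x" "regs s' 2 = 0" if "agree {29,30} s1 s'" for s'
      using that M F(2)[of "regs s"] envD(1)[of \<sigma> s] by (auto simp: M_def framed_def agree_def s1_def)
    have "(regs s1 29 = 0 \<longrightarrow> f (\<sigma>(u := 0)) \<le> success X (Suc (Suc t) + (5 * b + 1)) (flips b # K', s1)) \<and>
      (regs s1 29 = 1 \<longrightarrow> f (\<sigma>(u := x)) / 2 ^ b + (1 - 1 / 2 ^ b) * f (\<sigma>(u := 0)) \<le> success X (Suc (Suc t) + (5 * b + 1)) (flips b # K', s1))"
    proof (rule success_flips[of s1])
      fix s' assume s': "agree {29,30} s1 s'" "regs s' 29 = 1"
      then show "f (\<sigma>(u := x)) \<le> success X (Suc (Suc t)) (K', s')" using fin[OF s'(1), of x] r12[OF s'(1)]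
        by (simp add: K'_def success_step)
    next
      fix s' assume s': "agree {29,30} s1 s'" "regs s' 29 = 0"
      then show "f (\<sigma>(u := 0)) \<le> success X (Suc (Suc t)) (K', s')" using fin[OF s'(1), of 0] r12[OF s'(1)]
        by (simp add: K'_def success_step)
    qed simp
    then have "p * f (\<sigma>(u := x)) + (1 - p) * f (\<sigma>(u := 0)) \<le> success X (Suc (Suc t) + (5 * b + 1)) (flips b # K', s1)"
      by (simp add: s1_def p_def)
    also have "\<dots> = success X (t + (5 * b + 6)) (((Const 29 1 ;; flips b) ;; Cond 29 (Store 27 12) (Store 27 2)) # K, s)"
      by (simp add: success_step K'_def s1_def numeral_eq_Suc)
    also have "\<dots> \<le> success X (t + (5 * b + 10)) (((Const 29 1 ;; flips b) ;; Cond 29 (Store 27 12) (Store 27 2)) # K, s)"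
      by (rule success_mono) simp
    finally show "p * f (\<sigma>(u := x)) + (1 - p) * f (\<sigma>(u := 0)) \<le>
       success X (t + (5 * b + 10)) (((Const 29 1 ;; flips b) ;; Cond 29 (Store 27 12) (Store 27 2)) # K, s)" .
  qed
  have 3: "sim (\<lambda>\<sigma> s. M \<sigma> s \<and> regs s 28 = 0) Skip 1 (\<lambda>f. f) (framed F)"
    by (rule sim_id, rule hoare_pre[OF hoare_basic(1)]) (auto simp: M_def)
  have 4: "sim M (Cond 28 ((Const 29 1 ;; flips b) ;; Cond 29 (Store 27 12) (Store 27 2)) Skip) (max (5 * b + 10) 1 + 1)
     (\<lambda>f \<sigma>. if c \<sigma> then p * f (\<sigma>(u := x)) + (1 - p) * f (\<sigma>(u := 0)) else f \<sigma>) (framed F)"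
    by (rule sim_cond[OF 2 3]) (auto simp: M_def)
  show ?thesis unfolding upd_com_def
    by (rule sim_weaken[OF sim_seq[OF 1 4]]) (auto simp: upd_cost_def upd_def c_def)
qed

end

section \<open>Loops over neighbours, colours and random draws\<close>

definition nbrs_com :: "com \<Rightarrow> com" where
  "nbrs_com body = Add 13 0 2 ;; While 13 (Sub 13 13 31 ;; adj_com 11 13 ;; Cond 20 body Skip)"

definition sweep_com :: "nat \<Rightarrow> com" where
  "sweep_com b = Add 12 4 2 ;; While 12 (nbrs_com (upd_com b) ;; nbrs_com (upd_com b) ;; Sub 12 12 31)"

text \<open>Register \<open>16\<close> starts at half of the power of two \<open>Y\<close> and is
  halved, so the loop runs once per binary digit of a number below \<open>Y\<close>.\<close>

definition rand_com :: com where
  "rand_com = Const 12 0 ;; Half 16 7 ;; While 16 (Flip 17 ;; Add 12 12 12 ;; Add 12 12 17 ;; Half 16 16)"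

definition mix_com :: "nat \<Rightarrow> com" where
  "mix_com b = rand_com ;; Cond 12 (Sub 25 12 4 ;; Cond 25 Skip (upd_com b)) Skip"

definition scan_nbrs_com :: "nat \<Rightarrow> com" where
  "scan_nbrs_com b = nbrs_com (Add 15 3 2 ;; While 15 (Sub 15 15 31 ;; mix_com b))"

text \<open>Passes a randomly drawn value to the next fragment as part of the ghost state.\<close>

lemma sim_ghost:
  assumes "\<And>x. sim (P x) p b (T x) Q"
  shows "sim (\<lambda>(\<sigma>, x). P x \<sigma>) p b (\<lambda>f (\<sigma>, x). T x f \<sigma>) Q"
  by (rule simI) (use simD[OF assms] in auto)

lemma sum_split_pow2: "(\<Sum>i<2 ^ Suc k. h i) = (\<Sum>i<2 ^ k. h i) + (\<Sum>i<(2::nat) ^ k. h (2 ^ k + i))"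
  for h :: "nat \<Rightarrow> real"
proof -
  have "{..<2 ^ Suc k} = {..<2 ^ k} \<union> {2 ^ k..<2 ^ k + (2::nat) ^ k}" by auto
  then have "sum h {..<2 ^ Suc k} = sum h ({..<2 ^ k} \<union> {2 ^ k..<2 ^ k + 2 ^ k})" by (rule arg_cong)
  also have "\<dots> = sum h {..<2 ^ k} + sum h {2 ^ k..<2 ^ k + 2 ^ k}"
    by (rule sum.union_disjoint) auto
  also have "sum h {2 ^ k..<2 ^ k + 2 ^ k} = (\<Sum>i<2 ^ k. h (2 ^ k + i))"
    by (rule sum.reindex_bij_witness[of _ "\<lambda>i. 2 ^ k + i" "\<lambda>i. i - 2 ^ k"]) auto
  finally show ?thesis .
qed

text \<open>With \<open>k\<close> digits still to come, the final value is uniform on the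
  \<open>2 ^ k\<close> numbers that begin with the digits drawn so far.\<close>

lemma success_rand_loop:
  assumes "\<And>s' x. agree {12,16,17} s0 s' \<Longrightarrow> regs s' 12 = x \<Longrightarrow> h x \<le> success X t (K, s')"
    and "agree {12,16,17} s0 s" "regs s 16 = 2 ^ k div 2"
  shows "(\<Sum>i<2 ^ k. h (regs s 12 * 2 ^ k + i)) / 2 ^ k
    \<le> success X (t + (8 * k + 1)) (While 16 (Flip 17 ;; Add 12 12 12 ;; Add 12 12 17 ;; Half 16 16) # K, s)"
  using assms(2,3)
proof (induction k arbitrary: s)
  case 0
  then show ?case using assms(1)[of s] by (simp add: success_step)
next
  case (Suc k)
  define L where "L = While 16 (Flip 17 ;; Add 12 12 12 ;; Add 12 12 17 ;; Half 16 16)"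
  define s' where "s' x = set_reg 16 (2 ^ k div 2) (set_reg 12 (regs s 12 + regs s 12 + x) (set_reg 12 (regs s 12 + regs s 12) (set_reg 17 x s)))" for x
  have e: "t + (8 * Suc k + 1) = Suc (Suc (Suc (Suc (Suc (Suc (Suc (Suc (t + (8 * k + 1)))))))))" by simp
  have step: "success X (t + (8 * Suc k + 1)) (L # K, s) = (success X (t + (8 * k + 1)) (L # K, s' 0) + success X (t + (8 * k + 1)) (L # K, s' 1)) / 2"
    unfolding e L_def using Suc.prems(2) by (simp add: success_step success_flip s'_def del: add_Suc_right)
  have IH: "(\<Sum>i<2 ^ k. h ((2 * regs s 12 + x) * 2 ^ k + i)) / 2 ^ k \<le> success X (t + (8 * k + 1)) (L # K, s' x)" for x
    using Suc.IH[of "s' x"] Suc.prems(1) by (simp add: s'_def L_def mult_2)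
  have eq: "(\<Sum>i<2 ^ Suc k. h (regs s 12 * 2 ^ Suc k + i)) / 2 ^ Suc k
    = ((\<Sum>i<2 ^ k. h ((2 * regs s 12 + 0) * 2 ^ k + i)) / 2 ^ k + (\<Sum>i<2 ^ k. h ((2 * regs s 12 + 1) * 2 ^ k + i)) / 2 ^ k) / 2"
    unfolding sum_split_pow2 by (simp add: add_divide_distrib algebra_simps)
  show ?case unfolding L_def[symmetric] step eq by (intro divide_right_mono add_mono IH) simp
qed

context machine
begin

definition nbrs_cost :: "nat \<Rightarrow> nat" where "nbrs_cost c = n * (c + adj_cost n + 20) + 10"

lemma sim_nbrs:
  assumes body: "\<And>u. u < n \<Longrightarrow> sim (framed (\<lambda>g. F g \<and> g 13 = u)) body c (T u) (framed (\<lambda>g. F g \<and> g 13 = u))"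
    and F: "stable ({20, 21} \<union> {13}) F" "\<And>g. F g \<Longrightarrow> g 11 = v" and v: "v < n"
  shows "sim (framed F) (nbrs_com body) (nbrs_cost c) (foldr T (nb_list v)) (framed F)"
proof -
  define I where "I j \<sigma> s \<longleftrightarrow> framed (\<lambda>g. F g \<and> g 13 = j) \<sigma> s" for j \<sigma> s
  have stab: "stable {20, 21} (\<lambda>g. F g \<and> g 13 = j)" for j
    using F(1) unfolding stable_def by auto
  have A: "(11::nat) \<notin> {20, 21}" "(13::nat) \<notin> {20, 21}" by auto
  have upd13: "F (g(13 := j)) \<longleftrightarrow> F g" for g j
    by (rule stable_upd[OF F(1)]) simp
  have loop: "sim (I n) (While 13 (Sub 13 13 31 ;; adj_com 11 13 ;; Cond 20 body Skip)) (n * ((c + adj_cost n + 15) + 1) + 1)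
     (downto (\<lambda>j. if adj v j then T j else (\<lambda>f. f)) n) (I 0)"
  proof (rule sim_while)
    fix j assume j: "j < n"
    define M where "M \<sigma> s \<longleftrightarrow> I j \<sigma> s \<and> regs s 20 = of_bool (adj v j)" for \<sigma> s
    have 0: "sim (I (Suc j)) (Sub 13 13 31) 1 (\<lambda>f. f) (I j)"
      by (rule sim_id, rule hoare_pre[OF hoare_basic(4)]) (auto simp: I_def framed_def upd13 envD(1))
    have 1: "sim (I j) (adj_com 11 13) (adj_cost n) (\<lambda>f. f) M"
    proof (rule sim_id, rule hoare_specD[OF hoare_adj_com[OF A, where N = n]])
      fix \<sigma> s assume s: "I j \<sigma> s"
      then have e: "env \<sigma> s" "regs s 11 = v" "regs s 13 = j" using F(2) by (auto simp: I_def framed_def)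
      then show "regs s 31 = 1 \<and> regs s 2 = 0 \<and> regs s 11 \<le> n" using envD(1)[OF e(1)] v by auto
      fix s' assume p: "agree {20, 21} s s' \<and> regs s' 20 = mem s (regs s 11 * regs s 0 + regs s 13)"
      have "I j \<sigma> s'" using framed_agree[OF _ conjunct1[OF p] stab] s unfolding I_def by auto
      then show "M \<sigma> s'" using p envD(1)[OF e(1)] envD(2)[OF e(1) v j] e by (auto simp: M_def)
    qed
    have 2: "sim (\<lambda>\<sigma> s. M \<sigma> s \<and> regs s 20 \<noteq> 0) body c (T j) (I j)"
      by (rule sim_weaken[OF body[OF j]]) (auto simp: M_def I_def)
    have 3: "sim (\<lambda>\<sigma> s. M \<sigma> s \<and> regs s 20 = 0) Skip 1 (\<lambda>f. f) (I j)"
      by (rule sim_id, rule hoare_pre[OF hoare_basic(1)]) (auto simp: M_def)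
    have 4: "sim M (Cond 20 body Skip) (max c 1 + 1) (\<lambda>f \<sigma>. if adj v j then T j f \<sigma> else f \<sigma>) (I j)"
      by (rule sim_cond[OF 2 3]) (auto simp: M_def)
    show "sim (I (Suc j)) (Sub 13 13 31 ;; adj_com 11 13 ;; Cond 20 body Skip) (c + adj_cost n + 15)
       (if adj v j then T j else (\<lambda>f. f)) (I j)"
      by (rule sim_weaken[OF sim_seq[OF 0 sim_seq[OF 1 4]]]) auto
  qed (auto simp: I_def framed_def)
  have init: "sim (framed F) (Add 13 0 2) 1 (\<lambda>f. f) (I n)"
    by (rule sim_id, rule hoare_pre[OF hoare_basic(3)]) (auto simp: I_def framed_def upd13 envD(1))
  show ?thesis unfolding nbrs_com_def nb_list_def downto_foldr[symmetric]
    by (rule sim_weaken[OF sim_seq[OF init loop]]) (auto simp: nbrs_cost_def I_def framed_def algebra_simps)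
qed

lemma sim_sweep:
  assumes F: "stable (scratch \<union> {12, 13}) F" "\<And>g. F g \<Longrightarrow> g 11 = v" and v: "v < n"
  shows "sim (framed F) (sweep_com b) (q * (2 * nbrs_cost (upd_cost n b) + 10) + 10) (sweep_at v) (framed F)"
proof -
  define I where "I j \<sigma> s \<longleftrightarrow> framed (\<lambda>g. F g \<and> g 12 = j) \<sigma> s" for j \<sigma> s
  have upd12: "F (g(12 := j)) \<longleftrightarrow> F g" for g j
    by (rule stable_upd[OF F(1)]) simp
  have pass: "sim (I x) (nbrs_com (upd_com b)) (nbrs_cost (upd_cost n b)) (word (nb_list v) x) (I x)" for x
    unfolding I_def
  proof (rule sim_nbrs[OF sim_upd _ _ v])
    show "stable scratch (\<lambda>g. (F g \<and> g 12 = x) \<and> g 13 = u)" for u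
      using F(1) unfolding stable_def scratch_def by auto
    show "stable ({20, 21} \<union> {13}) (\<lambda>g. F g \<and> g 12 = x)"
      using F(1) unfolding stable_def scratch_def by auto
  qed (use F(2) in auto)
  have loop: "sim (I q) (While 12 (nbrs_com (upd_com b) ;; nbrs_com (upd_com b) ;; Sub 12 12 31))
      (q * ((2 * nbrs_cost (upd_cost n b) + 5) + 1) + 1) (downto (\<lambda>j. phase (nb_list v) (Suc j)) q) (I 0)"
  proof (rule sim_while)
    fix j assume j: "j < q"
    have 1: "sim (I (Suc j)) (Sub 12 12 31) 1 (\<lambda>f. f) (I j)"
      by (rule sim_id, rule hoare_pre[OF hoare_basic(4)]) (auto simp: I_def framed_def upd12 envD(1))
    show "sim (I (Suc j)) (nbrs_com (upd_com b) ;; nbrs_com (upd_com b) ;; Sub 12 12 31)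
        (2 * nbrs_cost (upd_cost n b) + 5) (phase (nb_list v) (Suc j)) (I j)"
      by (rule sim_weaken[OF sim_seq[OF pass sim_seq[OF pass 1]]]) (auto simp: phase_def)
  qed (auto simp: I_def framed_def)
  have init: "sim (framed F) (Add 12 4 2) 1 (\<lambda>f. f) (I q)"
    by (rule sim_id, rule hoare_pre[OF hoare_basic(3)]) (auto simp: I_def framed_def upd12 envD(1))
  show ?thesis unfolding sweep_com_def sweep_at_def downto_foldr_Suc[symmetric]
    by (rule sim_weaken[OF sim_seq[OF init loop]]) (auto simp: I_def framed_def algebra_simps)
qed

lemma sim_rand:
  assumes F: "stable {12, 16, 17} F"
  shows "sim (framed F) rand_com (8 * \<beta> + 5) (\<lambda>f \<sigma>. (\<Sum>x<Y. f (\<sigma>, x)) / Y) (\<lambda>(\<sigma>, x). framed (\<lambda>g. F g \<and> g 12 = x) \<sigma>)"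
proof (rule simI)
  fix X K t f \<sigma> s
  assume s: "framed F \<sigma> s" and Q: "\<And>\<sigma>' s'. (case \<sigma>' of (\<sigma>, x) \<Rightarrow> framed (\<lambda>g. F g \<and> g 12 = x) \<sigma>) s' \<Longrightarrow> f \<sigma>' \<le> success X t (K, s')"
  define s1 where "s1 = set_reg 16 (Y div 2) (set_reg 12 0 s)"
  define L where "L = While 16 (Flip 17 ;; Add 12 12 12 ;; Add 12 12 17 ;; Half 16 16)"
  have "(\<Sum>i<2 ^ \<beta>. f (\<sigma>, regs s1 12 * 2 ^ \<beta> + i)) / 2 ^ \<beta> \<le> success X (t + (8 * \<beta> + 1)) (L # K, s1)"
    unfolding L_def
  proof (rule success_rand_loop[of s])
    fix s' x assume a: "agree {12,16,17} s s'" "regs s' 12 = x"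
    have "framed F \<sigma> s'" by (rule framed_agree[OF s a(1) F]) auto
    then show "f (\<sigma>, x) \<le> success X t (K, s')" using a by (intro Q) (auto simp: framed_def)
  qed (auto simp: s1_def Y_eq)
  then have "(\<Sum>x<Y. f (\<sigma>, x)) / Y \<le> success X (t + (8 * \<beta> + 1)) (L # K, s1)" by (simp add: s1_def Y_eq)
  also have "\<dots> = success X (t + (8 * \<beta> + 5)) (rand_com # K, s)"
  proof -
    have e: "t + (8 * \<beta> + 5) = Suc (Suc (Suc (Suc (t + (8 * \<beta> + 1)))))" by simp
    have "regs s 7 = Y" using s envD(1) by (auto simp: framed_def)
    then show ?thesis unfolding e rand_com_def L_def[symmetric]
      by (simp add: success_step s1_def del: add_Suc_right)
  qed
  finally show "(\<Sum>x<Y. f (\<sigma>, x)) / Y \<le> success X (t + (8 * \<beta> + 5)) (rand_com # K, s)" .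
qed

definition mix_cost :: nat where "mix_cost = 8 * \<beta> + upd_cost n b + 20"

lemma sim_mix:
  assumes F: "stable (scratch \<union> {12, 16, 17}) F" "\<And>g. F g \<Longrightarrow> g 13 = u" and u: "u < n"
  shows "sim (framed F) (mix_com b) mix_cost (mix u) (framed F)"
proof -
  have Fr: "stable {12, 16, 17} F" by (rule stable_mono[OF F(1)]) auto
  have *: "sim (framed (\<lambda>g. F g \<and> g 12 = x)) (Cond 12 (Sub 25 12 4 ;; Cond 25 Skip (upd_com b)) Skip) (upd_cost n b + 10)
     (\<lambda>f \<sigma>. if 1 \<le> x \<and> x \<le> q then upd u x f \<sigma> else f \<sigma>) (framed F)" for x
  proof -
    let ?F = "\<lambda>g. F g \<and> g 12 = x"
    have sF: "stable scratch ?F" using F(1) unfolding stable_def scratch_def by auto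
    have upd25: "?F (g(25 := j)) \<longleftrightarrow> ?F g" for g j
      by (rule stable_upd[OF sF]) (simp add: scratch_def)
    have 1: "sim (\<lambda>\<sigma> s. framed ?F \<sigma> s \<and> regs s 12 \<noteq> 0) (Sub 25 12 4) 1 (\<lambda>f. f) (\<lambda>\<sigma> s. framed ?F \<sigma> s \<and> regs s 25 = x - q)"
      by (rule sim_id, rule hoare_pre[OF hoare_basic(4)]) (use upd25 in \<open>auto simp: framed_def envD(1)\<close>)
    have 2: "sim (\<lambda>\<sigma> s. (framed ?F \<sigma> s \<and> regs s 25 = x - q) \<and> regs s 25 \<noteq> 0) Skip 1 (\<lambda>f. f) (framed F)"
      by (rule sim_id, rule hoare_pre[OF hoare_basic(1)]) (auto simp: framed_def)
    have 3: "sim (\<lambda>\<sigma> s. (framed ?F \<sigma> s \<and> regs s 25 = x - q) \<and> regs s 25 = 0) (upd_com b) (upd_cost n b) (upd u x) (framed F)"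
      by (rule sim_weaken[OF sim_upd[OF sF _ u]]) (use F(2) in \<open>auto simp: framed_def\<close>)
    have 4: "sim (\<lambda>\<sigma> s. framed ?F \<sigma> s \<and> regs s 25 = x - q) (Cond 25 Skip (upd_com b)) (max 1 (upd_cost n b) + 1)
       (\<lambda>f \<sigma>. if x > q then f \<sigma> else upd u x f \<sigma>) (framed F)"
      by (rule sim_cond[OF 2 3]) auto
    have 5: "sim (\<lambda>\<sigma> s. framed ?F \<sigma> s \<and> regs s 12 = 0) Skip 1 (\<lambda>f. f) (framed F)"
      by (rule sim_id, rule hoare_pre[OF hoare_basic(1)]) (auto simp: framed_def)
    have 6: "sim (framed ?F) (Cond 12 (Sub 25 12 4 ;; Cond 25 Skip (upd_com b)) Skip)
       (max (1 + (max 1 (upd_cost n b) + 1) + 1) 1 + 1)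
       (\<lambda>f \<sigma>. if x \<noteq> 0 then (if x > q then f \<sigma> else upd u x f \<sigma>) else f \<sigma>) (framed F)"
      by (rule sim_cond[OF sim_seq[OF 1 4] 5]) (auto simp: framed_def)
    show ?thesis by (rule sim_weaken[OF 6]) auto
  qed
  show ?thesis unfolding mix_com_def
    by (rule sim_weaken[OF sim_seq[OF sim_rand[OF Fr] sim_ghost[OF *]]]) (auto simp: mix_def mix_cost_def)
qed

lemma sim_scan_nbrs:
  assumes F: "stable (scratch \<union> {12, 13, 15, 16, 17}) F" "\<And>g. F g \<Longrightarrow> g 11 = v" and v: "v < n"
  shows "sim (framed F) (scan_nbrs_com b) (nbrs_cost (n * n * (mix_cost + 5) + 10)) (scan_at v) (framed F)"
  unfolding scan_nbrs_com_def scan_at_def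
proof (rule sim_nbrs)
  fix u assume u: "u < n"
  let ?F = "\<lambda>g. F g \<and> g 13 = u"
  define I where "I j \<sigma> s \<longleftrightarrow> framed (\<lambda>g. ?F g \<and> g 15 = j) \<sigma> s" for j :: nat and \<sigma> s
  have F15: "F (g(15 := j)) \<longleftrightarrow> F g" for g j
    by (rule stable_upd[OF F(1)]) simp
  have loop: "sim (I (n * n)) (While 15 (Sub 15 15 31 ;; mix_com b)) (n * n * ((mix_cost + 3) + 1) + 1) (downto (\<lambda>_. mix u) (n * n)) (I 0)"
  proof (rule sim_while)
    fix j
    have 0: "sim (I (Suc j)) (Sub 15 15 31) 1 (\<lambda>f. f) (I j)"
      by (rule sim_id, rule hoare_pre[OF hoare_basic(4)]) (auto simp: I_def framed_def F15 envD(1))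
    have 1: "sim (I j) (mix_com b) mix_cost (mix u) (I j)"
      unfolding I_def by (rule sim_mix[OF _ _ u]) (use F(1) in \<open>auto simp: stable_def scratch_def\<close>)
    show "sim (I (Suc j)) (Sub 15 15 31 ;; mix_com b) (mix_cost + 3) (mix u) (I j)"
      by (rule sim_weaken[OF sim_seq[OF 0 1]]) auto
  qed (auto simp: I_def framed_def)
  have rn: "renew u = downto (\<lambda>_. mix u) (n * n)"
    unfolding renew_def by (simp add: downto_funpow R_eq)
  have init: "sim (framed ?F) (Add 15 3 2) 1 (\<lambda>f. f) (I (n * n))"
    by (rule sim_id, rule hoare_pre[OF hoare_basic(3)]) (auto simp: I_def framed_def F15 envD(1))
  show "sim (framed ?F) (Add 15 3 2 ;; While 15 (Sub 15 15 31 ;; mix_com b)) (n * n * (mix_cost + 5) + 10) (renew u) (framed ?F)"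
    unfolding rn
    by (rule sim_weaken[OF sim_seq[OF init loop]]) (auto simp: I_def framed_def algebra_simps)
next
  show "stable ({20, 21} \<union> {13}) F" by (rule stable_mono[OF F(1)]) (auto simp: scratch_def)
qed (use F v in auto)

end

section \<open>Finding the lowest flaw and iterating the repairs\<close>

definition count_free_com :: com where
  "count_free_com = (Const 18 0 ;; Add 12 4 2) ;; While 12 (free_com 11 12 ;; Add 18 18 22 ;; Sub 12 12 31) ;; Sub 19 6 18"

definition count_blank_com :: com where
  "count_blank_com = (Const 18 0 ;; Add 13 0 2) ;; While 13 (Sub 13 13 31 ;; adj_com 11 13 ;;
     Cond 20 (Add 24 3 13 ;; Load 24 24 ;; Cond 24 Skip (Add 18 18 31)) Skip) ;; Sub 19 18 5"

definition scan_com :: "nat \<Rightarrow> com \<Rightarrow> com" where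
  "scan_com d chk = (Const d 0 ;; Add 11 0 2) ;; While 11 (Sub 11 11 31 ;; chk ;; Cond 19 (Add d 11 31) Skip)"

definition iter_com :: "nat \<Rightarrow> com" where
  "iter_com b = scan_com 9 count_free_com ;; scan_com 10 count_blank_com ;;
     Cond 9 (Sub 11 9 31 ;; sweep_com b) (Cond 10 (Sub 11 10 31 ;; scan_nbrs_com b) Skip)"

definition main_com :: "nat \<Rightarrow> com" where
  "main_com b = Add 8 3 2 ;; While 8 (Sub 8 8 31 ;; iter_com b)"

text \<open>Encodes an optional vertex in a register: \<open>0\<close> for none, otherwise the
  vertex plus one. As the scan runs downwards, each hit overwrites the previous one and the lowest
  survives.\<close>

definition first :: "(nat \<Rightarrow> bool) \<Rightarrow> nat \<Rightarrow> nat \<Rightarrow> nat" where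
  "first P n j = (if \<exists>v. j \<le> v \<and> v < n \<and> P v then Suc (LEAST v. j \<le> v \<and> v < n \<and> P v) else 0)"

lemma first_n: "first P n n = 0" by (simp add: first_def)

lemma first_step:
  assumes "j < n" shows "first P n j = (if P j then Suc j else first P n (Suc j))"
proof (cases "P j")
  case True
  then have "(LEAST v. j \<le> v \<and> v < n \<and> P v) = j" using assms by (intro Least_equality) auto
  then show ?thesis using True assms by (auto simp: first_def)
next
  case False
  then have "(j \<le> v \<and> v < n \<and> P v) \<longleftrightarrow> (Suc j \<le> v \<and> v < n \<and> P v)" for v
    using le_neq_implies_less by (auto simp: Suc_le_eq le_less)
  then show ?thesis using False by (simp only: first_def if_False)
qed

lemma first_0_eq: "first P n 0 = (if {v. v < n \<and> P v} = {} then 0 else Suc (Min {v. v < n \<and> P v}))"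
proof (cases "{v. v < n \<and> P v} = {}")
  case False
  then have "Min {v. v < n \<and> P v} = (LEAST v. v < n \<and> P v)" using Least_Min[of "\<lambda>v. v < n \<and> P v"] by auto
  then show ?thesis using False by (auto simp: first_def)
qed (auto simp: first_def)

context machine
begin

lemma hoare_count_free:
  assumes F: "stable (scratch \<union> {12, 18, 19}) F" "\<And>g. F g \<Longrightarrow> g 11 = v" and v: "v < n"
  shows "hoare (framed F \<sigma>) count_free_com (q * (free_cost n + 10) + 20) (\<lambda>s. framed F \<sigma> s \<and> (regs s 19 \<noteq> 0 \<longleftrightarrow> short_list \<sigma> v))"
proof -
  define cnt where "cnt j = card {x\<in>{Suc j..q}. free \<sigma> v x}" for j
  define I where "I j s \<longleftrightarrow> framed F \<sigma> s \<and> j \<le> q \<and> regs s 12 = j \<and> regs s 18 = cnt j" for j s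
  have A: "(11::nat) \<notin> {20,21,22,23,24,25,26}" "(12::nat) \<notin> {20,21,22,23,24,25,26}" by auto
  note Fu = stable_upd[OF F(1)]
  have up: "F (g(12 := x)) = F g" "F (g(18 := x)) = F g" "F (g(19 := x)) = F g" for g x by (rule Fu; simp)+
  have loop: "hoare (I q) (While 12 (free_com 11 12 ;; Add 18 18 22 ;; Sub 12 12 31)) (q * ((free_cost n + 4) + 1) + 1) (I 0)"
  proof (rule hoare_while)
    fix j assume j: "j < q"
    have f: "hoare (I (Suc j)) (free_com 11 12) (free_cost n) (\<lambda>s. I (Suc j) s \<and> regs s 22 = of_bool (free \<sigma> v (Suc j)))"
    proof (rule hoare_specD[OF hoare_free_com[OF A]])
      fix s assume s: "I (Suc j) s"
      then have e: "env \<sigma> s" "regs s 11 = v" "regs s 12 = Suc j" "framed F \<sigma> s" using F(2) by (auto simp: I_def framed_def)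
      then show "\<exists>\<sigma>. env \<sigma> s \<and> regs s 11 < n" using v by auto
      fix s' assume p: "agree {20,21,22,23,24,25,26} s s' \<and> (\<forall>\<sigma>. env \<sigma> s \<longrightarrow> regs s' 22 = of_bool (free \<sigma> (regs s 11) (regs s 12)))"
      have "framed F \<sigma> s'" by (rule framed_agree[OF e(4) conjunct1[OF p] stable_mono[OF F(1)]]) (auto simp: scratch_def)
      then show "I (Suc j) s' \<and> regs s' 22 = of_bool (free \<sigma> v (Suc j))"
        using p e s by (auto simp: I_def agree_def)
    qed
    have "{x\<in>{Suc j..q}. free \<sigma> v x} = (if free \<sigma> v (Suc j) then insert (Suc j) {x\<in>{Suc (Suc j)..q}. free \<sigma> v x} else {x\<in>{Suc (Suc j)..q}. free \<sigma> v x})"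
      using j by (auto simp: Suc_le_eq order.order_iff_strict)
    then have cd: "cnt j = cnt (Suc j) + of_bool (free \<sigma> v (Suc j))" by (simp add: cnt_def)
    show "hoare (I (Suc j)) (free_com 11 12 ;; Add 18 18 22 ;; Sub 12 12 31) (free_cost n + 4) (I j)"
      by (rule hoare_pre, rule hoare_seq, rule hoare_seq, rule hoare_basic, rule hoare_basic, rule hoare_post[OF f])
         (use j in \<open>auto simp: I_def framed_def up envD(1) cd\<close>)
  qed (auto simp: I_def)
  have init: "hoare (framed F \<sigma>) (Const 18 0 ;; Add 12 4 2) 3 (I q)"
    by (rule hoare_pre, (rule hoare_seq hoare_basic)+) (auto simp: I_def framed_def up envD(1) cnt_def)
  have fin: "hoare (I 0) (Sub 19 6 18) 1 (\<lambda>s. framed F \<sigma> s \<and> (regs s 19 \<noteq> 0 \<longleftrightarrow> short_list \<sigma> v))"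
    by (rule hoare_pre[OF hoare_basic(4)]) (auto simp: I_def framed_def up envD(1) short_list_def avail_def cnt_def)
  show ?thesis unfolding count_free_com_def
    by (rule hoare_pre[OF hoare_seq[OF hoare_seq[OF fin loop] init]]) (auto simp: algebra_simps)
qed

lemma hoare_count_blank:
  assumes F: "stable (scratch \<union> {13, 18, 19}) F" "\<And>g. F g \<Longrightarrow> g 11 = v" and v: "v < n"
  shows "hoare (framed F \<sigma>) count_blank_com (n * (adj_cost n + 20) + 20) (\<lambda>s. framed F \<sigma> s \<and> (regs s 19 \<noteq> 0 \<longleftrightarrow> crowded \<sigma> v))"
proof -
  define I where "I j s \<longleftrightarrow> framed F \<sigma> s \<and> j \<le> n \<and> regs s 13 = j \<and> regs s 18 = card {u\<in>nb v. j \<le> u \<and> \<sigma> u = 0}" for j s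
  have A: "(11::nat) \<notin> {20,21}" "(13::nat) \<notin> {20,21}" by auto
  note Fu = stable_upd[OF F(1)]
  have up: "F (g(13 := x)) = F g" "F (g(18 := x)) = F g" "F (g(19 := x)) = F g" "F (g(24 := x)) = F g" for g x
    by (rule Fu; simp add: scratch_def)+
  let ?body = "Cond 20 (Add 24 3 13 ;; Load 24 24 ;; Cond 24 Skip (Add 18 18 31)) Skip"
  have loop: "hoare (I n) (While 13 (Sub 13 13 31 ;; adj_com 11 13 ;; ?body)) (n * ((adj_cost n + 15) + 1) + 1) (I 0)"
  proof (rule hoare_while)
    fix j assume j: "j < n"
    define J where "J s \<longleftrightarrow> framed F \<sigma> s \<and> regs s 13 = j \<and> regs s 18 = card {u\<in>nb v. Suc j \<le> u \<and> \<sigma> u = 0}" for s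
    have 1: "hoare (I (Suc j)) (Sub 13 13 31) 1 J"
      by (rule hoare_pre[OF hoare_basic(4)]) (auto simp: I_def J_def framed_def up envD(1))
    have 2: "hoare J (adj_com 11 13) (adj_cost n) (\<lambda>s. J s \<and> regs s 20 = of_bool (adj v j))"
    proof (rule hoare_specD[OF hoare_adj_com[OF A, where N = n]])
      fix s assume s: "J s"
      then have e: "env \<sigma> s" "regs s 11 = v" "regs s 13 = j" "framed F \<sigma> s" using F(2) by (auto simp: J_def framed_def)
      then show "regs s 31 = 1 \<and> regs s 2 = 0 \<and> regs s 11 \<le> n" using v envD(1)[OF e(1)] by auto
      fix s' assume p: "agree {20,21} s s' \<and> regs s' 20 = mem s (regs s 11 * regs s 0 + regs s 13)"
      have "framed F \<sigma> s'" by (rule framed_agree[OF e(4) conjunct1[OF p] stable_mono[OF F(1)]]) (auto simp: scratch_def)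
      then show "J s' \<and> regs s' 20 = of_bool (adj v j)"
        using p e s envD(1)[OF e(1)] envD(2)[OF e(1) v j] by (auto simp: J_def agree_def)
    qed
    have "{u\<in>nb v. j \<le> u \<and> \<sigma> u = 0} = (if adj v j \<and> \<sigma> j = 0 then insert j {u\<in>nb v. Suc j \<le> u \<and> \<sigma> u = 0} else {u\<in>nb v. Suc j \<le> u \<and> \<sigma> u = 0})"
      by (auto simp: Suc_le_eq order.order_iff_strict nb_def)
    then have cd: "card {u\<in>nb v. j \<le> u \<and> \<sigma> u = 0} = card {u\<in>nb v. Suc j \<le> u \<and> \<sigma> u = 0} + of_bool (adj v j \<and> \<sigma> j = 0)" by simp
    have 3: "hoare (\<lambda>s. J s \<and> regs s 20 = of_bool (adj v j)) ?body 10 (I j)"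
      by (rule hoare_pre, (rule hoare_seq hoare_cond hoare_basic)+)
         (use j in \<open>auto simp: I_def J_def framed_def up envD cd\<close>)
    show "hoare (I (Suc j)) (Sub 13 13 31 ;; adj_com 11 13 ;; ?body) (adj_cost n + 15) (I j)"
      by (rule hoare_pre[OF hoare_seq[OF hoare_seq[OF 3 2] 1]]) auto
  qed (auto simp: I_def)
  have init: "hoare (framed F \<sigma>) (Const 18 0 ;; Add 13 0 2) 3 (I n)"
  proof -
    have e: "{u\<in>nb v. n \<le> u \<and> \<sigma> u = 0} = {}" using nb_subset by force
    show ?thesis by (rule hoare_pre, (rule hoare_seq hoare_basic)+) (auto simp: I_def framed_def up envD(1) e)
  qed
  have fin: "hoare (I 0) (Sub 19 18 5) 1 (\<lambda>s. framed F \<sigma> s \<and> (regs s 19 \<noteq> 0 \<longleftrightarrow> crowded \<sigma> v))"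
    by (rule hoare_pre[OF hoare_basic(4)]) (auto simp: I_def framed_def up envD(1) crowded_def)
  show ?thesis unfolding count_blank_com_def
    by (rule hoare_pre[OF hoare_seq[OF hoare_seq[OF fin loop] init]]) (auto simp: algebra_simps)
qed

lemma hoare_scan:
  assumes chk: "\<And>F v. stable ({12, 13, 18, 19} \<union> scratch) F \<Longrightarrow> (\<And>g. F g \<Longrightarrow> g 11 = v) \<Longrightarrow> v < n \<Longrightarrow>
      hoare (framed F \<sigma>) chk c (\<lambda>s. framed F \<sigma> s \<and> (regs s 19 \<noteq> 0 \<longleftrightarrow> P v))"
    and F: "stable ({d, 11, 12, 13, 18, 19} \<union> scratch) F" and d: "d \<in> {9, 10}"
  shows "hoare (framed F \<sigma>) (scan_com d chk) (n * (c + 10) + 10) (framed (\<lambda>g. F g \<and> g d = first P n 0) \<sigma>)"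
proof -
  define I where "I j s \<longleftrightarrow> framed (\<lambda>g. F g \<and> g 11 = j \<and> g d = first P n j) \<sigma> s" for j s
  have up: "F (g(11 := x)) = F g" "F (g(d := x)) = F g" for g x by (rule stable_upd[OF F]; simp)+
  have d': "d \<noteq> 11" "d \<notin> {0, 2, 3, 4, 5, 6, 7, 31}" "d \<noteq> 19" "d \<noteq> 12" "d \<noteq> 13" "d \<noteq> 18" "d \<notin> scratch" using d by (auto simp: scratch_def)
  have loop: "hoare (I n) (While 11 (Sub 11 11 31 ;; chk ;; Cond 19 (Add d 11 31) Skip)) (n * ((c + 7) + 1) + 1) (I 0)"
  proof (rule hoare_while)
    fix j assume j: "j < n"
    define F' where "F' g \<longleftrightarrow> F g \<and> g 11 = j \<and> g d = first P n (Suc j)" for g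
    have s: "stable ({12, 13, 18, 19} \<union> scratch) F'"
      using F d' unfolding stable_def F'_def by (auto simp: scratch_def)
    have c: "hoare (framed F' \<sigma>) chk c (\<lambda>s. framed F' \<sigma> s \<and> (regs s 19 \<noteq> 0 \<longleftrightarrow> P j))"
      by (rule chk[OF s _ j]) (auto simp: F'_def)
    have e: "hoare (\<lambda>s. framed F' \<sigma> s \<and> (regs s 19 \<noteq> 0 \<longleftrightarrow> P j)) (Cond 19 (Add d 11 31) Skip) 2 (I j)"
      by (rule hoare_pre, (rule hoare_cond hoare_basic)+)
         (use d' j in \<open>auto simp: F'_def I_def framed_def up first_step[of j n P] envD(1)\<close>)
    have a: "hoare (I (Suc j)) (Sub 11 11 31) 1 (framed F' \<sigma>)"
      by (rule hoare_pre[OF hoare_basic(4)]) (use d' in \<open>auto simp: F'_def I_def framed_def up envD(1)\<close>)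
    show "hoare (I (Suc j)) (Sub 11 11 31 ;; chk ;; Cond 19 (Add d 11 31) Skip) (c + 7) (I j)"
      by (rule hoare_pre[OF hoare_seq[OF hoare_seq[OF e c] a]]) auto
  qed (auto simp: I_def framed_def)
  have init: "hoare (framed F \<sigma>) (Const d 0 ;; Add 11 0 2) 3 (I n)"
    by (rule hoare_pre, (rule hoare_seq hoare_basic)+) (use d' in \<open>auto simp: I_def framed_def up envD(1) first_n\<close>)
  show ?thesis unfolding scan_com_def
    by (rule hoare_pre[OF hoare_post[OF hoare_seq[OF loop init]]]) (auto simp: I_def framed_def algebra_simps)
qed

end

section \<open>Greedy completion of a flawless partial colouring\<close>

definition pick_com :: com where
  "pick_com = (Const 14 0 ;; Add 16 5 31) ;; While 16 (Add 12 4 16 ;; free_com 11 12 ;; Cond 22 (Add 14 12 2) Skip ;; Sub 16 16 31)"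

definition greedy_com :: com where
  "greedy_com = Add 11 0 2 ;; While 11 (Sub 11 11 31 ;; (Add 27 3 11 ;; Load 28 27) ;; Cond 28 Skip (pick_com ;; Store 27 14))"

definition copy_com :: com where
  "copy_com = Add 11 0 2 ;; While 11 (Sub 11 11 31 ;; Add 27 3 11 ;; Load 28 27 ;; Store 11 28)"

text \<open>The vertex to repair depends on the ghost state; each of its possible values is verified
  as if it were fixed.\<close>

lemma sim_param:
  assumes "\<And>v. sim (\<lambda>\<sigma> s. P \<sigma> s \<and> g \<sigma> = v) p b (T v) Q"
  shows "sim P p b (\<lambda>f \<sigma>. T (g \<sigma>) f \<sigma>) Q"
  by (rule simI) (use simD[OF assms] in auto)

context machine
begin

definition temps :: "nat set" where "temps = {9, 10, 11, 12, 13, 15, 16, 17, 18, 19} \<union> scratch"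

definition sweep_cost :: nat where "sweep_cost = q * (2 * nbrs_cost (upd_cost n b) + 10) + 10"
definition scan_nbrs_cost :: nat where "scan_nbrs_cost = nbrs_cost (n * n * (mix_cost + 5) + 10)"
definition scan_cost :: nat where
  "scan_cost = n * (q * (free_cost n + 10) + 30) + n * (n * (adj_cost n + 20) + 30) + 20"
definition iter_cost :: nat where "iter_cost = scan_cost + sweep_cost + scan_nbrs_cost + 20"

text \<open>Since short lists have the indices below \<open>n\<close>, the lowest flaw is the first
  short list if there is one, and otherwise the first crowded vertex.\<close>

lemma iter_alt:
  "iter f \<sigma> = (if first (short_list \<sigma>) n 0 \<noteq> 0 then sweep_at (first (short_list \<sigma>) n 0 - 1) f \<sigma>
     else if first (crowded \<sigma>) n 0 \<noteq> 0 then scan_at (first (crowded \<sigma>) n 0 - 1) f \<sigma> else f \<sigma>)"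
proof -
  define SA where "SA = {v. v < n \<and> short_list \<sigma> v}"
  define SZ where "SZ = {v. v < n \<and> crowded \<sigma> v}"
  have fin: "finite SA" "finite SZ" by (auto simp: SA_def SZ_def)
  have fl: "flaws \<sigma> = SA \<union> (\<lambda>v. n + v) ` SZ" by (simp add: flaws_def SA_def SZ_def)
  show ?thesis
  proof (cases "SA = {}")
    case False
    then have mA: "Min SA \<in> SA" using fin by simp
    have "Min (flaws \<sigma>) = Min SA" unfolding fl
    proof (rule Min_eqI)
      fix y assume "y \<in> SA \<union> (\<lambda>v. n + v) ` SZ"
      then show "Min SA \<le> y" using fin mA by (auto simp: SA_def)
    qed (use fin mA in auto)
    moreover have "Min SA < n" using mA by (simp add: SA_def)
    moreover have "flaws \<sigma> \<noteq> {}" using False by (simp add: fl)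
    ultimately show ?thesis using False by (auto simp: iter_def repair_def first_0_eq SA_def)
  next
    case A: True
    show ?thesis
    proof (cases "SZ = {}")
      case False
      have "Min (flaws \<sigma>) = n + Min SZ" unfolding fl A using mono_Min_commute[of "\<lambda>v. n + v" SZ] fin False
        by (simp add: mono_def)
      moreover have "flaws \<sigma> \<noteq> {}" using False by (simp add: fl)
      ultimately show ?thesis using False A by (auto simp: iter_def repair_def first_0_eq SA_def SZ_def)
    next
      case True
      then show ?thesis using A fl by (simp add: iter_def first_0_eq SA_def SZ_def)
    qed
  qed
qed

lemma first_less: "first P n 0 = Suc v \<Longrightarrow> v < n"
  by (auto simp: first_0_eq split: if_splits) (use Min_in[of "{v. v < n \<and> P v}"] in auto)

lemma sim_iter:
  assumes F: "stable temps F"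
  shows "sim (framed F) (iter_com b) iter_cost iter (framed F)"
proof -
  define fA where "fA \<sigma> = first (short_list \<sigma>) n 0" for \<sigma>
  define fZ where "fZ \<sigma> = first (crowded \<sigma>) n 0" for \<sigma>
  define M1 where "M1 \<sigma> = framed (\<lambda>g. F g \<and> g 9 = fA \<sigma>) \<sigma>" for \<sigma>
  define M2 where "M2 \<sigma> = framed (\<lambda>g. (F g \<and> g 9 = fA \<sigma>) \<and> g 10 = fZ \<sigma>) \<sigma>" for \<sigma>
  have up: "F (g(11 := x)) = F g" for g x by (rule stable_upd[OF F]) (simp add: temps_def)
  have sub: "stable S F" if "S \<subseteq> temps" for S using F that by (rule stable_mono)
  have 1: "sim (framed F) (scan_com 9 count_free_com) (n * (q * (free_cost n + 10) + 20 + 10) + 10) (\<lambda>f. f) M1"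
    unfolding M1_def fA_def
    by (rule sim_id, rule hoare_scan, rule hoare_count_free)
       (auto intro!: sub elim!: stable_mono simp: temps_def scratch_def)
  have 2: "sim M1 (scan_com 10 count_blank_com) (n * (n * (adj_cost n + 20) + 20 + 10) + 10) (\<lambda>f. f) M2"
    unfolding M1_def M2_def fZ_def
  proof (rule sim_id, rule hoare_scan, rule hoare_count_blank)
    fix \<sigma>
    have "stable (temps - {9}) F" by (rule sub) auto
    then show "stable ({10, 11, 12, 13, 18, 19} \<union> scratch) (\<lambda>g. F g \<and> g 9 = fA \<sigma>)"
      unfolding stable_def by (auto simp: temps_def scratch_def)
  qed (auto elim!: stable_mono simp: temps_def scratch_def)
  have 3: "sim (\<lambda>\<sigma> s. (M2 \<sigma> s \<and> regs s 9 \<noteq> 0) \<and> fA \<sigma> - 1 = v) (Sub 11 9 31 ;; sweep_com b) (sweep_cost + 2) (sweep_at v) (framed F)" for v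
  proof (cases "v < n")
    case True
    have a: "sim (\<lambda>\<sigma> s. (M2 \<sigma> s \<and> regs s 9 \<noteq> 0) \<and> fA \<sigma> - 1 = v) (Sub 11 9 31) 1 (\<lambda>f. f) (framed (\<lambda>g. F g \<and> g 11 = v))"
      by (rule sim_id, rule hoare_pre[OF hoare_basic(4)]) (auto simp: M2_def framed_def up envD(1))
    have c: "sim (framed (\<lambda>g. F g \<and> g 11 = v)) (sweep_com b) sweep_cost (sweep_at v) (framed (\<lambda>g. F g \<and> g 11 = v))"
      unfolding sweep_cost_def by (rule sim_sweep[OF _ _ True]) (use F in \<open>auto simp: stable_def temps_def scratch_def\<close>)
    show ?thesis by (rule sim_weaken[OF sim_seq[OF a c]]) (auto simp: framed_def)
  next
    case False
    then have "\<not> ((M2 \<sigma> s \<and> regs s 9 \<noteq> 0) \<and> fA \<sigma> - 1 = v)" for \<sigma> s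
      using first_less[of "short_list \<sigma>" "fA \<sigma> - 1"] by (auto simp: M2_def framed_def fA_def)
    then show ?thesis unfolding sim_def by blast
  qed
  have 4: "sim (\<lambda>\<sigma> s. ((M2 \<sigma> s \<and> regs s 9 = 0) \<and> regs s 10 \<noteq> 0) \<and> fZ \<sigma> - 1 = v) (Sub 11 10 31 ;; scan_nbrs_com b) (scan_nbrs_cost + 2) (scan_at v) (framed F)" for v
  proof (cases "v < n")
    case True
    have a: "sim (\<lambda>\<sigma> s. ((M2 \<sigma> s \<and> regs s 9 = 0) \<and> regs s 10 \<noteq> 0) \<and> fZ \<sigma> - 1 = v) (Sub 11 10 31) 1 (\<lambda>f. f) (framed (\<lambda>g. F g \<and> g 11 = v))"
      by (rule sim_id, rule hoare_pre[OF hoare_basic(4)]) (auto simp: M2_def framed_def up envD(1))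
    have c: "sim (framed (\<lambda>g. F g \<and> g 11 = v)) (scan_nbrs_com b) scan_nbrs_cost (scan_at v) (framed (\<lambda>g. F g \<and> g 11 = v))"
      unfolding scan_nbrs_cost_def by (rule sim_scan_nbrs[OF _ _ True]) (use F in \<open>auto simp: stable_def temps_def scratch_def\<close>)
    show ?thesis by (rule sim_weaken[OF sim_seq[OF a c]]) (auto simp: framed_def)
  next
    case False
    then have "\<not> (((M2 \<sigma> s \<and> regs s 9 = 0) \<and> regs s 10 \<noteq> 0) \<and> fZ \<sigma> - 1 = v)" for \<sigma> s
      using first_less[of "crowded \<sigma>" "fZ \<sigma> - 1"] by (auto simp: M2_def framed_def fZ_def)
    then show ?thesis unfolding sim_def by blast
  qed
  have 5: "sim (\<lambda>\<sigma> s. (M2 \<sigma> s \<and> regs s 9 = 0) \<and> regs s 10 = 0) Skip 1 (\<lambda>f. f) (framed F)"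
    by (rule sim_id, rule hoare_pre[OF hoare_basic(1)]) (auto simp: M2_def framed_def)
  have 6: "sim M2 (Cond 9 (Sub 11 9 31 ;; sweep_com b) (Cond 10 (Sub 11 10 31 ;; scan_nbrs_com b) Skip))
      (max (sweep_cost + 2) (max (scan_nbrs_cost + 2) 1 + 1) + 1)
      (\<lambda>f \<sigma>. if fA \<sigma> \<noteq> 0 then sweep_at (fA \<sigma> - 1) f \<sigma> else if fZ \<sigma> \<noteq> 0 then scan_at (fZ \<sigma> - 1) f \<sigma> else f \<sigma>) (framed F)"
    by (intro sim_cond sim_param[OF 3] sim_param[OF 4] 5) (auto simp: M2_def framed_def)
  show ?thesis unfolding iter_com_def
    by (rule sim_weaken[OF sim_seq[OF 1 sim_seq[OF 2 6]]])
       (auto simp: iter_cost_def scan_cost_def iter_alt fA_def fZ_def add.assoc)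
qed

lemma sim_main: "sim env (main_com b) (n * n * (iter_cost + 5) + 10) (iter ^^ (n * n)) env"
proof -
  define I where "I j \<sigma> s \<longleftrightarrow> framed (\<lambda>g. g 8 = j) \<sigma> s" for j :: nat and \<sigma> s
  have loop: "sim (I (n * n)) (While 8 (Sub 8 8 31 ;; iter_com b)) (n * n * ((iter_cost + 3) + 1) + 1) (downto (\<lambda>_. iter) (n * n)) (I 0)"
  proof (rule sim_while)
    fix j
    have 0: "sim (I (Suc j)) (Sub 8 8 31) 1 (\<lambda>f. f) (I j)"
      by (rule sim_id, rule hoare_pre[OF hoare_basic(4)]) (auto simp: I_def framed_def envD(1))
    have 1: "sim (I j) (iter_com b) iter_cost iter (I j)"
      unfolding I_def by (rule sim_iter) (auto simp: stable_def temps_def scratch_def)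
    show "sim (I (Suc j)) (Sub 8 8 31 ;; iter_com b) (iter_cost + 3) iter (I j)"
      by (rule sim_weaken[OF sim_seq[OF 0 1]]) auto
  qed (auto simp: I_def framed_def)
  have init: "sim env (Add 8 3 2) 1 (\<lambda>f. f) (I (n * n))"
    by (rule sim_id, rule hoare_pre[OF hoare_basic(3)]) (auto simp: I_def framed_def envD(1))
  show ?thesis unfolding main_com_def
    by (rule sim_weaken[OF sim_seq[OF init loop]]) (auto simp: I_def framed_def algebra_simps downto_funpow)
qed

text \<open>Filled-in colours lie above \<open>q\<close>, so they can conflict only with other
  filled-in vertices, all of which were blank in \<open>\<sigma>\<close>.\<close>

definition extends :: "pcol \<Rightarrow> pcol \<Rightarrow> bool" where
  "extends \<sigma> \<tau> \<longleftrightarrow> (\<forall>v. \<sigma> v \<noteq> 0 \<longrightarrow> \<tau> v = \<sigma> v) \<and> (\<forall>v. \<sigma> v = 0 \<longrightarrow> \<tau> v = 0 \<or> \<tau> v \<in> {q + 1..q + r + 1}) \<and>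
     (\<forall>u v. adj u v \<longrightarrow> \<tau> u = \<tau> v \<longrightarrow> \<tau> u = 0)"

lemma extendsD:
  "extends \<sigma> \<tau> \<Longrightarrow> \<sigma> v \<noteq> 0 \<Longrightarrow> \<tau> v = \<sigma> v"
  "extends \<sigma> \<tau> \<Longrightarrow> \<sigma> v = 0 \<Longrightarrow> \<tau> v = 0 \<or> \<tau> v \<in> {q + 1..q + r + 1}"
  "extends \<sigma> \<tau> \<Longrightarrow> adj u v \<Longrightarrow> \<tau> u = \<tau> v \<Longrightarrow> \<tau> u = 0"
  unfolding extends_def by blast+

text \<open>At most \<open>r\<close> neighbours were blank, and only those can carry one of the
  \<open>r + 1\<close> extra colours.\<close>

lemma extends_free:
  assumes "\<sigma> \<in> \<Omega>" "flaws \<sigma> = {}" "extends \<sigma> \<tau>" "v < n"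
  shows "\<exists>x\<in>{q + 1..q + r + 1}. free \<tau> v x"
proof (rule ccontr)
  assume "\<not> ?thesis"
  then have *: "\<exists>w. adj v w \<and> \<tau> w = x" if "x \<in> {q + 1..q + r + 1}" for x using that by (auto simp: free_def)
  have "{q + 1..q + r + 1} \<subseteq> \<tau> ` {u\<in>nb v. \<sigma> u = 0}"
  proof
    fix x assume x: "x \<in> {q + 1..q + r + 1}"
    obtain w where w: "adj v w" "\<tau> w = x" using *[OF x] by blast
    have "\<sigma> w \<le> q" using assms(1) by (simp add: \<Omega>_def)
    then have "\<sigma> w = 0" using extendsD(1)[OF assms(3), of w] w x by fastforce
    then show "x \<in> \<tau> ` {u\<in>nb v. \<sigma> u = 0}" using w by (auto simp: nb_def)
  qed
  then have "card {q + 1..q + r + 1} \<le> card (\<tau> ` {u\<in>nb v. \<sigma> u = 0})" by (intro card_mono) auto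
  also have "\<dots> \<le> card {u\<in>nb v. \<sigma> u = 0}" by (rule card_image_le) auto
  also have "\<dots> \<le> r" using assms(2,4) by (force simp: flaws_def crowded_def)
  finally show False by simp
qed

lemma extends_step:
  assumes "extends \<sigma> \<tau>" "free \<tau> v x" "x \<in> {q + 1..q + r + 1}" "\<tau> v = 0"
  shows "extends \<sigma> (\<tau>(v := x))"
proof -
  have "\<sigma> v = 0" using assms(1,4) by (metis extends_def)
  then show ?thesis using assms adj_sym unfolding extends_def free_def by (auto simp: adj_irrefl)
qed

lemma extends_refl: "\<sigma> \<in> \<Omega> \<Longrightarrow> extends \<sigma> \<sigma>" by (auto simp: extends_def \<Omega>_def)

definition complete :: "pcol \<Rightarrow> bool" where
  "complete \<tau> \<longleftrightarrow> (\<forall>u v. adj u v \<longrightarrow> \<tau> u \<noteq> \<tau> v) \<and> (\<forall>v<n. \<tau> v \<in> {1..q + r + 1})"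

lemma extends_complete:
  assumes "\<sigma> \<in> \<Omega>" "extends \<sigma> \<tau>" "\<And>v. v < n \<Longrightarrow> \<tau> v \<noteq> 0" shows "complete \<tau>"
proof -
  have "\<tau> u \<noteq> \<tau> v" if "adj u v" for u v
    using extendsD(3)[OF assms(2) that] assms(3)[OF adj_lt[OF that]] by metis
  moreover have "\<tau> v \<in> {1..q + r + 1}" if "v < n" for v
  proof (cases "\<sigma> v = 0")
    case True
    then show ?thesis using extendsD(2)[OF assms(2) True] assms(3)[OF that] by auto
  next
    case False
    moreover have "\<sigma> v \<le> q" using assms(1) by (simp add: \<Omega>_def)
    ultimately show ?thesis using extendsD(1)[OF assms(2) False] by simp
  qed
  ultimately show ?thesis by (simp add: complete_def)
qed

lemma exists_complete:
  assumes "\<sigma> \<in> \<Omega>" "flaws \<sigma> = {}" shows "\<exists>\<tau>. complete \<tau>"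
proof -
  have "\<exists>\<tau>. extends \<sigma> \<tau> \<and> (\<forall>v<j. \<tau> v \<noteq> 0)" if "j \<le> n" for j
    using that
  proof (induction j)
    case 0
    then show ?case using extends_refl[OF assms(1)] by auto
  next
    case (Suc j)
    then obtain \<tau> where t: "extends \<sigma> \<tau>" "\<forall>v<j. \<tau> v \<noteq> 0" by auto
    show ?case
    proof (cases "\<tau> j = 0")
      case True
      obtain x where x: "x \<in> {q + 1..q + r + 1}" "free \<tau> j x"
        using extends_free[OF assms t(1), of j] Suc.prems by auto
      have "\<forall>v<Suc j. (\<tau>(j := x)) v \<noteq> 0" using t(2) x by (auto simp: less_Suc_eq)
      then show ?thesis using extends_step[OF t(1) x(2,1) True] by blast
    next
      case False
      then show ?thesis using t by (auto simp: less_Suc_eq)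
    qed
  qed
  then obtain \<tau> where "extends \<sigma> \<tau>" "\<forall>v<n. \<tau> v \<noteq> 0" by blast
  then show ?thesis using extends_complete[OF assms(1), of \<tau>] by blast
qed

end

context machine
begin

lemma hoare_pick:
  assumes ex: "\<exists>x\<in>{q + 1..q + r + 1}. free \<sigma> v x" and v: "v < n"
  shows "hoare (\<lambda>s. env \<sigma> s \<and> regs s 11 = v \<and> regs s 27 = a) pick_com ((r + 1) * (free_cost n + 10) + 10)
     (\<lambda>s. env \<sigma> s \<and> regs s 11 = v \<and> regs s 27 = a \<and> regs s 14 \<in> {q + 1..q + r + 1} \<and> free \<sigma> v (regs s 14))"
proof -
  define I where "I j s \<longleftrightarrow> env \<sigma> s \<and> regs s 11 = v \<and> regs s 27 = a \<and> j \<le> r + 1 \<and> regs s 16 = j \<and>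
     (regs s 14 \<in> {q + 1..q + r + 1} \<and> free \<sigma> v (regs s 14) \<or> (\<forall>x\<in>{q + j + 1..q + r + 1}. \<not> free \<sigma> v x))" for j s
  have A: "(11::nat) \<notin> {20,21,22,23,24,25,26}" "(12::nat) \<notin> {20,21,22,23,24,25,26}" by auto
  have loop: "hoare (I (r + 1)) (While 16 (Add 12 4 16 ;; free_com 11 12 ;; Cond 22 (Add 14 12 2) Skip ;; Sub 16 16 31))
     ((r + 1) * ((free_cost n + 8) + 1) + 1) (I 0)"
  proof (rule hoare_while)
    fix j assume j: "j < r + 1"
    have 1: "hoare (I (Suc j)) (Add 12 4 16) 1 (\<lambda>s. I (Suc j) s \<and> regs s 12 = q + Suc j)"
      by (rule hoare_pre[OF hoare_basic(3)]) (auto simp: I_def envD(1))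
    have 2: "hoare (\<lambda>s. I (Suc j) s \<and> regs s 12 = q + Suc j) (free_com 11 12) (free_cost n)
       (\<lambda>s. (I (Suc j) s \<and> regs s 12 = q + Suc j) \<and> regs s 22 = of_bool (free \<sigma> v (q + Suc j)))"
    proof (rule hoare_specD[OF hoare_free_com[OF A]])
      fix s assume s: "I (Suc j) s \<and> regs s 12 = q + Suc j"
      then show "\<exists>\<sigma>. env \<sigma> s \<and> regs s 11 < n" using v by (auto simp: I_def)
      fix s' assume p: "agree {20,21,22,23,24,25,26} s s' \<and> (\<forall>\<sigma>. env \<sigma> s \<longrightarrow> regs s' 22 = of_bool (free \<sigma> (regs s 11) (regs s 12)))"
      have "env \<sigma> s'" by (rule env_agree[OF _ conjunct1[OF p]]) (use s in \<open>auto simp: I_def\<close>)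
      then show "(I (Suc j) s' \<and> regs s' 12 = q + Suc j) \<and> regs s' 22 = of_bool (free \<sigma> v (q + Suc j))"
        using p s by (auto simp: I_def agree_def)
    qed
    have 3: "hoare (\<lambda>s. (I (Suc j) s \<and> regs s 12 = q + Suc j) \<and> regs s 22 = of_bool (free \<sigma> v (q + Suc j)))
        (Cond 22 (Add 14 12 2) Skip ;; Sub 16 16 31) 5 (I j)"
    proof (rule hoare_pre, (rule hoare_seq hoare_cond hoare_basic)+, goal_cases)
      case (1 s)
      have "\<forall>x\<in>{q + j + 1..q + r + 1}. \<not> free \<sigma> v x"
        if "\<not> free \<sigma> v (q + Suc j)" "\<forall>x\<in>{q + Suc j + 1..q + r + 1}. \<not> free \<sigma> v x"
      proof
        fix x assume "x \<in> {q + j + 1..q + r + 1}"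
        then have "x = q + Suc j \<or> x \<in> {q + Suc j + 1..q + r + 1}" by auto
        then show "\<not> free \<sigma> v x" using that by auto
      qed
      then show ?case using 1 j unfolding I_def by (auto simp: envD(1))
    qed auto
    show "hoare (I (Suc j)) (Add 12 4 16 ;; free_com 11 12 ;; Cond 22 (Add 14 12 2) Skip ;; Sub 16 16 31) (free_cost n + 8) (I j)"
      by (rule hoare_pre[OF hoare_seq[OF hoare_seq[OF 3 2] 1]]) auto
  qed (auto simp: I_def)
  have init: "hoare (\<lambda>s. env \<sigma> s \<and> regs s 11 = v \<and> regs s 27 = a) (Const 14 0 ;; Add 16 5 31) 3 (I (r + 1))"
    by (rule hoare_pre, (rule hoare_seq hoare_basic)+) (auto simp: I_def envD(1))
  show ?thesis unfolding pick_com_def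
    by (rule hoare_pre[OF hoare_post[OF hoare_seq[OF loop init]]]) (use ex in \<open>auto simp: I_def algebra_simps\<close>)
qed

definition greedy_cost :: nat where "greedy_cost = n * ((r + 1) * (free_cost n + 10) + 40) + 10"

lemma hoare_greedy:
  assumes \<sigma>: "\<sigma> \<in> \<Omega>" "flaws \<sigma> = {}"
  shows "hoare (env \<sigma>) greedy_com greedy_cost (\<lambda>s. \<exists>\<tau>. env \<tau> s \<and> complete \<tau>)"
proof -
  define I where "I j s \<longleftrightarrow> (\<exists>\<tau>. env \<tau> s \<and> extends \<sigma> \<tau> \<and> regs s 11 = j \<and> j \<le> n \<and> (\<forall>v. j \<le> v \<longrightarrow> v < n \<longrightarrow> \<tau> v \<noteq> 0))" for j s
  have loop: "hoare (I n) (While 11 (Sub 11 11 31 ;; (Add 27 3 11 ;; Load 28 27) ;; Cond 28 Skip (pick_com ;; Store 27 14)))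
     (n * (((r + 1) * (free_cost n + 10) + 25) + 1) + 1) (I 0)"
  proof (rule hoare_while)
    fix j assume j: "j < n"
    define J where "J \<tau> s \<longleftrightarrow> env \<tau> s \<and> extends \<sigma> \<tau> \<and> regs s 11 = j \<and> (\<forall>v. Suc j \<le> v \<longrightarrow> v < n \<longrightarrow> \<tau> v \<noteq> 0)" for \<tau> s
    have 1: "hoare (I (Suc j)) (Sub 11 11 31) 1 (\<lambda>s. \<exists>\<tau>. J \<tau> s)"
      by (rule hoare_pre[OF hoare_basic(4)]) (auto simp: I_def J_def envD(1))
    have 2: "hoare (\<lambda>s. \<exists>\<tau>. J \<tau> s) (Add 27 3 11 ;; Load 28 27) 3
       (\<lambda>s. \<exists>\<tau>. J \<tau> s \<and> regs s 27 = n * n + j \<and> regs s 28 = \<tau> j)"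
      by (rule hoare_pre, (rule hoare_seq hoare_basic)+) (use j in \<open>auto simp: J_def envD\<close>)
    have le: "I j s" if "J \<tau> s" "\<tau> j \<noteq> 0" for \<tau> s
      using that j unfolding I_def J_def by (metis Suc_leI le_neq_implies_less less_imp_le_nat)
    have 3: "hoare (\<lambda>s. \<exists>\<tau>. J \<tau> s \<and> regs s 27 = n * n + j \<and> regs s 28 = \<tau> j \<and> \<tau> j = 0) (pick_com ;; Store 27 14)
       ((r + 1) * (free_cost n + 10) + 12) (I j)"
    proof (rule hoareI)
      fix X K t a s
      assume s: "\<exists>\<tau>. J \<tau> s \<and> regs s 27 = n * n + j \<and> regs s 28 = \<tau> j \<and> \<tau> j = 0"
        and Q: "\<And>s'. I j s' \<Longrightarrow> a \<le> success X t (K, s')"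
      obtain \<tau> where t: "J \<tau> s" "regs s 27 = n * n + j" "\<tau> j = 0" using s by blast
      have ext: "extends \<sigma> \<tau>" using t(1) by (simp add: J_def)
      have f: "hoare (\<lambda>s. env \<tau> s \<and> regs s 11 = j \<and> regs s 27 = n * n + j \<and> regs s 14 \<in> {q + 1..q + r + 1} \<and> free \<tau> j (regs s 14))
        (Store 27 14) 1 (I j)"
      proof (rule hoare_pre[OF hoare_basic(7)])
        fix s assume h: "env \<tau> s \<and> regs s 11 = j \<and> regs s 27 = n * n + j \<and> regs s 14 \<in> {q + 1..q + r + 1} \<and> free \<tau> j (regs s 14)"
        have "J (\<tau>(j := regs s 14)) (s\<lparr>mem := (mem s)(n * n + j := regs s 14)\<rparr>)"
          using h j env_store[of \<tau> s j "regs s 14"] extends_step[OF ext, of j "regs s 14"] t(1,3) by (auto simp: J_def)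
        moreover have "(\<tau>(j := regs s 14)) j \<noteq> 0" using h by auto
        ultimately show "I j (s\<lparr>mem := (mem s)(regs s 27 := regs s 14)\<rparr>)" using h le by metis
      qed simp
      note pk = hoare_pick[OF extends_free[OF \<sigma> ext j] j, where a = "n * n + j"]
      have "a \<le> success X (t + ((r + 1) * (free_cost n + 10) + 10 + 1 + 1)) ((pick_com ;; Store 27 14) # K, s)"
        by (rule hoareD[OF hoare_seq[OF f pk] _ Q]) (use t in \<open>auto simp: J_def\<close>)
      then show "a \<le> success X (t + ((r + 1) * (free_cost n + 10) + 12)) ((pick_com ;; Store 27 14) # K, s)" by simp
    qed
    have 4: "hoare (\<lambda>s. \<exists>\<tau>. J \<tau> s \<and> regs s 27 = n * n + j \<and> regs s 28 = \<tau> j) (Cond 28 Skip (pick_com ;; Store 27 14))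
       ((r + 1) * (free_cost n + 10) + 15) (I j)"
      by (rule hoare_pre, rule hoare_cond, rule hoare_basic, rule 3) (auto intro: le)
    show "hoare (I (Suc j)) (Sub 11 11 31 ;; (Add 27 3 11 ;; Load 28 27) ;; Cond 28 Skip (pick_com ;; Store 27 14))
       ((r + 1) * (free_cost n + 10) + 25) (I j)"
      by (rule hoare_pre[OF hoare_seq[OF hoare_seq[OF 4 2] 1]]) auto
  qed (auto simp: I_def)
  have init: "hoare (env \<sigma>) (Add 11 0 2) 1 (I n)"
    by (rule hoare_pre[OF hoare_basic(3)]) (use extends_refl[OF \<sigma>(1)] in \<open>auto simp: I_def envD(1)\<close>)
  show ?thesis unfolding greedy_com_def
    by (rule hoare_pre[OF hoare_post[OF hoare_seq[OF loop init]]])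
       (use extends_complete[OF \<sigma>(1)] in \<open>auto simp: I_def greedy_cost_def algebra_simps\<close>)
qed

text \<open>Copying overwrites the adjacency matrix, so the invariant retains only the constants and
  the stored colours; these lie beyond the cells written because
  \<open>n \<le> n * n\<close>.\<close>

lemma hoare_copy:
  "hoare (env \<tau>) copy_com (n * 10 + 10) (\<lambda>s. \<forall>v<n. mem s v = \<tau> v)"
proof -
  define I where "I j s \<longleftrightarrow> consts_ok s \<and> (\<forall>v<n. mem s (n * n + v) = \<tau> v) \<and> j \<le> n \<and> regs s 11 = j \<and>
     (\<forall>v. j \<le> v \<longrightarrow> v < n \<longrightarrow> mem s v = \<tau> v)" for j s
  have c: "consts_ok (set_reg a x s) = consts_ok s" if "a \<notin> {0, 2, 3, 4, 5, 6, 7, 31}" for a x s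
    using that by (auto simp: consts_ok_def)
  have c2: "consts_ok (s\<lparr>mem := m\<rparr>) = consts_ok s" for s m by (auto simp: consts_ok_def)
  have c3: "consts_ok s \<Longrightarrow> regs s 31 = 1 \<and> regs s 3 = n * n \<and> regs s 0 = n \<and> regs s 2 = 0" for s by (simp add: consts_ok_def)
  have loop: "hoare (I n) (While 11 (Sub 11 11 31 ;; Add 27 3 11 ;; Load 28 27 ;; Store 11 28)) (n * (7 + 1) + 1) (I 0)"
  proof (rule hoare_while)
    fix j assume j: "j < n"
    have ne: "n * n + w \<noteq> j" for w using j le_square[of n] by linarith
    have up: "\<forall>v. j \<le> v \<longrightarrow> v < n \<longrightarrow> (m(j := \<tau> j)) v = \<tau> v" if "\<forall>v. Suc j \<le> v \<longrightarrow> v < n \<longrightarrow> m v = \<tau> v" for m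
      using that by auto
    show "hoare (I (Suc j)) (Sub 11 11 31 ;; Add 27 3 11 ;; Load 28 27 ;; Store 11 28) 7 (I j)"
    proof (rule hoare_pre, (rule hoare_seq hoare_basic)+, goal_cases)
      case (1 s)
      then have "regs s 31 = 1" "regs s 3 = n * n" "regs s 11 = Suc j" "mem s (n * n + j) = \<tau> j" "consts_ok s"
        "\<forall>v. Suc j \<le> v \<longrightarrow> v < n \<longrightarrow> mem s v = \<tau> v" "\<forall>v<n. mem s (n * n + v) = \<tau> v"
        using j c3 by (auto simp: I_def)
      then show ?case using j up[of "mem s"] by (simp add: I_def c c2 ne)
    qed simp
  qed (auto simp: I_def)
  have init: "hoare (env \<tau>) (Add 11 0 2) 1 (I n)"
    by (rule hoare_pre[OF hoare_basic(3)]) (auto simp: I_def env_def c c3)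
  show ?thesis unfolding copy_com_def
    by (rule hoare_pre[OF hoare_post[OF hoare_seq[OF loop init]]]) (auto simp: I_def)
qed

text \<open>All chance lies in the walk: from a flawless state the remaining program succeeds with
  certainty. Hence the probability of ending without flaws is a lower bound.\<close>

lemma success_main:
  assumes s: "env (\<lambda>_. 0) s" and X: "\<And>s \<tau>. complete \<tau> \<Longrightarrow> (\<And>v. v < n \<Longrightarrow> mem s v = \<tau> v) \<Longrightarrow> s \<in> X"
    and t: "n * n * (iter_cost + 5) + greedy_cost + n * 10 + 30 \<le> t"
  shows "(iter ^^ (n * n)) (\<lambda>\<sigma>. of_bool (flaws \<sigma> = {})) (\<lambda>_. 0) \<le> success X t ([main_com b ;; greedy_com ;; copy_com], s)"
proof -
  have "(\<lambda>_. 0) \<in> \<Omega>" by (simp add: \<Omega>_def)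
  \<comment> \<open>The greedy step needs a proper partial colouring, so membership in
    \<open>\<Omega>\<close>, which the walk never leaves, is added to the indicator.\<close>
  then have "(iter ^^ (n * n)) (\<lambda>\<sigma>. of_bool (flaws \<sigma> = {})) (\<lambda>_. 0)
     = (iter ^^ (n * n)) (\<lambda>\<sigma>. of_bool (\<sigma> \<in> \<Omega> \<and> flaws \<sigma> = {})) (\<lambda>_. 0)"
    by (intro markov_eq[OF markov_funpow[OF _ _ markov_iter]]) (auto intro!: reflpI transpI)
  also have "\<dots> \<le> success X ((greedy_cost + (n * 10 + 10) + 1) + (n * n * (iter_cost + 5) + 10)) (main_com b # [greedy_com ;; copy_com], s)"
  proof (rule simD[OF sim_main, of "\<lambda>_. 0"])
    fix \<sigma> s assume e: "env \<sigma> s"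
    show "of_bool (\<sigma> \<in> \<Omega> \<and> flaws \<sigma> = {}) \<le> success X (greedy_cost + (n * 10 + 10) + 1) ([greedy_com ;; copy_com], s)"
    proof (cases "\<sigma> \<in> \<Omega> \<and> flaws \<sigma> = {}")
      case True
      have c: "hoare (\<lambda>s. \<exists>\<tau>. env \<tau> s \<and> complete \<tau>) copy_com (n * 10 + 10) (\<lambda>s. s \<in> X)"
        by (rule hoareI) (use hoareD[OF hoare_copy] X in metis)
      have "1 \<le> success X (0 + (greedy_cost + (n * 10 + 10) + 1)) ([greedy_com ;; copy_com], s)"
        by (rule hoareD[OF hoare_seq[OF c hoare_greedy]]) (use True e in \<open>auto simp: success_halted\<close>)
      then show ?thesis using True by simp
    qed (auto simp: success_nonneg)
  qed (use s in auto)
  also have "\<dots> = success X (Suc ((greedy_cost + (n * 10 + 10) + 1) + (n * n * (iter_cost + 5) + 10))) ([main_com b ;; greedy_com ;; copy_com], s)"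
    by (simp only: success_step)
  also have "\<dots> \<le> success X t ([main_com b ;; greedy_com ;; copy_com], s)" by (rule success_mono) (use t in simp)
  finally show ?thesis .
qed

end

section \<open>Computing the parameters from the graph\<close>

definition square_com :: com where
  "square_com = (Const 3 0 ;; Add 11 0 2) ;; While 11 (Sub 11 11 31 ;; Add 3 3 0)"

definition degree_com :: com where
  "degree_com = (Const 18 0 ;; Add 13 0 2) ;; While 13 (Sub 13 13 31 ;; adj_com 11 13 ;; Add 18 18 20)"

text \<open>The maximum of two numbers is one of them plus the truncated difference to the
  other.\<close>

definition max_degree_com :: com where
  "max_degree_com = (Const 14 0 ;; Add 11 0 2) ;; While 11 (Sub 11 11 31 ;; degree_com ;; Sub 19 18 14 ;; Add 14 14 19)"

definition log_com :: com where
  "log_com = (Const 15 0 ;; Half 16 14) ;; While 16 (Add 15 15 31 ;; Half 16 16)"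

primrec scale_com :: "nat \<Rightarrow> nat \<Rightarrow> nat \<Rightarrow> com" where
  "scale_com d a 0 = Const d 0"
| "scale_com d a (Suc c) = scale_com d a c ;; Add d d a"

text \<open>Division by repeated subtraction. The \<open>+ 1\<close> before the truncated difference
  makes register \<open>18\<close> nonzero exactly while the divisor still fits.\<close>

definition div_com :: com where
  "div_com = (Const 5 0 ;; Add 18 14 31 ;; Sub 18 18 17) ;;
     While 18 (Sub 14 14 17 ;; Add 5 5 31 ;; Add 18 14 31 ;; Sub 18 18 17)"

text \<open>Stops at the least power of two exceeding \<open>n\<close>, when the truncated
  difference of \<open>n + 1\<close> and that power vanishes.\<close>

definition pow2_com :: com where
  "pow2_com = (Const 7 1 ;; Add 18 0 31 ;; Sub 18 18 7) ;; While 18 (Add 7 7 7 ;; Add 18 0 31 ;; Sub 18 18 7)"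

text \<open>\<open>q\<close> and \<open>r\<close> are multiples of \<open>\<Delta> div (J * \<lfloor>log\<^sub>2 \<Delta>\<rfloor>)\<close>, and \<open>l\<close> is a multiple of
  \<open>\<lfloor>log\<^sub>2 \<Delta>\<rfloor>\<close>, so that no logarithm has to be approximated more finely.\<close>

definition init_com :: "nat \<Rightarrow> nat \<Rightarrow> nat \<Rightarrow> com" where
  "init_com J c1 c3 = Const 31 1 ;; square_com ;; max_degree_com ;; log_com ;; scale_com 17 15 J ;; scale_com 6 15 c3 ;;
     div_com ;; scale_com 4 5 c1 ;; pow2_com"

context graph_on
begin

definition maxdeg :: "nat \<Rightarrow> nat" where
  "maxdeg j = Max (insert 0 ((\<lambda>v. card (nb v)) ` {j..<n}))"

lemma maxdeg_step: "j < n \<Longrightarrow> maxdeg j = max (card (nb j)) (maxdeg (Suc j))"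
proof -
  assume "j < n"
  then have "{j..<n} = insert j {Suc j..<n}" by auto
  then have "insert 0 ((\<lambda>v. card (nb v)) ` {j..<n}) = insert (card (nb j)) (insert 0 ((\<lambda>v. card (nb v)) ` {Suc j..<n}))"
    by auto
  then show ?thesis unfolding maxdeg_def by (metis Max_insert finite_atLeastLessThan finite_imageI finite_insert insert_not_empty)
qed

lemma maxdeg_n: "maxdeg n = 0" by (simp add: maxdeg_def)

lemma card_nb_le: "card (nb v) \<le> n"
  using card_mono[OF _ nb_subset[of v]] by simp

lemma maxdeg_le: "maxdeg j \<le> n"
  unfolding maxdeg_def by (auto simp: card_nb_le)

lemma card_nb_maxdeg: "card (nb v) \<le> maxdeg 0"
proof (cases "v < n")
  case True
  then show ?thesis unfolding maxdeg_def by (intro Max_ge) auto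
next
  case False
  then have "nb v = {}" using adj_lt by (auto simp: nb_def)
  then show ?thesis by simp
qed

definition base :: "(nat \<Rightarrow> nat) \<Rightarrow> ((nat \<Rightarrow> nat) \<Rightarrow> bool) \<Rightarrow> state \<Rightarrow> bool" where
  "base m F s \<longleftrightarrow> regs s 0 = n \<and> regs s 2 = 0 \<and> regs s 31 = 1 \<and> mem s = m \<and> F (regs s)"

lemma hoare_square:
  assumes F: "stable {3, 11} F"
  shows "hoare (base m F) square_com (n * 5 + 10) (base m (\<lambda>g. F g \<and> g 3 = n * n))"
proof -
  define I where "I j s \<longleftrightarrow> base m (\<lambda>g. F g \<and> g 11 = j \<and> g 3 = (n - j) * n) s \<and> j \<le> n" for j s
  have up: "F (g(3 := x)) = F g" "F (g(11 := x)) = F g" for g x by (rule stable_upd[OF F]; simp)+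
  have loop: "hoare (I n) (While 11 (Sub 11 11 31 ;; Add 3 3 0)) (n * (3 + 1) + 1) (I 0)"
  proof (rule hoare_while)
    fix j assume j: "j < n"
    have "n - j = Suc (n - Suc j)" using j by simp
    then have e: "(n - j) * n = (n - Suc j) * n + n" by simp
    show "hoare (I (Suc j)) (Sub 11 11 31 ;; Add 3 3 0) 3 (I j)"
      by (rule hoare_pre, (rule hoare_seq hoare_basic)+) (use j in \<open>auto simp: I_def base_def up e\<close>)
  qed (auto simp: I_def base_def)
  have init: "hoare (base m F) (Const 3 0 ;; Add 11 0 2) 3 (I n)"
    by (rule hoare_pre, (rule hoare_seq hoare_basic)+) (auto simp: I_def base_def up)
  show ?thesis unfolding square_com_def
    by (rule hoare_pre[OF hoare_post[OF hoare_seq[OF loop init]]]) (auto simp: I_def base_def)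
qed

lemma hoare_degree:
  assumes F: "stable {13, 18, 20, 21} F" "\<And>g. F g \<Longrightarrow> g 11 = v" and v: "v < n"
    and m: "\<And>u v. u < n \<Longrightarrow> v < n \<Longrightarrow> m (u * n + v) = of_bool (adj u v)"
  shows "hoare (base m F) degree_com (n * (adj_cost n + 10) + 10) (base m (\<lambda>g. F g \<and> g 18 = card (nb v)))"
proof -
  define cnt where "cnt j = card {u\<in>nb v. j \<le> u}" for j
  define I where "I j s \<longleftrightarrow> base m (\<lambda>g. F g \<and> g 13 = j \<and> g 18 = cnt j) s \<and> j \<le> n" for j s
  have up: "F (g(13 := x)) = F g" "F (g(18 := x)) = F g" for g x by (rule stable_upd[OF F(1)]; simp)+
  have A: "(11::nat) \<notin> {20,21}" "(13::nat) \<notin> {20,21}" by auto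
  have loop: "hoare (I n) (While 13 (Sub 13 13 31 ;; adj_com 11 13 ;; Add 18 18 20)) (n * ((adj_cost n + 5) + 1) + 1) (I 0)"
  proof (rule hoare_while)
    fix j assume j: "j < n"
    define J where "J s \<longleftrightarrow> base m (\<lambda>g. F g \<and> g 13 = j \<and> g 18 = cnt (Suc j)) s" for s
    have 1: "hoare (I (Suc j)) (Sub 13 13 31) 1 J"
      by (rule hoare_pre[OF hoare_basic(4)]) (auto simp: I_def J_def base_def up)
    have 2: "hoare J (adj_com 11 13) (adj_cost n) (\<lambda>s. J s \<and> regs s 20 = of_bool (adj v j))"
    proof (rule hoare_specD[OF hoare_adj_com[OF A, where N = n]])
      fix s assume s: "J s"
      then have e: "regs s 11 = v" using F(2) by (auto simp: J_def base_def)
      then show "regs s 31 = 1 \<and> regs s 2 = 0 \<and> regs s 11 \<le> n" using v s by (auto simp: J_def base_def)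
      fix s' assume p: "agree {20,21} s s' \<and> regs s' 20 = mem s (regs s 11 * regs s 0 + regs s 13)"
      have "F (regs s')" using F(1) s p unfolding stable_def J_def base_def agree_def by auto
      then show "J s' \<and> regs s' 20 = of_bool (adj v j)"
        using p e s m[OF v j] by (auto simp: J_def base_def agree_def)
    qed
    have "{u\<in>nb v. j \<le> u} = (if adj v j then insert j {u\<in>nb v. Suc j \<le> u} else {u\<in>nb v. Suc j \<le> u})"
      by (auto simp: Suc_le_eq order.order_iff_strict nb_def)
    then have cd: "cnt j = cnt (Suc j) + of_bool (adj v j)" by (simp add: cnt_def)
    have 3: "hoare (\<lambda>s. J s \<and> regs s 20 = of_bool (adj v j)) (Add 18 18 20) 1 (I j)"
      by (rule hoare_pre[OF hoare_basic(3)]) (use j in \<open>auto simp: I_def J_def base_def up cd\<close>)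
    show "hoare (I (Suc j)) (Sub 13 13 31 ;; adj_com 11 13 ;; Add 18 18 20) (adj_cost n + 5) (I j)"
      by (rule hoare_pre[OF hoare_seq[OF hoare_seq[OF 3 2] 1]]) auto
  qed (auto simp: I_def base_def)
  have "{u\<in>nb v. n \<le> u} = {}" using nb_subset by force
  then have c: "cnt n = 0" "cnt 0 = card (nb v)" by (simp_all add: cnt_def)
  have init: "hoare (base m F) (Const 18 0 ;; Add 13 0 2) 3 (I n)"
    by (rule hoare_pre, (rule hoare_seq hoare_basic)+) (auto simp: I_def base_def up c)
  show ?thesis unfolding degree_com_def
    by (rule hoare_pre[OF hoare_post[OF hoare_seq[OF loop init]]]) (auto simp: I_def base_def c algebra_simps)
qed

lemma hoare_max_degree:
  assumes F: "stable {11, 13, 14, 18, 19, 20, 21} F"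
    and m: "\<And>u v. u < n \<Longrightarrow> v < n \<Longrightarrow> m (u * n + v) = of_bool (adj u v)"
  shows "hoare (base m F) max_degree_com (n * (n * (adj_cost n + 10) + 30) + 10) (base m (\<lambda>g. F g \<and> g 14 = maxdeg 0))"
proof -
  define I where "I j s \<longleftrightarrow> base m (\<lambda>g. F g \<and> g 11 = j \<and> g 14 = maxdeg j) s \<and> j \<le> n" for j s
  have up: "F (g(11 := x)) = F g" "F (g(14 := x)) = F g" "F (g(19 := x)) = F g" for g x by (rule stable_upd[OF F]; simp)+
  have loop: "hoare (I n) (While 11 (Sub 11 11 31 ;; degree_com ;; Sub 19 18 14 ;; Add 14 14 19))
      (n * ((n * (adj_cost n + 10) + 20) + 1) + 1) (I 0)"
  proof (rule hoare_while)
    fix j assume j: "j < n"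
    define G where "G g \<longleftrightarrow> F g \<and> g 11 = j \<and> g 14 = maxdeg (Suc j)" for g
    have 1: "hoare (I (Suc j)) (Sub 11 11 31) 1 (base m G)"
      by (rule hoare_pre[OF hoare_basic(4)]) (auto simp: I_def G_def base_def up)
    have 2: "hoare (base m G) degree_com (n * (adj_cost n + 10) + 10) (base m (\<lambda>g. G g \<and> g 18 = card (nb j)))"
      by (rule hoare_degree[OF _ _ j m]) (use F in \<open>auto simp: G_def stable_def\<close>)
    have 3: "hoare (base m (\<lambda>g. G g \<and> g 18 = card (nb j))) (Sub 19 18 14 ;; Add 14 14 19) 3 (I j)"
      by (rule hoare_pre, (rule hoare_seq hoare_basic)+)
         (use j in \<open>auto simp: I_def G_def base_def up maxdeg_step\<close>)
    show "hoare (I (Suc j)) (Sub 11 11 31 ;; degree_com ;; Sub 19 18 14 ;; Add 14 14 19) (n * (adj_cost n + 10) + 20) (I j)"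
      by (rule hoare_pre[OF hoare_seq[OF hoare_seq[OF 3 2] 1]]) auto
  qed (auto simp: I_def base_def)
  have init: "hoare (base m F) (Const 14 0 ;; Add 11 0 2) 3 (I n)"
    by (rule hoare_pre, (rule hoare_seq hoare_basic)+) (auto simp: I_def base_def up maxdeg_n)
  show ?thesis unfolding max_degree_com_def
    by (rule hoare_pre[OF hoare_post[OF hoare_seq[OF loop init]]]) (auto simp: I_def base_def algebra_simps)
qed

lemma floor_log_le: "floor_log k \<le> k"
  by (induction k rule: floor_log.induct) (subst floor_log.simps, auto)

lemma hoare_log:
  assumes F: "stable {15, 16} F" "\<And>g. F g \<Longrightarrow> g 14 = D"
  shows "hoare (base m F) log_com (D * 5 + 10) (base m (\<lambda>g. F g \<and> g 15 = floor_log D))"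
proof -
  define k where "k = floor_log D"
  define I where "I j s \<longleftrightarrow> base m (\<lambda>g. F g \<and> g 15 = k - j \<and> g 16 = D div 2 ^ (k - j + 1)) s \<and> j \<le> k" for j s
  have up: "F (g(15 := x)) = F g" "F (g(16 := x)) = F g" for g x by (rule stable_upd[OF F(1)]; simp)+
  have D: "D < 2 ^ (k + 1)" using floor_log_exp2_gt[of D] by (simp add: k_def)
  have loop: "hoare (I k) (While 16 (Add 15 15 31 ;; Half 16 16)) (k * (3 + 1) + 1) (I 0)"
  proof (rule hoare_while)
    fix j assume j: "j < k"
    have e: "k - j = Suc (k - Suc j)" using j by simp
    show "hoare (I (Suc j)) (Add 15 15 31 ;; Half 16 16) 3 (I j)"
      by (rule hoare_pre, (rule hoare_seq hoare_basic)+)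
         (use j in \<open>auto simp: I_def base_def up e div_mult2_eq[symmetric] mult.commute\<close>)
    have "D \<noteq> 0" using j by (cases "D = 0") (auto simp: k_def)
    then have "2 ^ k \<le> D" using floor_log_exp2_le[of D] by (simp add: k_def)
    moreover have "(2::nat) ^ (k - Suc j + 1) \<le> 2 ^ k" using j by (intro power_increasing) auto
    ultimately have "D div 2 ^ (k - Suc j + 1) > 0" by (simp add: div_greater_zero_iff)
    then show "regs s 16 \<noteq> 0" if "I (Suc j) s" for s using that by (auto simp: I_def base_def)
  qed (use D in \<open>auto simp: I_def base_def\<close>)
  have init: "hoare (base m F) (Const 15 0 ;; Half 16 14) 3 (I k)"
    by (rule hoare_pre, (rule hoare_seq hoare_basic)+) (use F(2) in \<open>auto simp: I_def base_def up\<close>)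
  show ?thesis unfolding log_com_def
    by (rule hoare_pre[OF hoare_post[OF hoare_seq[OF loop init]]]) (use floor_log_le[of D] in \<open>auto simp: I_def base_def k_def\<close>)
qed

lemma hoare_scale:
  assumes F: "stable {d} F" "\<And>g. F g \<Longrightarrow> g a = x" and d: "d \<notin> {0, 2, 31, a}"
  shows "hoare (base m F) (scale_com d a c) (2 * c + 1) (base m (\<lambda>g. F g \<and> g d = c * x))"
proof (induction c)
  case 0
  show ?case by (simp, rule hoare_pre[OF hoare_basic(2)]) (use d stable_upd[OF F(1)] in \<open>auto simp: base_def\<close>)
next
  case (Suc c)
  have "hoare (base m (\<lambda>g. F g \<and> g d = c * x)) (Add d d a) 1 (base m (\<lambda>g. F g \<and> g d = Suc c * x))"
    by (rule hoare_pre[OF hoare_basic(3)]) (use d stable_upd[OF F(1)] F(2) in \<open>auto simp: base_def\<close>)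
  from hoare_seq[OF this Suc.IH] show ?case by (simp add: algebra_simps)
qed

lemma hoare_div:
  assumes F: "stable {5, 14, 18} F" "\<And>g. F g \<Longrightarrow> g 17 = W" and W: "1 \<le> W"
  shows "hoare (base m (\<lambda>g. F g \<and> g 14 = D)) div_com (D * 10 + 10) (base m (\<lambda>g. F g \<and> g 5 = D div W))"
proof -
  define k where "k = D div W"
  define I where "I j s \<longleftrightarrow> base m (\<lambda>g. F g \<and> g 5 = k - j \<and> g 14 = D - (k - j) * W \<and> g 18 = D - (k - j) * W + 1 - W) s \<and> j \<le> k" for j s
  have up: "F (g(5 := x)) = F g" "F (g(14 := x)) = F g" "F (g(18 := x)) = F g" for g x by (rule stable_upd[OF F(1)]; simp)+
  have kW: "k * W \<le> D" "D < k * W + W"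
    using W dividend_less_div_times[of W D] by (auto simp: k_def add.commute)
  have loop: "hoare (I k) (While 18 (Sub 14 14 17 ;; Add 5 5 31 ;; Add 18 14 31 ;; Sub 18 18 17)) (k * (7 + 1) + 1) (I 0)"
  proof (rule hoare_while)
    fix j assume j: "j < k"
    have e: "k - j = Suc (k - Suc j)" using j by simp
    have e2: "D - (k - Suc j) * W - W = D - (k - j) * W" by (simp add: e)
    show "hoare (I (Suc j)) (Sub 14 14 17 ;; Add 5 5 31 ;; Add 18 14 31 ;; Sub 18 18 17) 7 (I j)"
    proof (rule hoare_pre, (rule hoare_seq hoare_basic)+, goal_cases)
      case (1 s)
      then have "regs s 17 = W" using F(2) by (auto simp: I_def base_def)
      then show ?case using 1 j e e2 by (auto simp: I_def base_def up)
    qed simp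
    have "(k - Suc j) * W + W \<le> k * W" using j by (metis e mult_le_mono1 diff_le_self mult_Suc add.commute)
    then have "D - (k - Suc j) * W + 1 - W > 0" using kW by linarith
    then show "regs s 18 \<noteq> 0" if "I (Suc j) s" for s using that by (auto simp: I_def base_def)
  qed (use kW in \<open>auto simp: I_def base_def\<close>)
  have init: "hoare (base m (\<lambda>g. F g \<and> g 14 = D)) (Const 5 0 ;; Add 18 14 31 ;; Sub 18 18 17) 5 (I k)"
    by (rule hoare_pre, (rule hoare_seq hoare_basic)+) (use F(2) in \<open>auto simp: I_def base_def up\<close>)
  have "k \<le> D" by (simp add: k_def)
  then have c: "5 + (k * (7 + 1) + 1) + 1 \<le> D * 10 + 10" by simp
  show ?thesis unfolding div_com_def
    by (rule hoare_pre[OF hoare_post[OF hoare_seq[OF loop init]] _ c]) (auto simp: I_def base_def k_def)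
qed

lemma hoare_pow2:
  assumes F: "stable {7, 18} F" and n: "n \<ge> 1"
  shows "hoare (base m F) pow2_com (n * 10 + 20) (base m (\<lambda>g. F g \<and> g 7 = 2 ^ (floor_log n + 1)))"
proof -
  define k where "k = floor_log n + 1"
  define I where "I j s \<longleftrightarrow> base m (\<lambda>g. F g \<and> g 7 = 2 ^ (k - j) \<and> g 18 = n + 1 - 2 ^ (k - j)) s \<and> j \<le> k" for j s
  have up: "F (g(7 := x)) = F g" "F (g(18 := x)) = F g" for g x by (rule stable_upd[OF F(1)]; simp)+
  have k: "n < 2 ^ k" "2 ^ (k - 1) \<le> n" using floor_log_exp2_gt[of n] floor_log_exp2_le[of n] n by (auto simp: k_def)
  have loop: "hoare (I k) (While 18 (Add 7 7 7 ;; Add 18 0 31 ;; Sub 18 18 7)) (k * (5 + 1) + 1) (I 0)"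
  proof (rule hoare_while)
    fix j assume j: "j < k"
    have e: "k - j = Suc (k - Suc j)" using j by simp
    show "hoare (I (Suc j)) (Add 7 7 7 ;; Add 18 0 31 ;; Sub 18 18 7) 5 (I j)"
      by (rule hoare_pre, (rule hoare_seq hoare_basic)+) (use j in \<open>auto simp: I_def base_def up e\<close>)
    have "(2::nat) ^ (k - Suc j) \<le> 2 ^ (k - 1)" by (intro power_increasing) auto
    then have "n + 1 - 2 ^ (k - Suc j) > 0" using k by linarith
    then show "regs s 18 \<noteq> 0" if "I (Suc j) s" for s using that by (auto simp: I_def base_def)
  qed (use k in \<open>auto simp: I_def base_def\<close>)
  have init: "hoare (base m F) (Const 7 1 ;; Add 18 0 31 ;; Sub 18 18 7) 5 (I k)"
    by (rule hoare_pre, (rule hoare_seq hoare_basic)+) (auto simp: I_def base_def up)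
  show ?thesis unfolding pow2_com_def
    by (rule hoare_pre[OF hoare_post[OF hoare_seq[OF loop init]]]) (use floor_log_le[of n] in \<open>auto simp: I_def base_def k_def\<close>)
qed

definition init_cost :: "nat \<Rightarrow> nat \<Rightarrow> nat \<Rightarrow> nat" where
  "init_cost J c1 c3 = n * 40 + n * (n * (adj_cost n + 10) + 30) + 2 * J + 2 * c1 + 2 * c3 + 100"

lemma hoare_init:
  assumes n: "n \<ge> 1" and J: "J \<ge> 1" and D: "maxdeg 0 \<ge> 2"
    and m: "\<And>u v. u < n \<Longrightarrow> v < n \<Longrightarrow> m (u * n + v) = of_bool (adj u v)"
  defines "L \<equiv> floor_log (maxdeg 0)"
  defines "M \<equiv> maxdeg 0 div (J * L)"
  shows "hoare (\<lambda>s. regs s 0 = n \<and> regs s 2 = 0 \<and> mem s = m) (init_com J c1 c3) (init_cost J c1 c3)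
     (base m (\<lambda>g. g 3 = n * n \<and> g 4 = c1 * M \<and> g 5 = M \<and> g 6 = c3 * L \<and> g 7 = 2 ^ (floor_log n + 1)))"
proof -
  define T where "T = (\<lambda>g :: nat \<Rightarrow> nat. True)"
  define F1 where "F1 g \<longleftrightarrow> T g \<and> g 3 = n * n" for g
  define F2 where "F2 g \<longleftrightarrow> F1 g \<and> g 14 = maxdeg 0" for g
  define F3 where "F3 g \<longleftrightarrow> F2 g \<and> g 15 = L" for g
  define F4 where "F4 g \<longleftrightarrow> F3 g \<and> g 17 = J * L" for g
  define F5 where "F5 g \<longleftrightarrow> F4 g \<and> g 6 = c3 * L" for g
  \<comment> \<open>The division destroys the maximum degree in register \<open>14\<close>, so the
    frame is restated without it.\<close>
  define F5' where "F5' g \<longleftrightarrow> g 3 = n * n \<and> g 15 = L \<and> g 17 = J * L \<and> g 6 = c3 * L" for g :: "nat \<Rightarrow> nat"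
  define F6 where "F6 g \<longleftrightarrow> F5' g \<and> g 5 = M" for g
  define F7 where "F7 g \<longleftrightarrow> F6 g \<and> g 4 = c1 * M" for g
  note Fs = F1_def F2_def F3_def F4_def F5_def F5'_def F6_def F7_def T_def
  have L: "L \<ge> 1" using D floor_log_rec[of "maxdeg 0"] by (simp add: L_def)
  have 0: "hoare (\<lambda>s. regs s 0 = n \<and> regs s 2 = 0 \<and> mem s = m) (Const 31 1) 1 (base m T)"
    by (rule hoare_pre[OF hoare_basic(2)]) (auto simp: base_def T_def)
  have 1: "hoare (base m T) square_com (n * 5 + 10) (base m F1)"
    by (rule hoare_post[OF hoare_square]) (auto simp: base_def Fs stable_def)
  have 2: "hoare (base m F1) max_degree_com (n * (n * (adj_cost n + 10) + 30) + 10) (base m F2)"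
    by (rule hoare_post[OF hoare_max_degree[OF _ m]]) (auto simp: base_def Fs stable_def)
  have 3: "hoare (base m F2) log_com (maxdeg 0 * 5 + 10) (base m F3)"
    by (rule hoare_post[OF hoare_log]) (auto simp: base_def Fs stable_def L_def)
  have 4: "hoare (base m F3) (scale_com 17 15 J) (2 * J + 1) (base m F4)"
    by (rule hoare_post[OF hoare_scale[where x = L]]) (auto simp: base_def Fs stable_def)
  have 5: "hoare (base m F4) (scale_com 6 15 c3) (2 * c3 + 1) (base m F5)"
    by (rule hoare_post[OF hoare_scale[where x = L]]) (auto simp: base_def Fs stable_def)
  have 6: "hoare (base m F5) div_com (maxdeg 0 * 10 + 10) (base m F6)"
    by (rule hoare_pre[OF hoare_post[OF hoare_div[where F = F5' and D = "maxdeg 0" and W = "J * L"]]])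
       (use J L in \<open>auto simp: base_def Fs stable_def M_def\<close>)
  have 7: "hoare (base m F6) (scale_com 4 5 c1) (2 * c1 + 1) (base m F7)"
    by (rule hoare_post[OF hoare_scale[where x = M]]) (auto simp: base_def Fs stable_def)
  have 8: "hoare (base m F7) pow2_com (n * 10 + 20)
    (base m (\<lambda>g. g 3 = n * n \<and> g 4 = c1 * M \<and> g 5 = M \<and> g 6 = c3 * L \<and> g 7 = 2 ^ (floor_log n + 1)))"
    by (rule hoare_post[OF hoare_pow2[OF _ n]]) (auto simp: base_def Fs stable_def)
  show ?thesis unfolding init_com_def
    by (rule hoare_pre[OF hoare_seq[OF hoare_seq[OF hoare_seq[OF hoare_seq[OF hoare_seq[OF hoare_seq[OF hoare_seq[OF hoare_seq[OF
       8 7] 6] 5] 4] 3] 2] 1] 0]])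
       (use maxdeg_le[of 0] in \<open>auto simp: init_cost_def\<close>)
qed

end

section \<open>Choice of the parameters\<close>

text \<open>\<open>- ln (1 - p) \<le> p / (1 - p)\<close>; the factor \<open>1 - p\<close> in the
  bound on \<open>Z\<close> compensates for the denominator.\<close>

lemma power_minus_ge_powr:
  fixes p x t :: real
  assumes p: "0 < p" "p < 1" and x: "1 < x" and Z: "real Z * p \<le> t * (1 - p) * ln x"
  shows "x powr (- t) \<le> (1 - p) ^ Z"
proof -
  have "ln (1 / (1 - p)) \<le> 1 / (1 - p) - 1" using p by (intro ln_le_minus_one) auto
  then have "- ln (1 - p) \<le> p / (1 - p)" using p by (simp add: ln_div field_simps)
  then have "real Z * (- ln (1 - p)) \<le> real Z * (p / (1 - p))" by (intro mult_left_mono) auto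
  also have "\<dots> \<le> t * ln x" using Z p by (simp add: field_simps)
  finally have "- t * ln x \<le> real Z * ln (1 - p)" by simp
  then have "exp (- t * ln x) \<le> exp (real Z * ln (1 - p))" by simp
  moreover have "exp (real Z * ln (1 - p)) = (1 - p) ^ Z" using p by (simp add: exp_of_nat_mult)
  ultimately show ?thesis using x by (simp add: powr_def)
qed

lemma floor_log_bounds:
  assumes "D \<ge> 1"
  shows "real (floor_log D) * ln 2 \<le> ln (real D)" "ln (real D) \<le> (real (floor_log D) + 1) * ln 2"
proof -
  have "real (2 ^ floor_log D) \<le> real D" using floor_log_exp2_le[of D] assms by (subst of_nat_le_iff) simp
  then have "ln (2 ^ floor_log D) \<le> ln (real D)" using assms by (subst ln_le_cancel_iff) auto
  then show "real (floor_log D) * ln 2 \<le> ln (real D)" by (simp add: ln_realpow)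
  have "real D \<le> real (2 * 2 ^ floor_log D)" using floor_log_exp2_ge[of D] by (subst of_nat_le_iff)
  then have "ln (real D) \<le> ln (2 ^ (floor_log D + 1))" using assms by (subst ln_le_cancel_iff) auto
  then show "ln (real D) \<le> (real (floor_log D) + 1) * ln 2" by (simp add: ln_mult ln_realpow algebra_simps)
qed

text \<open>With \<open>M\<close> close to \<open>\<Delta> / (J * log 2 \<Delta>)\<close>, the
  quotient \<open>c1 * ln 2 / J\<close> is the constant in front of
  \<open>\<Delta> / ln \<Delta>\<close>. It has to exceed \<open>1 + 8 * \<delta>\<close> for the
  sweep bound and, with the greedy colours counted, stay below \<open>1 + \<epsilon> / 2\<close>.
  The bounds on \<open>c3\<close> make lists so long that vertices of large inner degree and blank
  neighbours are few compared with \<open>M\<close>.\<close>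

locale parameters =
  fixes d \<epsilon> \<delta> p :: real and J c1 c3 :: nat
  assumes eps: "0 < \<epsilon>" "\<epsilon> \<le> 1" and delta: "\<delta> = \<epsilon> / 32" and d: "0 \<le> d"
    and p: "0 < p" "p \<le> \<delta>" "d * p \<le> \<delta>" and J: "J \<ge> 1"
    and c1: "(1 + 8 * \<delta>) * J \<le> c1 * ln 2" "(real c1 + 1) * ln 2 \<le> (1 + \<epsilon> / 2) * J"
    and c3: "8 * d * J \<le> c3" "16 * J \<le> c3 * p"
begin

text \<open>In turn: a lower bound on the logarithm, the colour count, two lower-order losses in the
  product of gain and \<open>q\<close>, the failure bounds of sweep and scan, the rounding in
  \<open>M\<close>, and the quadratic term of the gain.\<close>

definition large :: "real \<Rightarrow> bool" where
  "large x \<longleftrightarrow> 2 \<le> ln x \<and> (1 + \<epsilon> / 2) * x / (ln x - ln 2) + 1 \<le> (1 + \<epsilon>) * x / ln x \<and>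
     4 * x / ln x \<le> \<delta> * x \<and> c1 * ln x \<le> \<delta> * x \<and>
     c3 * ln x / ln 2 - \<delta> * x powr \<delta> / (2 * ln x) \<le> - ln (12 * (x\<^sup>2 + 1)) \<and>
     ln (12 * (x\<^sup>2 + 1)) \<le> x * ln 2 / (4 * real J * ln x) - 1 / 2 - 2 * x * exp (- x / 4) \<and>
     ln x / ln 2 \<le> x / (2 * real J) \<and>
     x powr (- (1 - \<delta>)) / (2 * ln x) * (ln x / p)\<^sup>2 / 2 \<le> 1"

lemma delta_bounds: "0 < \<delta>" "\<delta> \<le> 1 / 32" using eps by (auto simp: delta)

lemma eventually_large: "eventually large at_top"
proof -
  have dl: "0 < \<delta>" "\<delta> < 1" "0 < 1 - \<delta>" using delta_bounds by auto
  have J0: "0 < real J" using J by simp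
  define c1' where "c1' = real c1"
  define c3' where "c3' = real c3"
  define J' where "J' = real J"
  have J'0: "J' > 0" using J by (simp add: J'_def)
  have c: "0 \<le> c1'" "0 \<le> c3'" by (auto simp: c1'_def c3'_def)
  have l2: "0 < ln (2::real)" by simp
  have 1: "eventually (\<lambda>x::real. 2 \<le> ln x) at_top" by real_asymp
  have 2: "eventually (\<lambda>x::real. (1 + \<epsilon> / 2) * x / (ln x - ln 2) + 1 \<le> (1 + \<epsilon>) * x / ln x) at_top"
    using eps(1) by real_asymp
  have 3: "eventually (\<lambda>x::real. 4 * x / ln x \<le> \<delta> * x) at_top" using dl by real_asymp
  have 4: "eventually (\<lambda>x::real. c1' * ln x \<le> \<delta> * x) at_top" using dl c by real_asymp
  have 5: "eventually (\<lambda>x::real. c3' * ln x / ln 2 - \<delta> * x powr \<delta> / (2 * ln x) \<le> - ln (12 * (x\<^sup>2 + 1))) at_top"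
    using dl c by real_asymp
  have 6: "eventually (\<lambda>x::real. ln (12 * (x\<^sup>2 + 1)) \<le> x * ln 2 / (4 * J' * ln x) - 1 / 2 - 2 * x * exp (- x / 4)) at_top"
    using J'0 by real_asymp
  have 7: "eventually (\<lambda>x::real. ln x / ln 2 \<le> x / (2 * J')) at_top" using J'0 by real_asymp
  have 8: "eventually (\<lambda>x::real. x powr (- (1 - \<delta>)) / (2 * ln x) * (ln x / p)\<^sup>2 / 2 \<le> 1) at_top"
    using dl p(1) by real_asymp
  show ?thesis using 1 2 3 4 5 6 7 8 unfolding large_def c1'_def c3'_def J'_def
    by eventually_elim blast
qed

text \<open>The condition on \<open>e\<close> in \<open>iter_fails_le\<close>, solved for
  \<open>e\<close>.\<close>

definition target :: "real \<Rightarrow> real" where "target x = 1 / (12 * (x\<^sup>2 + 1))"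

lemma exp_le_target: "y \<le> - ln (12 * (x\<^sup>2 + 1)) \<Longrightarrow> exp y \<le> target x"
proof -
  assume y: "y \<le> - ln (12 * (x\<^sup>2 + 1))"
  have pos: "0 < 12 * (x\<^sup>2 + 1)" by (simp add: add_nonneg_pos)
  have "exp y \<le> exp (- ln (12 * (x\<^sup>2 + 1)))" using y by simp
  also have "\<dots> = target x" using pos by (simp add: exp_minus target_def divide_inverse)
  finally show ?thesis .
qed

context
  fixes D L M :: nat and x :: real
  assumes x: "x = real D" and D: "D \<ge> 1" and lg: "large x" and L: "L = floor_log D" and M: "M = D div (J * L)"
begin

lemma lnx: "2 \<le> ln x" using lg by (simp add: large_def)

lemma xpos: "0 < x" "1 < x"
proof -
  show "0 < x" using D x by simp
  have "x \<noteq> 1" using lnx by auto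
  then show "1 < x" using D x by simp
qed

lemma L_bounds: "L * ln 2 \<le> ln x" "ln x - ln 2 \<le> L * ln 2" "1 \<le> L" "real L \<le> ln x / ln 2"
proof -
  have l2: "0 < ln (2::real)" "ln (2::real) < 1" using ln_2_less_1 by auto
  show a: "L * ln 2 \<le> ln x" "ln x - ln 2 \<le> L * ln 2"
    using floor_log_bounds[OF D] by (auto simp: L x algebra_simps)
  then show "real L \<le> ln x / ln 2" using l2 by (simp add: field_simps)
  have "L * ln 2 > 0" using a lnx l2 by linarith
  then show "1 \<le> L" using l2 by (simp add: zero_less_mult_iff)
qed

lemma M_bounds: "M \<le> x / (real J * real L)" "x / (real J * real L) - 1 \<le> M"
proof -
  have p: "J * L > 0" using J L_bounds by simp
  have "real M = real_of_int \<lfloor>real D / real (J * L)\<rfloor>" unfolding M by (simp only: floor_divide_of_nat_eq of_int_of_nat_eq)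
  then have "real M = real_of_int \<lfloor>real D / (real J * real L)\<rfloor>" by simp
  then show "M \<le> x / (real J * real L)" "x / (real J * real L) - 1 \<le> M" unfolding x by linarith+
qed

text \<open>Counts the \<open>c1 * M\<close> colours of the walk and the \<open>M + 1\<close> extra
  colours of the greedy step.\<close>

lemma ncol_le: "real (c1 * M + M + 1) \<le> (1 + \<epsilon>) * x / ln x"
proof -
  have l2: "0 < ln (2::real)" "ln (2::real) < 1" using ln_2_less_1 by auto
  have pos: "0 < ln x - ln 2" using lnx l2 by linarith
  have "real (c1 * M + M + 1) = (real c1 + 1) * M + 1" by (simp add: algebra_simps)
  also have "(real c1 + 1) * M \<le> (real c1 + 1) * (x / (real J * real L))" using M_bounds by (intro mult_left_mono) auto
  also have "\<dots> = ((real c1 + 1) * ln 2) * x / (J * (L * ln 2))" using l2 by simp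
  also have "\<dots> \<le> ((1 + \<epsilon> / 2) * J) * x / (J * (L * ln 2))"
    using c1(2) xpos l2 by (intro divide_right_mono mult_right_mono) auto
  also have "\<dots> = (1 + \<epsilon> / 2) * x / (L * ln 2)" using J by simp
  also have "\<dots> \<le> (1 + \<epsilon> / 2) * x / (ln x - ln 2)"
    using L_bounds pos xpos eps by (intro divide_left_mono mult_pos_pos) auto
  finally show ?thesis using lg by (simp add: large_def)
qed

lemma ncol_le_D: "c1 * M + M + 1 \<le> D"
proof -
  have "(1 + \<epsilon>) * x / ln x \<le> 2 * x / 2" using lnx xpos eps by (intro frac_le mult_right_mono) auto
  then have "real (c1 * M + M + 1) \<le> real D" using ncol_le x by simp
  then show ?thesis by (simp only: of_nat_le_iff)
qed

lemma LM_ge: "x / (2 * real J) \<le> real L * real M"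
proof -
  have "x / J - L = real L * (x / (real J * real L) - 1)" using L_bounds J by (simp add: field_simps)
  also have "\<dots> \<le> real L * real M" using M_bounds by (intro mult_left_mono) auto
  finally have "x / J - L \<le> real L * real M" .
  moreover have "real L \<le> x / (2 * real J)" using L_bounds lg by (simp add: large_def)
  moreover have "x / J = x / (2 * real J) + x / (2 * real J)" by (simp add: field_simps)
  ultimately show ?thesis by linarith
qed

text \<open>The condition by which \<open>scan_flaw_le\<close> limits the vertices of large inner
  degree.\<close>

lemma high_degree_le: "2 * d * D / (c3 * L) \<le> M / 2"
proof (cases "c3 = 0")
  case False
  have "4 * d * x = (8 * d * J) * (x / (2 * real J))" using J by simp
  also have "\<dots> \<le> c3 * (real L * real M)" using c3(1) LM_ge d xpos by (intro mult_mono) auto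
  finally show ?thesis using False L_bounds by (simp add: x field_simps)
qed auto

lemma c3_pos: "0 < c3 * L"
proof -
  have "0 < 16 * real J" using J by simp
  then have "0 < c3 * p" using c3(2) by linarith
  then show ?thesis using p L_bounds by (cases "c3 = 0") auto
qed

text \<open>\<open>M / 2\<close> is about \<open>x / (2 * J * L)\<close>. The main term of the blank
  rate uses up at most half of it, and the rest, of order \<open>x / ln x\<close>, exceeds the
  required logarithm.\<close>

lemma blank_le:
  assumes y: "y \<le> exp (- x / 4)"
  shows "exp (- (M / 2) + 2 * (2 / (p * real (c3 * L)) + y) * D) \<le> target x"
proof (rule exp_le_target)
  have l2: "0 < ln (2::real)" by simp
  have pos: "0 < real J * real L" "0 < p * (real c3 * real L)" "0 < real c3" using J L_bounds p c3_pos by auto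
  have "4 * x / (p * (real c3 * real L)) \<le> x / (4 * (real J * real L))"
  proof -
    have "(16 * real J) * real L \<le> (c3 * p) * real L" using c3(2) by (intro mult_right_mono) auto
    then have "x * ((16 * real J) * real L) \<le> x * ((c3 * p) * real L)" using xpos by (intro mult_left_mono) auto
    then have c: "(4 * x) * (4 * (real J * real L)) \<le> x * (p * (real c3 * real L))" by (simp add: mult_ac)
    have gen: "a / P \<le> c / Q" if "0 < P" "0 < Q" "a * Q \<le> c * P" for a P c Q :: real
      using that by (simp add: field_simps)
    show ?thesis by (rule gen[OF _ _ c]) (use pos in auto)
  qed
  moreover have "2 * y * x \<le> 2 * x * exp (- x / 4)" using y xpos by simp
  moreover have "x / (2 * (real J * real L)) - 1 / 2 \<le> M / 2"
  proof -
    have "x / (2 * (real J * real L)) = x / (real J * real L) / 2" by simp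
    then show ?thesis using M_bounds(2) by linarith
  qed
  moreover have "x / (2 * (real J * real L)) - x / (4 * (real J * real L)) = x / (4 * (real J * real L))" using pos by (simp add: field_simps)
  moreover have "x * ln 2 / (4 * real J * ln x) \<le> x / (4 * (real J * real L))"
  proof -
    have "x * ln 2 / (4 * real J * ln x) = x / (4 * real J * (ln x / ln 2))" using l2 by simp
    also have "\<dots> \<le> x / (4 * real J * real L)" using L_bounds xpos pos lnx J l2
      by (intro divide_left_mono mult_left_mono mult_pos_pos) auto
    finally show ?thesis by (simp add: mult.assoc)
  qed
  moreover have "ln (12 * (x\<^sup>2 + 1)) \<le> x * ln 2 / (4 * real J * ln x) - 1 / 2 - 2 * x * exp (- x / 4)"
    using lg by (simp add: large_def)
  moreover have "2 * (2 / (p * real (c3 * L)) + y) * D = 4 * x / (p * (real c3 * real L)) + 2 * y * x"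
    by (simp add: x algebra_simps)
  ultimately show "- (M / 2) + 2 * (2 / (p * real (c3 * L)) + y) * D \<le> - ln (12 * (x\<^sup>2 + 1))"
    by simp
qed

text \<open>\<open>Z\<close> is small enough for a colour with \<open>Z\<close> candidates to
  survive with probability at least \<open>x powr (- (1 - \<delta>))\<close>, yet the gain is still
  \<open>(1 - 3 * \<delta>) * ln x\<close> up to a constant. Times the number of colours this
  exceeds \<open>(1 + \<delta>) * x\<close>, and the surplus \<open>\<delta> * \<theta> * x\<close>
  grows like \<open>x powr \<delta> / ln x\<close>.\<close>

lemma sweep_le:
  obtains Z :: nat and \<theta> :: real where "0 \<le> \<theta>" "\<theta> * (p * Z * (1 - d * p) - \<theta> * (real Z)\<^sup>2 / 2) \<le> (1 - p) ^ Z / 2"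
    "exp (real (c3 * L) + \<theta> * D - \<theta> * (p * Z * (1 - d * p) - \<theta> * (real Z)\<^sup>2 / 2) * (real (c1 * M))) \<le> target x"
proof -
  \<comment> \<open>The largest value that \<open>power_minus_ge_powr\<close> admits for the
    exponent \<open>1 - \<delta>\<close>.\<close>
  define T where "T = (1 - \<delta>) * (1 - p) / p * ln x"
  define Z where "Z = nat \<lfloor>T\<rfloor>"
  \<comment> \<open>As the gain is at most \<open>ln x\<close>, this price times the gain is at most
    half of the survival probability.\<close>
  define \<theta> where "\<theta> = x powr (- (1 - \<delta>)) / (2 * ln x)"
  define g where "g = p * Z * (1 - d * p) - \<theta> * (real Z)\<^sup>2 / 2"
  have p1: "p < 1" "0 \<le> d * p" "d * p < 1" using p delta_bounds d by auto
  have T0: "0 \<le> T" unfolding T_def using p p1 delta_bounds lnx by (intro mult_nonneg_nonneg divide_nonneg_pos) auto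
  have Z: "real Z \<le> T" "T - 1 \<le> real Z" using T0 unfolding Z_def by linarith+
  have \<theta>0: "0 \<le> \<theta>" using lnx by (simp add: \<theta>_def)
  have Tp: "T * p = (1 - \<delta>) * (1 - p) * ln x" using p by (simp add: T_def)
  have Tle: "T * p \<le> ln x"
  proof -
    have "(1 - \<delta>) * (1 - p) \<le> 1 * 1" using delta_bounds p p1 by (intro mult_mono) auto
    then show ?thesis unfolding Tp using lnx by (simp add: mult_left_le_one_le mult_le_cancel_right1)
  qed
  have pow: "x powr (- (1 - \<delta>)) \<le> (1 - p) ^ Z"
    by (rule power_minus_ge_powr) (use p p1 xpos Z mult_right_mono[OF Z(1), of p] Tp in auto)
  have g_le: "g \<le> ln x"
  proof -
    have "g \<le> p * Z * (1 - d * p)" using \<theta>0 by (simp add: g_def)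
    also have "\<dots> \<le> p * Z * 1" using p p1 by (intro mult_left_mono) auto
    also have "\<dots> \<le> T * p" using Z p by (simp add: mult.commute)
    finally show ?thesis using Tle by linarith
  qed
  have 1: "\<theta> * g \<le> (1 - p) ^ Z / 2"
  proof -
    have "\<theta> * g \<le> \<theta> * ln x" using g_le \<theta>0 by (rule mult_left_mono)
    also have "\<dots> = x powr (- (1 - \<delta>)) / 2" using lnx by (simp add: \<theta>_def)
    finally show ?thesis using pow by simp
  qed
  have g_ge: "(1 - 3 * \<delta>) * ln x - 2 \<le> g"
  proof -
    have "Z * p \<le> ln x" using mult_right_mono[OF Z(1), of p] Tle p by linarith
    then have "real Z \<le> ln x / p" using p by (simp add: field_simps)
    then have "\<theta> * (real Z)\<^sup>2 / 2 \<le> \<theta> * (ln x / p)\<^sup>2 / 2"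
      using \<theta>0 by (intro divide_right_mono mult_left_mono power_mono) auto
    also have "\<dots> \<le> 1" using lg by (simp add: large_def \<theta>_def)
    finally have a: "\<theta> * (real Z)\<^sup>2 / 2 \<le> 1" .
    \<comment> \<open>One \<open>\<delta>\<close> is lost for the exponent, one for \<open>p\<close>
      and one for \<open>d * p\<close>.\<close>
    have "(1 - 3 * \<delta>) \<le> (1 - \<delta>) * (1 - p) * (1 - d * p)"
    proof -
      have "(1 - \<delta>) * (1 - \<delta>) * (1 - \<delta>) \<le> (1 - \<delta>) * (1 - p) * (1 - d * p)"
        using delta_bounds p p1 by (intro mult_mono) auto
      moreover have "(1 - \<delta>) * (1 - \<delta>) * (1 - \<delta>) = 1 - 3 * \<delta> + \<delta>\<^sup>2 * (3 - \<delta>)" by (simp add: algebra_simps power2_eq_square)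
      moreover have "0 \<le> \<delta>\<^sup>2 * (3 - \<delta>)" using delta_bounds by (intro mult_nonneg_nonneg) auto
      ultimately show ?thesis by linarith
    qed
    then have "(1 - 3 * \<delta>) * ln x \<le> (1 - \<delta>) * (1 - p) * (1 - d * p) * ln x" using lnx by (intro mult_right_mono) auto
    also have "\<dots> = (T * p) * (1 - d * p)" by (simp add: Tp mult_ac)
    also have "\<dots> \<le> (p * Z + p) * (1 - d * p)" using mult_left_mono[of "T" "Z + 1" p] Z p p1
      by (intro mult_right_mono) (auto simp: algebra_simps)
    also have "\<dots> \<le> p * Z * (1 - d * p) + 1"
    proof -
      have "p * (1 - d * p) \<le> 1 * 1" using p p1 by (intro mult_mono) auto
      then show ?thesis by (simp add: algebra_simps)
    qed
    finally show ?thesis using a unfolding g_def by linarith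
  qed
  have q_ge: "(1 + 8 * \<delta>) * x / ln x - c1 \<le> real (c1 * M)"
  proof -
    have l2: "0 < ln (2::real)" by simp
    have "(1 + 8 * \<delta>) * x / ln x \<le> (c1 * ln 2 / J) * x / ln x"
      using c1(1) J lnx xpos by (intro divide_right_mono mult_right_mono) (auto simp: field_simps)
    also have "\<dots> = c1 * (x / (real J * (ln x / ln 2)))" by simp
    also have "\<dots> \<le> c1 * (x / (real J * real L))" using L_bounds xpos J lnx l2
      by (intro mult_left_mono divide_left_mono mult_pos_pos) auto
    also have "\<dots> \<le> real c1 * (real M + 1)" using M_bounds by (intro mult_left_mono) auto
    finally show ?thesis by (simp add: algebra_simps)
  qed
  have gq: "(1 + \<delta>) * x \<le> g * real (c1 * M)"
  proof -
    have d1: "0 < 1 - 3 * \<delta>" using delta_bounds by simp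
    have g0: "0 \<le> g"
    proof (cases "0 \<le> (1 - 3 * \<delta>) * ln x - 2")
      case False
      have "4 / ln x \<le> \<delta>" using lg xpos by (simp add: large_def field_simps)
      then have "4 \<le> \<delta> * ln x" using lnx by (simp add: field_simps)
      moreover have "\<delta> * ln x \<le> (1 - 3 * \<delta>) * ln x" using delta_bounds lnx by (intro mult_right_mono) auto
      ultimately show ?thesis using False by linarith
    qed (use g_ge in linarith)
    have e: "((1 - 3 * \<delta>) * ln x - 2) * ((1 + 8 * \<delta>) * x / ln x - c1)
       = (1 - 3 * \<delta>) * (1 + 8 * \<delta>) * x - (1 + 8 * \<delta>) * (2 * x / ln x) - (1 - 3 * \<delta>) * (c1 * ln x) + 2 * c1"
      using lnx by (simp add: field_simps)
    have "(1 + 8 * \<delta>) * (2 * x / ln x) \<le> 2 * (2 * x / ln x)" using delta_bounds xpos lnx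
      by (intro mult_right_mono) auto
    then have b1: "(1 + 8 * \<delta>) * (2 * x / ln x) \<le> \<delta> * x" using lg by (simp add: large_def)
    have "(1 - 3 * \<delta>) * (c1 * ln x) \<le> 1 * (c1 * ln x)" using delta_bounds lnx by (intro mult_right_mono) auto
    then have b2: "(1 - 3 * \<delta>) * (c1 * ln x) \<le> \<delta> * x" using lg by (simp add: large_def)
    \<comment> \<open>The surplus \<open>8 * \<delta>\<close> in the number of colours pays for the
      loss \<open>3 * \<delta>\<close> in the gain and for the product term; the
      \<open>3 * \<delta>\<close> left over cover \<open>b1\<close> and \<open>b2\<close> and still
      leave one \<open>\<delta>\<close>.\<close>
    have "1 + 3 * \<delta> \<le> (1 - 3 * \<delta>) * (1 + 8 * \<delta>)"
    proof -
      have "24 * \<delta> * \<delta> \<le> 1 * \<delta>" using delta_bounds by (intro mult_right_mono) auto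
      then show ?thesis by (simp add: algebra_simps) (use delta_bounds in linarith)
    qed
    then have b3: "(1 + 3 * \<delta>) * x \<le> (1 - 3 * \<delta>) * (1 + 8 * \<delta>) * x" using xpos by (intro mult_right_mono) auto
    have "(1 + \<delta>) * x \<le> ((1 - 3 * \<delta>) * ln x - 2) * ((1 + 8 * \<delta>) * x / ln x - c1)"
      unfolding e using b1 b2 b3 by (simp add: algebra_simps)
    also have "\<dots> \<le> g * ((1 + 8 * \<delta>) * x / ln x - c1)"
    proof (rule mult_right_mono[OF g_ge])
      have "c1 * ln x \<le> \<delta> * x" using lg unfolding large_def by blast
      also have "\<dots> \<le> 1 * x" using delta_bounds xpos by (intro mult_right_mono) auto
      finally have "c1 * ln x \<le> 1 * x" .
      then have "c1 \<le> x / ln x" using lnx by (simp add: field_simps)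
      also have "\<dots> \<le> (1 + 8 * \<delta>) * x / ln x" using delta_bounds lnx xpos by (intro divide_right_mono) auto
      finally show "0 \<le> (1 + 8 * \<delta>) * x / ln x - c1" by simp
    qed
    also have "\<dots> \<le> g * real (c1 * M)" by (rule mult_left_mono[OF q_ge g0])
    finally show ?thesis .
  qed
  have 2: "exp (real (c3 * L) + \<theta> * D - \<theta> * g * (real (c1 * M))) \<le> target x"
  proof (rule exp_le_target)
    have "\<theta> * ((1 + \<delta>) * x) \<le> \<theta> * (g * real (c1 * M))" by (rule mult_left_mono[OF gq \<theta>0])
    then have "\<theta> * D - \<theta> * g * real (c1 * M) \<le> - (\<delta> * (\<theta> * x))" by (simp add: x algebra_simps)
    moreover have "\<theta> * x = x powr \<delta> / (2 * ln x)"
      using xpos by (simp add: \<theta>_def powr_diff powr_minus field_simps)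
    moreover have "real (c3 * L) \<le> c3 * ln x / ln 2"
      using mult_left_mono[OF L_bounds(4), of c3] by simp
    moreover have "c3 * ln x / ln 2 - \<delta> * x powr \<delta> / (2 * ln x) \<le> - ln (12 * (x\<^sup>2 + 1))"
      using lg by (simp add: large_def)
    ultimately show "real (c3 * L) + \<theta> * D - \<theta> * g * real (c1 * M) \<le> - ln (12 * (x\<^sup>2 + 1))" by simp
  qed
  show ?thesis by (rule that[OF \<theta>0 1[unfolded g_def] 2[unfolded g_def]])
qed

end

end

lemma exists_parameters:
  fixes d \<epsilon> :: real
  assumes "0 < \<epsilon>" "\<epsilon> \<le> 1" "0 \<le> d"
  obtains b J c1 c3 :: nat where "b \<ge> 1" "parameters d \<epsilon> (\<epsilon> / 32) (1 / 2 ^ b) J c1 c3"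
proof -
  define \<delta> where "\<delta> = \<epsilon> / 32"
  define m where "m = min \<delta> (\<delta> / (d + 1))"
  have m: "m > 0" "m \<le> \<delta>" "d * m \<le> \<delta>"
  proof -
    show "m > 0" using assms by (auto simp: m_def \<delta>_def)
    show "m \<le> \<delta>" unfolding m_def by (rule min.cobounded1)
    have "d * m \<le> d * (\<delta> / (d + 1))" using assms by (intro mult_left_mono) (auto simp: m_def)
    also have "\<dots> \<le> \<delta>" using assms by (simp add: \<delta>_def field_simps)
    finally show "d * m \<le> \<delta>" .
  qed
  obtain b0 :: nat where b0: "(1 / 2) ^ b0 < m" using real_arch_pow_inv[OF m(1), of "1 / 2"] by auto
  define b where "b = Suc b0"
  define p :: real where "p = 1 / 2 ^ b"
  have p: "0 < p" "p \<le> m"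
  proof -
    have "p \<le> (1 / 2) ^ b0" by (simp add: p_def b_def power_one_over field_simps)
    then show "p \<le> m" using b0 by linarith
  qed (simp add: p_def)
  \<comment> \<open>Rounding \<open>c1\<close> up and adding one for the greedy colours cost at most
    \<open>2 * ln 2 \<le> 2\<close>, which has to fit into
    \<open>(\<epsilon> / 2 - 8 * \<delta>) * J = \<epsilon> / 4 * J\<close>.\<close>
  obtain J :: nat where J: "8 / \<epsilon> < J" using reals_Archimedean2 by blast
  have J1: "J \<ge> 1" using J assms by (cases J) auto
  define c1 where "c1 = nat \<lceil>(1 + 8 * \<delta>) * J / ln 2\<rceil>"
  obtain c3 :: nat where c3: "max (8 * d * J) (16 * J / p) < c3" using reals_Archimedean2 by blast
  have l2: "0 < ln (2::real)" "ln (2::real) < 1" using ln_2_less_1 by auto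
  have c1: "(1 + 8 * \<delta>) * J / ln 2 \<le> c1" "c1 \<le> (1 + 8 * \<delta>) * J / ln 2 + 1"
  proof -
    have "0 \<le> (1 + 8 * \<delta>) * J / ln 2" using assms by (auto simp: \<delta>_def intro!: divide_nonneg_nonneg mult_nonneg_nonneg)
    then show "(1 + 8 * \<delta>) * J / ln 2 \<le> c1" "c1 \<le> (1 + 8 * \<delta>) * J / ln 2 + 1"
      unfolding c1_def by linarith+
  qed
  have "parameters d \<epsilon> (\<epsilon> / 32) p J c1 c3"
  proof
    have pp: "d * p \<le> d * m" using p assms by (intro mult_left_mono) auto
    show "p \<le> \<epsilon> / 32" "d * p \<le> \<epsilon> / 32" using pp p m by (auto simp: \<delta>_def)
    show "(1 + 8 * (\<epsilon> / 32)) * J \<le> c1 * ln 2" using c1(1) l2 by (simp add: \<delta>_def field_simps)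
    have "(real c1 + 1) * ln 2 \<le> ((1 + 8 * \<delta>) * J / ln 2 + 2) * ln 2" using c1(2) l2 by (intro mult_right_mono) auto
    also have "\<dots> = ((1 + 8 * \<delta>) * J / ln 2) * ln 2 + 2 * ln 2" by (rule distrib_right)
    also have "\<dots> = (1 + 8 * \<delta>) * J + 2 * ln 2" using l2 by simp
    also have "\<dots> \<le> (1 + 8 * \<delta>) * J + 2" using l2 by simp
    also have "\<dots> \<le> (1 + \<epsilon> / 2) * J" using J assms by (simp add: \<delta>_def field_simps)
    finally show "(real c1 + 1) * ln 2 \<le> (1 + \<epsilon> / 2) * J" .
    show "8 * d * J \<le> c3" "16 * J \<le> c3 * p" using c3 p by (auto simp: field_simps)
  qed (use assms p J1 in auto)
  then show ?thesis using that[of b J c1 c3] by (simp add: p_def b_def)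
qed

section \<open>Fan-free graphs\<close>

text \<open>Removing vertices of degree at most \<open>k\<close> one by one deletes at most
  \<open>k\<close> edges each time, and every edge is counted twice.\<close>

lemma degenerate_sum_le:
  fixes adj :: "'a \<Rightarrow> 'a \<Rightarrow> bool"
  assumes "finite F" "\<And>u v. adj u v \<Longrightarrow> adj v u" "\<And>u. \<not> adj u u"
    and "\<And>F'. F' \<subseteq> F \<Longrightarrow> F' \<noteq> {} \<Longrightarrow> \<exists>u\<in>F'. card {w\<in>F'. adj u w} \<le> k"
  shows "(\<Sum>u\<in>F. card {w\<in>F. adj u w}) \<le> 2 * k * card F"
  using assms(1,4)
proof (induction "card F" arbitrary: F)
  case 0
  then show ?case by simp
next
  case (Suc m)
  then have "F \<noteq> {}" by auto
  then obtain u where u: "u \<in> F" "card {w\<in>F. adj u w} \<le> k" using Suc.prems(2)[of F] by blast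
  define F' where "F' = F - {u}"
  have F: "F = insert u F'" "u \<notin> F'" "finite F'" using u Suc.prems(1) by (auto simp: F'_def)
  have IH: "(\<Sum>x\<in>F'. card {w\<in>F'. adj x w}) \<le> 2 * k * card F'"
    by (rule Suc.hyps(1)) (use Suc.hyps(2) Suc.prems F in auto)
  have nu: "{w\<in>F. adj u w} = {w\<in>F'. adj u w}" using assms(3) F by auto
  have "card {w\<in>F. adj x w} = card {w\<in>F'. adj x w} + of_bool (adj x u)" if "x \<in> F'" for x
  proof -
    have "{w\<in>F. adj x w} = (if adj x u then insert u {w\<in>F'. adj x w} else {w\<in>F'. adj x w})"
      using F by auto
    then show ?thesis using F by simp
  qed
  then have "(\<Sum>x\<in>F'. card {w\<in>F. adj x w}) = (\<Sum>x\<in>F'. card {w\<in>F'. adj x w}) + (\<Sum>x\<in>F'. of_bool (adj x u))"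
    by (simp add: sum.distrib)
  also have "(\<Sum>x\<in>F'. of_bool (adj x u)) = card {w\<in>F'. adj u w}"
  proof -
    have "F' \<inter> {x. adj x u} = {w\<in>F'. adj u w}" using assms(2) by auto
    then show ?thesis using F unfolding of_bool_def by (simp add: sum.If_cases)
  qed
  finally have "(\<Sum>x\<in>F'. card {w\<in>F. adj x w}) \<le> 2 * k * card F' + k" using IH u nu by simp
  moreover have "(\<Sum>x\<in>F. card {w\<in>F. adj x w}) = card {w\<in>F. adj u w} + (\<Sum>x\<in>F'. card {w\<in>F. adj x w})"
    unfolding F'_def by (rule sum.remove[OF Suc.prems(1) u(1)])
  moreover have "card F = card F' + 1" using F by simp
  ultimately show ?case using u by simp
qed

text \<open>A path on \<open>j + 1\<close> vertices is extended at its head: at most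
  \<open>j\<close> of the \<open>m > j\<close> neighbours of the head already lie on it.\<close>

lemma exists_path_of_min_degree:
  fixes adj :: "'a \<Rightarrow> 'a \<Rightarrow> bool"
  assumes "finite F" "F \<noteq> {}" "\<And>u v. adj u v \<Longrightarrow> adj v u" "\<And>u. \<not> adj u u"
    and deg: "\<And>u. u \<in> F \<Longrightarrow> m \<le> card {w\<in>F. adj u w}"
  shows "\<exists>xs. length xs = Suc m \<and> distinct xs \<and> set xs \<subseteq> F \<and> (\<forall>i<m. adj (xs ! i) (xs ! Suc i))"
proof -
  have "\<exists>xs. length xs = Suc j \<and> distinct xs \<and> set xs \<subseteq> F \<and> (\<forall>i<j. adj (xs ! i) (xs ! Suc i))" if "j \<le> m" for j
    using that
  proof (induction j)
    case 0
    obtain a where "a \<in> F" using assms(2) by blast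
    then show ?case by (intro exI[of _ "[a]"]) auto
  next
    case (Suc j)
    then obtain xs where xs: "length xs = Suc j" "distinct xs" "set xs \<subseteq> F" "\<forall>i<j. adj (xs ! i) (xs ! Suc i)" by auto
    then obtain a ys where a: "xs = a # ys" by (cases xs) auto
    have "{w\<in>F. adj a w} \<inter> set xs \<subseteq> set ys" using assms(4) a by auto
    then have "card ({w\<in>F. adj a w} \<inter> set xs) \<le> card (set ys)" by (intro card_mono) auto
    also have "\<dots> \<le> j" using xs(1) a card_length[of ys] by simp
    also have "\<dots> < m" using Suc.prems by simp
    also have "m \<le> card {w\<in>F. adj a w}" using deg xs(3) a by auto
    finally have "{w\<in>F. adj a w} \<inter> set xs \<noteq> {w\<in>F. adj a w}" by auto
    then obtain y where y: "y \<in> F" "adj a y" "y \<notin> set xs" by auto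
    have "\<forall>i<Suc j. adj ((y # xs) ! i) ((y # xs) ! Suc i)"
    proof (intro allI impI)
      fix i assume "i < Suc j"
      then show "adj ((y # xs) ! i) ((y # xs) ! Suc i)" using xs(4) y assms(3) a by (cases i) auto
    qed
    then show ?case using xs y by (intro exI[of _ "y # xs"]) auto
  qed
  then show ?thesis by blast
qed

lemma fan_simps:
  assumes "k \<ge> 3"
  shows "verts (fan k) = {..<k}"
    "edges (fan k) = {{i, Suc i} | i. Suc i < k - 1} \<union> {{i, k - 1} | i. i < k - 1}"
  using assms by (auto simp: fan_def path_graph_def Let_def)

lemma fan_copy_not_free:
  fixes G :: "'a ugraph"
  assumes G: "finite_simple_graph G" and k: "k \<ge> 3" and v: "v \<in> verts G"
    and xs: "length xs = k - 1" "distinct xs" "\<And>i. i < k - 1 \<Longrightarrow> {xs ! i, v} \<in> edges G"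
      "\<And>i. Suc i < k - 1 \<Longrightarrow> {xs ! i, xs ! Suc i} \<in> edges G"
  shows "\<not> free_of (fan k) G"
proof -
  define f where "f i = (if i < k - 1 then xs ! i else v)" for i
  define H where "H = \<lparr>verts = f ` {..<k}, edges = (\<lambda>e. f ` e) ` edges (fan k)\<rparr>"
  have card2: "e \<subseteq> verts G \<and> card e = 2" if "e \<in> edges G" for e using G that by (auto simp: finite_simple_graph_def)
  have "xs ! i \<noteq> v" if "i < k - 1" for i using card2[OF xs(3)[OF that]] by auto
  then have inj: "inj_on f {..<k}"
    using xs(1,2) by (auto simp: inj_on_def f_def nth_eq_iff_index_eq split: if_splits)
  have vx: "{v, xs ! i} \<in> edges G" if "i < k - 1" for i using xs(3)[OF that] by (simp add: insert_commute)
  have edge: "f ` e \<in> edges G" if "e \<in> edges (fan k)" for e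
    using that unfolding fan_simps[OF k] by (auto simp: f_def xs vx)
  have fsub: "e \<subseteq> {..<k}" if "e \<in> edges (fan k)" for e
    using that k unfolding fan_simps[OF k] by auto
  have "f ` {..<k} \<subseteq> verts G"
  proof
    fix y assume "y \<in> f ` {..<k}"
    then obtain i where i: "i < k" "y = f i" by auto
    show "y \<in> verts G"
    proof (cases "i < k - 1")
      case True
      then show ?thesis using card2[OF xs(3)[OF True]] i by (auto simp: f_def)
    qed (use i v in \<open>auto simp: f_def\<close>)
  qed
  then have "subgraph H G"
    unfolding subgraph_def finite_simple_graph_def H_def using edge card2 fsub by (auto simp: image_mono)
  moreover have "isomorphic (fan k) H"
    unfolding isomorphic_def using inj by (intro exI[of _ f]) (auto simp: H_def fan_simps(1)[OF k] bij_betw_def)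
  ultimately show ?thesis by (auto simp: free_of_def)
qed

text \<open>Numbering the vertices by \<open>g\<close> lets the existence result for arbitrary
  vertex types share its analysis with the algorithm, where \<open>g\<close> is the
  identity.\<close>

locale indexed_graph =
  fixes G :: "'a ugraph" and g :: "nat \<Rightarrow> 'a" and n k :: nat
  assumes G: "finite_simple_graph G" and g: "bij_betw g {0..<n} (verts G)"
    and k: "k \<ge> 3" and fan_free: "free_of (fan k) G"
begin

definition adj :: "nat \<Rightarrow> nat \<Rightarrow> bool" where "adj u v \<longleftrightarrow> u < n \<and> v < n \<and> {g u, g v} \<in> edges G"

lemma edge_card: "e \<in> edges G \<Longrightarrow> card e = 2"
  using G by (auto simp: finite_simple_graph_def)

sublocale graph_on n adj
proof
  show "adj u v \<Longrightarrow> adj v u" for u v by (simp add: adj_def insert_commute)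
  show "\<not> adj u u" for u using edge_card[of "{g u}"] by (auto simp: adj_def)
  show "adj u v \<Longrightarrow> u < n" for u v by (simp add: adj_def)
qed

lemma card_nb: "u < n \<Longrightarrow> card (nb u) = vertex_degree G (g u)"
proof -
  assume u: "u < n"
  have "bij_betw g (nb u) {w \<in> verts G. {w, g u} \<in> edges G}"
  proof (rule bij_betw_subset[OF g])
    show "nb u \<subseteq> {0..<n}" by (simp add: atLeast0LessThan nb_subset)
    show "g ` nb u = {w \<in> verts G. {w, g u} \<in> edges G}"
      unfolding bij_betw_imp_surj_on[OF g, symmetric] using u by (auto simp: nb_def adj_def insert_commute)
  qed
  then show ?thesis unfolding vertex_degree_def by (rule bij_betw_same_card)
qed

lemma maxdeg_eq: "maxdeg 0 = max_degree G"
proof -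
  have "vertex_degree G ` verts G = (\<lambda>v. card (nb v)) ` {0..<n}"
    using bij_betw_imp_surj_on[OF g] card_nb by (auto simp: image_image[symmetric] intro!: image_eqI)
  then show ?thesis by (simp add: maxdeg_def max_degree_def)
qed

text \<open>A path on \<open>k - 1\<close> vertices among the neighbours of \<open>v\<close> would
  form a fan with \<open>v\<close>. So every nonempty subset has a vertex with fewer than
  \<open>k - 2\<close> neighbours in it, and the cruder bound \<open>k\<close> makes the
  neighbourhood degenerate.\<close>

lemma sparse:
  assumes F: "F \<subseteq> nb v"
  shows "(\<Sum>u\<in>F. real (card {w\<in>F. adj u w})) \<le> real (2 * k) * card F"
proof -
  have "(\<Sum>u\<in>F. card {w\<in>F. adj u w}) \<le> 2 * k * card F"
  proof (rule degenerate_sum_le)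
    show "finite F" by (rule finite_subset[OF F finite_nb])
    fix F' assume F': "F' \<subseteq> F" "F' \<noteq> {}"
    show "\<exists>u\<in>F'. card {w\<in>F'. adj u w} \<le> k"
    proof (rule ccontr)
      assume "\<not> ?thesis"
      then have deg: "k - 2 \<le> card {w\<in>F'. adj u w}" if "u \<in> F'" for u using that by force
      have "finite F'" using finite_subset[OF order_trans[OF F'(1) F] finite_nb] .
      then obtain xs where xs: "length xs = Suc (k - 2)" "distinct xs" "set xs \<subseteq> F'"
        "\<forall>i<k - 2. adj (xs ! i) (xs ! Suc i)"
        using exists_path_of_min_degree[OF _ F'(2) adj_sym adj_irrefl deg] by blast
      have adjv: "adj v u" if "u \<in> set xs" for u using that xs(3) F' F by (auto simp: nb_def)
      have vn: "v < n" using adjv[of "xs ! 0"] xs(1) by (auto simp: adj_def)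
      have "\<not> free_of (fan k) G"
      proof (rule fan_copy_not_free[OF G k, of "g v" "map g xs"])
        show "g v \<in> verts G" using vn bij_betwE[OF g] by auto
        show "distinct (map g xs)" unfolding distinct_map using xs(2) adjv
          by (auto intro!: inj_on_subset[OF bij_betw_imp_inj_on[OF g]] simp: adj_def)
        show "{map g xs ! i, g v} \<in> edges G" if "i < k - 1" for i
          using adjv[of "xs ! i"] that xs(1) k by (auto simp: adj_def insert_commute)
        show "{map g xs ! i, map g xs ! Suc i} \<in> edges G" if "Suc i < k - 1" for i
          using xs(1,4) that k by (auto simp: adj_def)
      qed (use xs(1) k in auto)
      then show False using fan_free by simp
    qed
  qed (auto intro: adj_sym simp: adj_irrefl)
  then show ?thesis by (simp flip: of_nat_sum of_nat_mult)
qed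

end

section \<open>Existence and algorithm\<close>

definition polynomial_fun :: "(nat \<Rightarrow> nat) \<Rightarrow> bool" where "polynomial_fun f \<longleftrightarrow> (\<exists>P. \<forall>n. f n = poly P n)"

lemma polynomial_fun_intros:
  "polynomial_fun (\<lambda>n. n)" "polynomial_fun (\<lambda>n. c)"
  "polynomial_fun f \<Longrightarrow> polynomial_fun h \<Longrightarrow> polynomial_fun (\<lambda>n. f n + h n)"
  "polynomial_fun f \<Longrightarrow> polynomial_fun h \<Longrightarrow> polynomial_fun (\<lambda>n. f n * h n)"
proof -
  show "polynomial_fun (\<lambda>n. n)" unfolding polynomial_fun_def by (rule exI[of _ "[:0, 1:]"]) simp
  show "polynomial_fun (\<lambda>n. c)" unfolding polynomial_fun_def by (rule exI[of _ "[:c:]"]) simp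
  show "polynomial_fun f \<Longrightarrow> polynomial_fun h \<Longrightarrow> polynomial_fun (\<lambda>n. f n + h n)" unfolding polynomial_fun_def by (metis poly_add)
  show "polynomial_fun f \<Longrightarrow> polynomial_fun h \<Longrightarrow> polynomial_fun (\<lambda>n. f n * h n)" unfolding polynomial_fun_def by (metis poly_mult)
qed

definition nbrs_bound :: "(nat \<Rightarrow> nat) \<Rightarrow> nat \<Rightarrow> nat" where
  "nbrs_bound c n = n * (c n + adj_cost n + 20) + 10"

definition mix_bound :: "nat \<Rightarrow> nat \<Rightarrow> nat" where
  "mix_bound b n = 8 * (n + 1) + upd_cost n b + 20"

definition iter_bound :: "nat \<Rightarrow> nat \<Rightarrow> nat" where
  "iter_bound b n = (n * (n * (free_cost n + 10) + 30) + n * (n * (adj_cost n + 20) + 30) + 20) +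
     (n * (2 * nbrs_bound (\<lambda>n. upd_cost n b) n + 10) + 10) + nbrs_bound (\<lambda>n. n * n * (mix_bound b n + 5) + 10) n + 20"

text \<open>The running time with \<open>q\<close>, \<open>r\<close> and \<open>\<beta>\<close>
  replaced by \<open>n\<close>, \<open>n\<close> and \<open>n + 1\<close>, so that for a fixed
  program it depends on the input only through \<open>n\<close>.\<close>

definition time_bound :: "nat \<Rightarrow> nat \<Rightarrow> nat \<Rightarrow> nat \<Rightarrow> nat \<Rightarrow> nat" where
  "time_bound b J c1 c3 n = (n * n * (iter_bound b n + 5) + (n * ((n + 1) * (free_cost n + 10) + 40) + 10) + n * 10 + 30) +
     (n * 40 + n * (n * (adj_cost n + 10) + 30) + 2 * J + 2 * c1 + 2 * c3 + 100) + 1"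

lemma polynomial_fun_time_bound: "polynomial_fun (time_bound b J c1 c3)"
proof -
  have "polynomial_fun (\<lambda>n. time_bound b J c1 c3 n)"
    unfolding time_bound_def iter_bound_def mix_bound_def nbrs_bound_def upd_cost_def free_cost_def adj_cost_def
    by (intro polynomial_fun_intros)
  then show ?thesis .
qed

lemma (in machine) cost_le:
  assumes "q \<le> n" "r \<le> n" "\<beta> \<le> n + 1"
  shows "n * n * (iter_cost + 5) + greedy_cost + n * 10 + 30 + init_cost J c1 c3 + 1 \<le> time_bound b J c1 c3 n"
proof -
  have m: "mix_cost \<le> mix_bound b n" using assms by (simp add: mix_cost_def mix_bound_def)
  have "iter_cost \<le> iter_bound b n"
    unfolding iter_cost_def iter_bound_def scan_cost_def sweep_cost_def scan_nbrs_cost_def nbrs_cost_def nbrs_bound_def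
    by (intro add_mono mult_le_mono order_refl assms m)
  moreover have "greedy_cost \<le> n * ((n + 1) * (free_cost n + 10) + 40) + 10"
    unfolding greedy_cost_def by (intro add_mono mult_le_mono order_refl assms)
  ultimately show ?thesis unfolding time_bound_def init_cost_def
    by (intro add_mono mult_le_mono order_refl)
qed

locale fan_free_instance = indexed_graph G g n k + parameters "real (2 * k)" \<epsilon> \<delta> "1 / 2 ^ b" J c1 c3
  for G :: "'a ugraph" and g n k \<epsilon> \<delta> J c1 c3 and b :: nat +
  fixes D :: nat
  assumes b1: "b \<ge> 1" and Dmax: "max_degree G = D" and D2: "D \<ge> 2" and lgD: "large (real D)"
begin

definition L where "L = floor_log D"
definition M where "M = D div (J * L)"
definition lg_pool where "lg_pool = floor_log n + 1"

lemma D_le_n: "D \<le> n" using maxdeg_le[of 0] maxdeg_eq Dmax by simp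

lemma n2: "n \<ge> 2" using D_le_n D2 by linarith

lemma lg_pool_bounds: "n < 2 ^ lg_pool" "(2::nat) ^ lg_pool \<le> 2 * n" "lg_pool \<le> n + 1"
  using floor_log_exp2_gt[of n] floor_log_exp2_le[of n] n2 floor_log_le[of n] by (auto simp: lg_pool_def)

lemma D1: "D \<ge> 1" using D2 by simp

lemmas pars = refl D1 lgD L_def M_def

lemma ncol: "c1 * M + M + 1 \<le> D" by (rule ncol_le_D[OF pars])

sublocale machine n adj "c1 * M" b "c3 * L" M "2 ^ lg_pool" "n * n" lg_pool
proof
  show "c1 * M < 2 ^ lg_pool" using ncol D_le_n lg_pool_bounds by linarith
qed (use b1 n2 in auto)

lemma deg: "card (nb v) \<le> D" using card_nb_maxdeg maxdeg_eq Dmax by simp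

lemma iter_succeeds: "1 - (4 * (real (c1 * M) + 1)) ^ n * (1 / 2) ^ m \<le> (iter ^^ m) (\<lambda>\<sigma>. of_bool (flaws \<sigma> = {})) (\<lambda>_. 0)"
proof -
  have pp: "p = 1 / 2 ^ b" by (simp add: p_def)
  obtain Z :: nat and \<theta> :: real where Z: "0 \<le> \<theta>"
    "\<theta> * (1 / 2 ^ b * Z * (1 - real (2 * k) * (1 / 2 ^ b)) - \<theta> * (real Z)\<^sup>2 / 2) \<le> (1 - 1 / 2 ^ b) ^ Z / 2"
    "exp (real (c3 * L) + \<theta> * D - \<theta> * (1 / 2 ^ b * Z * (1 - real (2 * k) * (1 / 2 ^ b)) - \<theta> * (real Z)\<^sup>2 / 2) * (real (c1 * M))) \<le> target (real D)"
    by (rule sweep_le[OF pars])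
  \<comment> \<open>\<open>n * n\<close> attempts against a pool of at most \<open>2 * n\<close>
    numbers give an exponent of at least \<open>n / 4\<close>, and \<open>n \<ge> D\<close>.\<close>
  have y: "(1 - 1 / real (2 * 2 ^ lg_pool)) ^ (n * n) \<le> exp (- real D / 4)"
  proof -
    have pos: "(1::real) \<le> 2 * 2 ^ lg_pool" using one_le_power[of "2::real" lg_pool] by linarith
    have "(1 - 1 / real (2 * 2 ^ lg_pool)) ^ (n * n) \<le> exp (- (1 / real (2 * 2 ^ lg_pool))) ^ (n * n)"
      using pos exp_ge_add_one_self[of "- (1 / real (2 * 2 ^ lg_pool))"] by (intro power_mono) (auto simp: field_simps)
    also have "\<dots> = exp (- (real (n * n) / (2 * 2 ^ lg_pool)))" by (simp flip: exp_of_nat_mult)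
    also have "\<dots> \<le> exp (- real D / 4)"
    proof -
      have p2: "real (2 ^ lg_pool) \<le> real (2 * n)" using lg_pool_bounds(2) by (simp only: of_nat_le_iff)
      have "real D * (2 * 2 ^ lg_pool) \<le> real n * (2 * (2 * real n))"
        using p2 D_le_n by (intro mult_mono) auto
      then have "real D / 4 \<le> real (n * n) / (2 * 2 ^ lg_pool)" by (simp add: field_simps)
      then show ?thesis by simp
    qed
    finally show ?thesis .
  qed
  show ?thesis
  proof (rule iter_fails_le[where d = "real (2 * k)" and \<Delta> = D and \<theta> = \<theta> and Z = Z and e = "target (real D)"])
    show "(\<Sum>u\<in>F. real (card {w\<in>F. adj u w})) \<le> real (2 * k) * card F" if "F \<subseteq> nb v" for v F
      by (rule sparse[OF that])
    show "2 * real (2 * k) * D / (c3 * L) \<le> M / 2" by (rule high_degree_le[OF pars])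
    show "0 < c3 * L" by (rule c3_pos[OF pars])
    show "exp (- (M / 2) + 2 * blank_rate * D) \<le> target (real D)"
      using blank_le[OF pars y] by (simp only: blank_rate_def pp)
    show "12 * ((real D)\<^sup>2 + 1) * target (real D) \<le> 1"
    proof -
      have "0 < (real D)\<^sup>2 + 1" by (simp add: add_nonneg_pos)
      then show ?thesis by (simp add: target_def)
    qed
  qed (use Z deg in \<open>simp_all only: gain_def pp of_nat_0_le_iff\<close>)
qed

text \<open>A positive probability of ending without flaws implies that a flawless state exists.
  Here \<open>m\<close> may be as large as the instance requires.\<close>

lemma exists_complete_colouring: "\<exists>\<tau>. complete \<tau>"
proof -
  obtain m where m: "(4 * (real (c1 * M) + 1)) ^ n * (1 / 2) ^ m < 1"
  proof -
    have pos: "0 < (4 * (real (c1 * M) + 1)) ^ n" by (intro zero_less_power) (simp add: add_nonneg_pos)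
    obtain m where "(1 / 2 :: real) ^ m < 1 / (4 * (real (c1 * M) + 1)) ^ n"
      using real_arch_pow_inv[of "1 / (4 * (real (c1 * M) + 1)) ^ n" "1 / 2"] pos by auto
    then show ?thesis using that[of m] pos by (simp add: field_simps)
  qed
  have zero: "(\<lambda>_. 0) \<in> \<Omega>" by (simp add: \<Omega>_def)
  have mk: "markov (\<lambda>\<sigma> \<tau>. \<sigma> \<in> \<Omega> \<longrightarrow> \<tau> \<in> \<Omega>) (iter ^^ m)"
    by (intro markov_funpow markov_iter) (auto intro!: reflpI transpI)
  have "\<exists>\<sigma>\<in>\<Omega>. flaws \<sigma> = {}"
  proof (rule ccontr)
    assume "\<not> ?thesis"
    then have "(iter ^^ m) (\<lambda>\<sigma>. of_bool (flaws \<sigma> = {})) (\<lambda>_. 0) \<le> 0"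
      by (intro markov_le_const[OF mk]) (use zero in auto)
    then show False using iter_succeeds[of m] m by linarith
  qed
  then show ?thesis using exists_complete by blast
qed

lemma chromatic_number_le: "real (chromatic_number G) \<le> (1 + \<epsilon>) * D / ln D"
proof -
  obtain \<tau> where t: "complete \<tau>" using exists_complete_colouring by blast
  define h where "h = inv_into {0..<n} g"
  define c where "c = \<tau> \<circ> h"
  have h: "h x < n" "g (h x) = x" if "x \<in> verts G" for x
    using that bij_betw_imp_surj_on[OF g] inv_into_into[of x g "{0..<n}"] f_inv_into_f[of x g "{0..<n}"]
    by (auto simp: h_def)
  have "proper_colouring G c" unfolding proper_colouring_def
  proof (intro ballI impI)
    fix u v assume uv: "u \<in> verts G" "v \<in> verts G" "{u, v} \<in> edges G"
    then have "adj (h u) (h v)" using h by (simp add: adj_def)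
    then show "c u \<noteq> c v" using t by (simp add: complete_def c_def)
  qed
  then have "chromatic_number G \<le> num_colours G c"
    unfolding chromatic_number_def by (intro Least_le) blast
  also have "\<dots> \<le> card {1..c1 * M + M + 1}"
    unfolding num_colours_def by (intro card_mono) (use h t in \<open>auto simp: c_def complete_def\<close>)
  finally have "chromatic_number G \<le> c1 * M + M + 1" by simp
  then have "real (chromatic_number G) \<le> real (c1 * M + M + 1)" by (simp only: of_nat_le_iff)
  also have "\<dots> \<le> (1 + \<epsilon>) * real D / ln (real D)" by (rule ncol_le[OF pars])
  finally show ?thesis .
qed

end

definition colouring_com :: "nat \<Rightarrow> nat \<Rightarrow> nat \<Rightarrow> nat \<Rightarrow> com" where
  "colouring_com b J c1 c3 = init_com J c1 c3 ;; main_com b ;; greedy_com ;; copy_com"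

lemma colouring_prob_ge:
  fixes G :: "nat ugraph"
  assumes "fan_free_instance G id n k \<epsilon> \<delta> J c1 c3 b D" and vG: "verts G = {0..<n}" and D6: "D \<ge> 6"
  shows "1 - (1 / 2) ^ n \<le> colouring_prob (colouring_com b J c1 c3) (time_bound b J c1 c3 n) G ((1 + \<epsilon>) * D / ln D)"
proof -
  interpret fan_free_instance G id n k \<epsilon> \<delta> J c1 c3 b D by fact
  define q where "q = c1 * M"
  define X :: "state set" where "X = {s. proper_colouring G (mem s) \<and> real (num_colours G (mem s)) \<le> (1 + \<epsilon>) * D / ln D}"
  have adj_iff: "adj u v \<longleftrightarrow> {u, v} \<in> edges G" if "u < n" "v < n" for u v using that by (simp add: adj_def)
  define m where "m = mem (input_state G)"
  have mem: "m (u * n + v) = of_bool (adj u v)" if "u < n" "v < n" for u v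
    using that cell_less[OF that] by (simp add: m_def input_state_def Let_def vG adj_iff)
  have mem0: "m (n * n + v) = 0" for v by (simp add: m_def input_state_def Let_def vG)
  have good: "s \<in> X" if t: "complete \<tau>" and s: "\<And>v. v < n \<Longrightarrow> mem s v = \<tau> v" for s \<tau>
  proof -
    have "proper_colouring G (mem s)"
      using t s adj_iff unfolding proper_colouring_def complete_def vG by auto
    moreover have "real (num_colours G (mem s)) \<le> (1 + \<epsilon>) * D / ln D"
    proof -
      have "num_colours G (mem s) \<le> card {1..c1 * M + M + 1}"
        unfolding num_colours_def vG by (intro card_mono) (use t s in \<open>auto simp: complete_def\<close>)
      then have "num_colours G (mem s) \<le> c1 * M + M + 1" by simp
      then have "real (num_colours G (mem s)) \<le> real (c1 * M + M + 1)" by (simp only: of_nat_le_iff)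
      also have "\<dots> \<le> (1 + \<epsilon>) * real D / ln (real D)" by (rule ncol_le[OF pars])
      finally show ?thesis .
    qed
    ultimately show ?thesis by (simp add: X_def)
  qed
  \<comment> \<open>\<open>8 * n \<le> 2 ^ n\<close> holds from \<open>n = 6\<close> on, which is
    where \<open>D \<ge> 6\<close> enters. As the colours of the walk number fewer than
    \<open>n\<close>, each of the \<open>n\<close> factors \<open>4 * (c1 * M + 1) / 2 ^ n\<close>
    is at most \<open>1 / 2\<close>.\<close>
  have "(4 * (real (c1 * M) + 1)) ^ n * (1 / 2) ^ (n * n) \<le> (1 / 2) ^ n"
  proof -
    have n6: "n \<ge> 6" using D_le_n D6 by linarith
    then have "8 * n \<le> 2 ^ n"
      by (induction n rule: dec_induct) auto
    then have "8 * real n \<le> 2 ^ n" by (metis of_nat_le_iff of_nat_mult of_nat_numeral of_nat_power)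
    moreover have "real (c1 * M) + 1 \<le> n"
    proof -
      have "c1 * M + 1 \<le> n" using ncol D_le_n by linarith
      then show ?thesis by (metis of_nat_1 of_nat_add of_nat_le_iff)
    qed
    ultimately have "4 * (real (c1 * M) + 1) * (1 / 2) ^ n \<le> 1 / 2"
      by (simp add: power_one_over field_simps)
    then have "(4 * (real (c1 * M) + 1) * (1 / 2) ^ n) ^ n \<le> (1 / 2) ^ n"
      by (intro power_mono) auto
    then show ?thesis by (simp add: power_mult_distrib power_mult)
  qed
  then have "1 - (1 / 2) ^ n \<le> (iter ^^ (n * n)) (\<lambda>\<sigma>. of_bool (flaws \<sigma> = {})) (\<lambda>_. 0)"
    using iter_succeeds[of "n * n"] by linarith
  also have "\<dots> \<le> success X (time_bound b J c1 c3 n) ([colouring_com b J c1 c3], input_state G)"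
  proof -
    define t1 where "t1 = n * n * (iter_cost + 5) + greedy_cost + n * 10 + 30"
    have i: "hoare (\<lambda>s. regs s 0 = n \<and> regs s 2 = 0 \<and> mem s = m) (init_com J c1 c3) (init_cost J c1 c3)
       (base m (\<lambda>g. g 3 = n * n \<and> g 4 = c1 * M \<and> g 5 = M \<and> g 6 = c3 * L \<and> g 7 = 2 ^ lg_pool))"
      using hoare_init[of J m c1 c3] n2 J D2 mem maxdeg_eq Dmax by (simp add: L_def M_def lg_pool_def)
    have "(iter ^^ (n * n)) (\<lambda>\<sigma>. of_bool (flaws \<sigma> = {})) (\<lambda>_. 0)
      \<le> success X (t1 + init_cost J c1 c3) (init_com J c1 c3 # [main_com b ;; greedy_com ;; copy_com], input_state G)"
    proof (rule hoareD[OF i])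
      show "regs (input_state G) 0 = n \<and> regs (input_state G) 2 = 0 \<and> mem (input_state G) = m"
        by (simp add: m_def) (simp add: input_state_def Let_def vG)
      fix s assume "base m (\<lambda>g. g 3 = n * n \<and> g 4 = c1 * M \<and> g 5 = M \<and> g 6 = c3 * L \<and> g 7 = 2 ^ lg_pool) s"
      then have "env (\<lambda>_. 0) s" using mem mem0 by (auto simp: env_def consts_ok_def adj_ok_def base_def)
      then show "(iter ^^ (n * n)) (\<lambda>\<sigma>. of_bool (flaws \<sigma> = {})) (\<lambda>_. 0) \<le> success X t1 ([main_com b ;; greedy_com ;; copy_com], s)"
        by (rule success_main) (use good in \<open>auto simp: t1_def\<close>)
    qed
    also have "\<dots> = success X (Suc (t1 + init_cost J c1 c3)) ([colouring_com b J c1 c3], input_state G)"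
      unfolding colouring_com_def by (simp only: success_step)
    also have "\<dots> \<le> success X (time_bound b J c1 c3 n) ([colouring_com b J c1 c3], input_state G)"
    proof (rule success_mono)
      have "c1 * M \<le> n" "M \<le> n" using ncol D_le_n by auto
      then show "Suc (t1 + init_cost J c1 c3) \<le> time_bound b J c1 c3 n"
        using cost_le[OF _ _ lg_pool_bounds(3), of J c1 c3] by (simp add: t1_def)
    qed
    finally show ?thesis .
  qed
  also have "\<dots> = colouring_prob (colouring_com b J c1 c3) (time_bound b J c1 c3 n) G ((1 + \<epsilon>) * D / ln D)"
    unfolding colouring_prob_def success_def X_def output_colouring_def by simp
  finally show ?thesis .
qed

text \<open>The constants \<open>b\<close>, \<open>J\<close>, \<open>c1\<close> and
  \<open>c3\<close> depend on \<open>k\<close> and \<open>\<epsilon>\<close> only. The program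
  computes the maximum degree from its input, so one program serves all
  \<open>\<Delta>\<close>.\<close>

theorem theorem1p3:
  fixes k :: nat and \<epsilon> :: real
  assumes "k \<ge> 3" and "\<epsilon> > 0"
  shows "\<exists>\<Delta>\<^sub>0 :: nat.
    (\<forall>\<Delta>\<ge>\<Delta>\<^sub>0. \<forall>G :: 'a ugraph.
       finite_simple_graph G \<and> free_of (fan k) G \<and> max_degree G = \<Delta> \<longrightarrow>
       real (chromatic_number G) \<le> (1 + \<epsilon>) * real \<Delta> / ln (real \<Delta>)) \<and>
    (\<exists>(A :: com) (p :: nat poly) (\<delta> :: nat \<Rightarrow> real).
       \<delta> \<longlonglongrightarrow> 0 \<and>
       (\<forall>\<Delta>\<ge>\<Delta>\<^sub>0. \<forall>n. \<forall>G :: nat ugraph.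
          finite_simple_graph G \<and> verts G = {0..<n} \<and>
          free_of (fan k) G \<and> max_degree G = \<Delta> \<longrightarrow>
          colouring_prob A (poly p n) G ((1 + \<epsilon>) * real \<Delta> / ln (real \<Delta>)) \<ge> 1 - \<delta> n))"
proof -
  \<comment> \<open>The parameters are chosen for values up to \<open>1\<close>; a larger
    \<open>\<epsilon>\<close> only weakens the bound on the number of colours.\<close>
  define e where "e = min \<epsilon> 1"
  have e: "0 < e" "e \<le> 1" "e \<le> \<epsilon>" using assms by (auto simp: e_def)
  obtain b J c1 c3 where b: "b \<ge> 1" and par: "parameters (real (2 * k)) e (e / 32) (1 / 2 ^ b) J c1 c3"
    by (rule exists_parameters[OF e(1,2), of "real (2 * k)"]) simp
  interpret parameters "real (2 * k)" e "e / 32" "1 / 2 ^ b" J c1 c3 by (rule par)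
  have "eventually (\<lambda>D. large (real D)) sequentially"
    using eventually_large filterlim_real_sequentially by (rule eventually_compose_filterlim)
  then obtain N where N: "\<And>D. D \<ge> N \<Longrightarrow> large (real D)" by (auto simp: eventually_sequentially)
  define D0 where "D0 = max N 6"
  obtain P where P: "\<And>n. time_bound b J c1 c3 n = poly P n"
    using polynomial_fun_time_bound[of b J c1 c3] by (auto simp: polynomial_fun_def)
  have mono: "(1 + e) * real D / ln (real D) \<le> (1 + \<epsilon>) * real D / ln (real D)" if "D \<ge> D0" for D
    using that e by (intro divide_right_mono mult_right_mono) (auto simp: D0_def)
  have inst: "fan_free_instance G g n k e (e / 32) J c1 c3 b D"
    if "D \<ge> D0" "finite_simple_graph G" "free_of (fan k) G" "max_degree G = D" "bij_betw g {0..<n} (verts G)"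
    for D n and G :: "'c ugraph" and g
    by unfold_locales (use that assms b N in \<open>auto simp: D0_def\<close>)
  show ?thesis
  proof (intro exI[of _ D0] exI[of _ "colouring_com b J c1 c3"] exI[of _ P] exI[of _ "\<lambda>n. (1 / 2) ^ n"] conjI allI impI)
    fix D and G :: "'a ugraph"
    assume D: "D \<ge> D0" and h: "finite_simple_graph G \<and> free_of (fan k) G \<and> max_degree G = D"
    obtain g where g: "bij_betw g {0..<card (verts G)} (verts G)"
      using ex_bij_betw_nat_finite[of "verts G"] h by (auto simp: finite_simple_graph_def)
    have "real (chromatic_number G) \<le> (1 + e) * real D / ln (real D)"
      by (rule fan_free_instance.chromatic_number_le[OF inst[OF D _ _ _ g]]) (use h in auto)
    then show "real (chromatic_number G) \<le> (1 + \<epsilon>) * real D / ln (real D)" using mono[OF D] by linarith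
  next
    show "(\<lambda>n. (1 / 2) ^ n :: real) \<longlonglongrightarrow> 0" by (rule LIMSEQ_power_zero) auto
  next
    fix D n and G :: "nat ugraph"
    assume D: "D \<ge> D0" and h: "finite_simple_graph G \<and> verts G = {0..<n} \<and> free_of (fan k) G \<and> max_degree G = D"
    have "1 - (1 / 2) ^ n \<le> colouring_prob (colouring_com b J c1 c3) (time_bound b J c1 c3 n) G ((1 + e) * real D / ln (real D))"
      by (rule colouring_prob_ge[OF inst[OF D]]) (use h D in \<open>auto simp: D0_def\<close>)
    also have "\<dots> \<le> colouring_prob (colouring_com b J c1 c3) (poly P n) G ((1 + \<epsilon>) * real D / ln (real D))"
      unfolding colouring_prob_def P[symmetric]
      by (rule measure_pmf.finite_measure_mono) (use mono[OF D] in auto)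
    finally show "1 - (1 / 2) ^ n \<le> colouring_prob (colouring_com b J c1 c3) (poly P n) G ((1 + \<epsilon>) * real D / ln (real D))" .
  qed
qed

end
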